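(* In the $(n_0,n_1,\ldots,n_N)$ multihop channel, the project-and-forward (PF) scheme is equivalent to the amplify-and-forward (AF) scheme, i.e. the two schemes have the same DMT.
   Context: Multihop channel: layers $0,\ldots,N$ with $n_i$ antennas in layer $i$; $\mathbf y_i=\mathbf H_i\mathbf x_{i-1}+\mathbf z_i$, where $\mathbf H_i\in\mathbb C^{n_i\times n_{i-1}}$ are mutually independent with i.i.d. $\mathcal{CN}(0,1)$ entries and $\mathbf z_i$ has i.i.d. $\mathcal{CN}(0,1)$ entries. Relays within a layer are clustered and know the receive channel. AF scheme: equivalent in DMT to the MIMO channel with matrix $\mathbf H_N\mathbf D_{N-1}\mathbf H_{N-1}\cdots\mathbf D_1\mathbf H_1$, where $\mathbf D_i$ is diagonal with entries $$\mathbf D_i(j,j)=\min\Big\{\kappa,\Big(\tfrac{\mathsf{SNR}}{n_{i-1}}\sum_k|\mathbf H_i(j,k)|^2+1\Big)^{-1/2}\sqrt{\mathsf{SNR}/n_i}\Big\},$$ with $0<\kappa<\infty$ a constant independent of $\mathsf{SNR}$. PF scheme: set $r_0:=n_0$ and $\underline{\mathbf H}_1:=\mathbf H_1$. Recursively, for layer $i$ let $r_i$ be the rank of the effective channel matrix $\underline{\mathbf H}_i\in\mathbb C^{n_i\times r_{i-1}}$, and write $\underline{\mathbf H}_i=\underline{\mathbf Q}_i\underline{\mathbf G}_i$ with $\underline{\mathbf Q}_i\in\mathbb C^{n_i\times r_i}$, $\underline{\mathbf Q}_i^\dagger\underline{\mathbf Q}_i=\mathbf I$, $\underline{\mathbf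 G}_i\in\mathbb C^{r_i\times r_{i-1}}$, where $\underline{\mathbf Q}_i$ is obtained by the QR decomposition of $\underline{\mathbf H}_i$ if $n_i>r_{i-1}$ and is the identity if $n_i\le r_{i-1}$. The received signal is projected as $\underline{\mathbf Q}_i^\dagger\mathbf y_i$, normalized component-wise by an $r_i\times r_i$ diagonal matrix $\underline{\mathbf D}_i$ analogous to that of the AF scheme (each component is normalized to power $\mathsf{SNR}/r_i$, with the same truncation by a constant $\kappa$), and transmitted with $r_i$ of the $n_i$ antennas. Thus $\underline{\mathbf H}_{i+1}\in\mathbb C^{n_{i+1}\times r_i}$ consists of the corresponding $r_i$ columns of $\mathbf H_{i+1}$. With $\mathbf P_i:=\underline{\mathbf D}_i\underline{\mathbf Q}_i^\dagger$, the PF multihop channel is equivalent in DMT to the MIMO channel with matrix $\boldsymbol\Pi_{\rm PF}=\underline{\mathbf H}_N\mathbf P_{N-1}\cdots\underline{\mathbf H}_2\mathbf P_1\underline{\mathbf H}_1$. DMT of a MIMO channel $\mathbf H$: $d(r)=-\lim_{\mathsf{SNR}\to\infty}\log\mathsf P\{\log\det(\mathbf I+\mathsf{SNR}\,\mathbf H\mathbf H^\dagger)<R\}/\log\mathsf{SNR}$, with $R=r\log\mathsf{SNR}$ for $r>0$ and $R>0$ fixed for $r=0$. *)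

theory Defs
  imports
    "HOL-Probability.Probability"
    "Jordan_Normal_Form.Schur_Decomposition"
    "Jordan_Normal_Form.DL_Rank"
begin

unbundle no vec_syntax

subsection \<open>The multihop channel\<close>

text \<open>\<open>H i\<close> is the channel matrix between layers \<open>i - 1\<close> and \<open>i\<close>, and \<open>n i\<close> is the
  number of antennas of layer \<open>i\<close>. A circularly symmetric standard complex Gaussian variable
  has density \<open>exp (-|z|^2) / pi\<close> with respect to Lebesgue measure on the complex plane.
  Joint independence of all entries of all matrices is the same as independence of the matrices
  together with independence of the entries within each of them.\<close>

locale multihop_channel = prob_space M for M :: "'a measure" +
  fixes N :: nat and n :: "nat \<Rightarrow> nat" and H :: "nat \<Rightarrow> 'a \<Rightarrow> complex mat"
  assumes hops: "1 \<le> N"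
    and antennas: "\<And>i. i \<le> N \<Longrightarrow> 1 \<le> n i"
    and H_carrier: "\<And>i \<omega>. i \<in> {1..N} \<Longrightarrow> \<omega> \<in> space M \<Longrightarrow> H i \<omega> \<in> carrier_mat (n i) (n (i - 1))"
    and H_gaussian: "\<And>i j k. i \<in> {1..N} \<Longrightarrow> j < n i \<Longrightarrow> k < n (i - 1) \<Longrightarrow>
      distributed M lborel (\<lambda>\<omega>. H i \<omega> $$ (j, k)) (\<lambda>z. ennreal (exp (- (cmod z)\<^sup>2) / pi))"
    and H_indep: "indep_vars (\<lambda>_. borel) (\<lambda>(i, j, k) \<omega>. H i \<omega> $$ (j, k))
      {(i, j, k). i \<in> {1..N} \<and> j < n i \<and> k < n (i - 1)}"

subsection \<open>Power normalization at a relay layer\<close>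

text \<open>\<open>G\<close> is the matrix seen by the signal to be normalized: its columns correspond to the
  transmitting antennas of the previous layer (each with power \<open>snr / dim_col G\<close>), its rows to the
  components that are retransmitted (each with power \<open>snr / dim_row G\<close>).\<close>

definition normalizer :: "real \<Rightarrow> real \<Rightarrow> complex mat \<Rightarrow> complex mat" where
  "normalizer \<kappa> snr G = mat (dim_row G) (dim_row G) (\<lambda>(j, l).
     if j = l then complex_of_real (min \<kappa>
       ((snr / real (dim_col G) * (\<Sum>k<dim_col G. (cmod (G $$ (j, k)))\<^sup>2) + 1) powr (- 1 / 2)
        * sqrt (snr / real (dim_row G))))
     else 0)"

subsection \<open>Amplify-and-forward\<close>

text \<open>\<open>h\<close> is a realization of the channel matrices; \<open>AF_matrix \<kappa> snr h N\<close> is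
  \<open>h N * D (N - 1) * h (N - 1) * ... * D 1 * h 1\<close>. The value at \<open>0\<close> is a dummy.\<close>

fun AF_matrix :: "real \<Rightarrow> real \<Rightarrow> (nat \<Rightarrow> complex mat) \<Rightarrow> nat \<Rightarrow> complex mat" where
  "AF_matrix \<kappa> snr h 0 = 1\<^sub>m (dim_col (h 1))"
| "AF_matrix \<kappa> snr h (Suc 0) = h 1"
| "AF_matrix \<kappa> snr h (Suc (Suc i)) =
     h (Suc (Suc i)) * normalizer \<kappa> snr (h (Suc i)) * AF_matrix \<kappa> snr h (Suc i)"

subsection \<open>Project-and-forward\<close>

abbreviation mrank :: "complex mat \<Rightarrow> nat" where
  "mrank A \<equiv> vec_space.rank (dim_row A) A"

text \<open>The \<open>Q\<close> factor of the thin QR decomposition, computed by Gram-Schmidt. A column that depends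
  linearly on its predecessors is turned into the zero vector by \<^const>\<open>gram_schmidt\<close> (division by
  zero yields zero in its definition) and is dropped, so that the number of columns of the factor
  is the rank of \<open>A\<close>.\<close>

definition qr_Q :: "complex mat \<Rightarrow> complex mat" where
  "qr_Q A = mat_of_cols (dim_row A)
     (map (\<lambda>v. complex_of_real (1 / sqrt (Re (v \<bullet>c v))) \<cdot>\<^sub>v v)
       (filter (\<lambda>v. v \<noteq> 0\<^sub>v (dim_row A)) (gram_schmidt (dim_row A) (cols A))))"

text \<open>\<open>H\<close> is an effective channel matrix. When \<open>dim_row H \<le> dim_col H\<close> but the rank is smaller than
  \<open>dim_row H\<close> (an event of probability zero), the identity does not have the \<open>mrank H\<close> columns that
  are required, and the QR factor is used instead.\<close>

definition PF_Q :: "complex mat \<Rightarrow> complex mat" where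
  "PF_Q H = (if dim_row H \<le> dim_col H \<and> mrank H = dim_row H then 1\<^sub>m (dim_row H) else qr_Q H)"

definition PF_P :: "real \<Rightarrow> real \<Rightarrow> complex mat \<Rightarrow> complex mat" where
  "PF_P \<kappa> snr H = normalizer \<kappa> snr (mat_adjoint (PF_Q H) * H) * mat_adjoint (PF_Q H)"

text \<open>Which \<open>r\<close> of the \<open>n i\<close> antennas of layer \<open>i\<close> transmit is an arbitrary fixed choice, given by
  \<open>sel i r 0, ..., sel i r (r - 1)\<close>.\<close>

definition antenna_selection :: "nat \<Rightarrow> (nat \<Rightarrow> nat) \<Rightarrow> (nat \<Rightarrow> nat \<Rightarrow> nat \<Rightarrow> nat) \<Rightarrow> bool" where
  "antenna_selection N n sel \<longleftrightarrow>
     (\<forall>i\<in>{1..<N}. \<forall>r\<le>n i. inj_on (sel i r) {..<r} \<and> sel i r ` {..<r} \<subseteq> {..<n i})"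

fun PF_eff :: "(nat \<Rightarrow> nat \<Rightarrow> nat \<Rightarrow> nat) \<Rightarrow> (nat \<Rightarrow> complex mat) \<Rightarrow> nat \<Rightarrow> complex mat" where
  "PF_eff sel h 0 = 1\<^sub>m (dim_col (h 1))"
| "PF_eff sel h (Suc 0) = h 1"
| "PF_eff sel h (Suc (Suc i)) =
     (let r = mrank (PF_eff sel h (Suc i)) in
      mat (dim_row (h (Suc (Suc i)))) r (\<lambda>(j, k). h (Suc (Suc i)) $$ (j, sel (Suc i) r k)))"

fun PF_matrix ::
  "(nat \<Rightarrow> nat \<Rightarrow> nat \<Rightarrow> nat) \<Rightarrow> real \<Rightarrow> real \<Rightarrow> (nat \<Rightarrow> complex mat) \<Rightarrow> nat \<Rightarrow> complex mat" where
  "PF_matrix sel \<kappa> snr h 0 = 1\<^sub>m (dim_col (h 1))"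
| "PF_matrix sel \<kappa> snr h (Suc 0) = PF_eff sel h 1"
| "PF_matrix sel \<kappa> snr h (Suc (Suc i)) =
     PF_eff sel h (Suc (Suc i)) * PF_P \<kappa> snr (PF_eff sel h (Suc i)) * PF_matrix sel \<kappa> snr h (Suc i)"

subsection \<open>Diversity-multiplexing tradeoff\<close>

definition outage_prob ::
  "'a measure \<Rightarrow> (real \<Rightarrow> 'a \<Rightarrow> complex mat) \<Rightarrow> real \<Rightarrow> real \<Rightarrow> real" where
  "outage_prob M A R snr = measure M {\<omega> \<in> space M.
     ln (Re (Determinant.det (1\<^sub>m (dim_row (A snr \<omega>)) +
       complex_of_real snr \<cdot>\<^sub>m (A snr \<omega> * mat_adjoint (A snr \<omega>))))) < R}"

text \<open>Logarithm with \<open>log 0 = -\<infinity>\<close>, as opposed to \<open>ln 0 = 0\<close>.\<close>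

definition ext_ln :: "real \<Rightarrow> ereal" where
  "ext_ln p = (if p = 0 then - \<infinity> else ereal (ln p))"

text \<open>The family \<open>A\<close> of random matrices, indexed by the SNR, has diversity \<open>d\<close> at
  multiplexing gain \<open>r\<close>; this includes existence of the limit. For \<open>r = 0\<close> the target rate is the
  constant \<open>R0\<close>.\<close>

definition has_DMT ::
  "'a measure \<Rightarrow> (real \<Rightarrow> 'a \<Rightarrow> complex mat) \<Rightarrow> real \<Rightarrow> real \<Rightarrow> ereal \<Rightarrow> bool" where
  "has_DMT M A R0 r d \<longleftrightarrow>
     ((\<lambda>snr. - (ext_ln (outage_prob M A (if r = 0 then R0 else r * ln snr) snr) / ereal (ln snr)))
       \<longlongrightarrow> d) at_top"

subsection \<open>Correctness of the QR factor\<close>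

abbreviation nonzero_vecs :: "nat \<Rightarrow> complex vec list \<Rightarrow> complex vec list" where
  "nonzero_vecs m \<equiv> filter (\<lambda>v. v \<noteq> 0\<^sub>v m)"

lemma adjuster_carrier': "w \<in> carrier_vec m \<Longrightarrow> set us \<subseteq> carrier_vec m \<Longrightarrow> adjuster m w us \<in> carrier_vec m"
  by (induction us) auto

lemma adjuster_nonzero_vecs:
  assumes "w \<in> carrier_vec m" "set us \<subseteq> carrier_vec m"
  shows "adjuster m (w::complex vec) us = adjuster m w (nonzero_vecs m us)"
  using assms(2)
proof (induction us)
  case (Cons u us)
  have "adjuster m w (nonzero_vecs m us) \<in> carrier_vec m" by (rule adjuster_carrier'[OF assms(1)]) (use Cons in auto)
  then show ?case using Cons assms(1) by auto
qed simp

definition gs_inv :: "nat \<Rightarrow> complex vec list \<Rightarrow> complex vec list \<Rightarrow> bool" where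
  "gs_inv m us ps \<longleftrightarrow>
  (set us \<subseteq> carrier_vec m \<and> set ps \<subseteq> carrier_vec m \<and> length (nonzero_vecs m us) \<le> length ps \<and> corthogonal (nonzero_vecs m us) \<and>
   LinearCombinations.module.span class_ring (module_vec TYPE(complex) m) (set (nonzero_vecs m us)) = LinearCombinations.module.span class_ring (module_vec TYPE(complex) m) (set ps) \<and>
   \<not> LinearCombinations.module.lin_dep class_ring (module_vec TYPE(complex) m) (set (nonzero_vecs m us)) \<and>
   (\<forall>i<length (nonzero_vecs m us). \<forall>j<i. ps ! j \<bullet>c (rev (nonzero_vecs m us)) ! i = (0::complex)))"

lemma gs_step:
  assumes I: "gs_inv m us ps" and w: "w \<in> carrier_vec m"
  shows "gs_inv m ((adjuster m w us + w) # us) (ps @ [w])"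
proof -
  interpret V: cof_vec_space m "TYPE(complex)" .
  let ?F = "nonzero_vecs m us" let ?u = "adjuster m w us + w"
  from I have U: "set us \<subseteq> carrier_vec m" and P: "set ps \<subseteq> carrier_vec m" and len: "length ?F \<le> length ps"
    and co: "corthogonal ?F" and sp: "V.span (set ?F) = V.span (set ps)" and li: "\<not> V.lin_dep (set ?F)"
    and tri: "\<And>i j. i<length ?F \<Longrightarrow> j<i \<Longrightarrow> ps ! j \<bullet>c (rev ?F) ! i = 0"
    by (use I[unfolded gs_inv_def] in blast)+
  have FU: "set ?F \<subseteq> carrier_vec m" using U by auto
  have dist: "distinct ?F" using corthogonal_distinct[OF co] .
  have ueq: "?u = adjuster m w ?F + w" using adjuster_nonzero_vecs[OF w U] by simp
  have uc: "?u \<in> carrier_vec m" using adjuster_carrier'[OF w U] w by auto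
  have orth: "?u \<bullet>c v = 0" if v: "v \<in> set ?F" for v
  proof -
    obtain i where "i < length ?F" "v = ?F ! i" using v unfolding in_set_conv_nth by blast
    then show ?thesis unfolding ueq using V.adjust_zero[OF FU co w, of i] by simp
  qed
  have spw: "V.span (set ((adjuster m w ?F + w) # ?F)) = V.span (set (w # ?F))"
    by (rule V.gram_schmidt_sub_span[OF w FU dist])
  have spu: "V.span (insert w (set ?F)) = V.span (set (ps @ [w]))"
  proof -
    have "V.span ({w} \<union> set ?F) = V.span ({w} \<union> set ps)"
      by (rule V.span_Un[OF _ _ _ FU P sp]) (use w in simp_all)
    then show ?thesis by simp
  qed
  have sporth: "x \<bullet>c ?u = 0" if x: "x \<in> V.span (set ?F)" for x
  proof -
    obtain a where a: "x = V.lincomb a (set ?F)" using x V.finite_span[OF finite_set FU] by blast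
    have cu: "conjugate ?u \<in> carrier_vec m" using uc by auto
    have "x \<bullet>c ?u = (\<Sum>v\<in>set ?F. (a v \<cdot>\<^sub>v v) \<bullet>c ?u)"
      unfolding a V.lincomb_def by (rule V.finsum_scalar_prod_sum[OF _ cu]) (use FU in blast)
    also have "\<dots> = 0"
    proof (rule sum.neutral, rule)
      fix v assume v: "v \<in> set ?F"
      have vc: "v \<in> carrier_vec m" using v FU by auto
      have "conjugate (?u \<bullet>c v) = conjugate ?u \<bullet> v"
        using conjugate_sprod_vec[OF uc, of "conjugate v"] vc by simp
      also have "\<dots> = v \<bullet>c ?u" by (rule comm_scalar_prod[OF cu vc])
      finally have "conjugate (?u \<bullet>c v) = v \<bullet>c ?u" .
      then have "v \<bullet>c ?u = 0" using orth[OF v] by simp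
      then show "(a v \<cdot>\<^sub>v v) \<bullet>c ?u = 0" using scalar_prod_smult_left[of v "conjugate ?u" "a v"] carrier_vecD[OF vc] carrier_vecD[OF cu] by simp
    qed
    finally show ?thesis .
  qed
  show ?thesis
  proof (cases "?u = 0\<^sub>v m")
    case True
    have 0: "0\<^sub>v m \<in> V.span (set ?F)"
      using V.span_empty V.span_is_monotone[of "{}" "set ?F"] by (simp add: module_vec_simps)
    have "V.span (set ?F) = V.span (insert (0\<^sub>v m) (set ?F))"
      using V.already_in_span[OF FU 0] by simp
    also have "\<dots> = V.span (set ((adjuster m w ?F + w) # ?F))"
      unfolding ueq[symmetric] True by simp
    also have "\<dots> = V.span (set (ps @ [w]))" using spw spu by simp
    finally have sp': "V.span (set ?F) = V.span (set (ps @ [w]))" .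
    have nth': "(ps @ [w]) ! j = ps ! j" if "i < length ?F" "j < i" for i j
      using that len by (simp add: nth_append)
    have F': "nonzero_vecs m (?u # us) = ?F" using True by simp
    show ?thesis unfolding gs_inv_def F'
    proof (intro conjI)
      show "set (?u # us) \<subseteq> carrier_vec m" using uc U by simp
      show "set (ps @ [w]) \<subseteq> carrier_vec m" using P w by simp
      show "length ?F \<le> length (ps @ [w])" using len by simp
      show "\<forall>i<length ?F. \<forall>j<i. (ps @ [w]) ! j \<bullet>c rev ?F ! i = 0" using tri nth' by metis
    qed (fact co sp' li)+
  next
    case False
    have ns: "w \<notin> V.span (set ?F)"
    proof
      assume "w \<in> V.span (set ?F)"
      then have "?u \<in> V.span (set ?F)" using V.adjust_preserves_span[OF w FU dist] ueq by simp
      from sporth[OF this] have "?u = 0\<^sub>v m" using conjugate_square_eq_0_vec[OF uc] by simp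
      then show False using False by simp
    qed
    have co': "corthogonal (?u # ?F)" using V.adjust_orthogonal[OF FU co w ns] ueq by simp
    have li': "\<not> V.lin_dep (insert ?u (set ?F))" using V.adjust_not_lindep[OF w FU dist ns li] ueq by simp
    have tri': "(ps @ [w]) ! j \<bullet>c rev (?u # ?F) ! i = 0" if "i < length (?u # ?F)" "j < i" for i j
    proof (cases "i < length ?F")
      case True
      then have "(ps @ [w]) ! j = ps ! j" "rev (?u # ?F) ! i = rev ?F ! i" using that len by (simp_all add: nth_append)
      then show ?thesis using tri[OF True that(2)] by simp
    next
      case False
      then have i: "i = length ?F" using that by simp
      then have "j < length ps" using that len by simp
      then have "ps ! j \<in> V.span (set ?F)" unfolding sp using V.span_mem[OF P] by auto
      from sporth[OF this] show ?thesis using i \<open>j < length ps\<close> by (simp add: nth_append)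
    qed
    have F': "nonzero_vecs m (?u # us) = ?u # ?F" using False by simp
    show ?thesis unfolding gs_inv_def F'
    proof (intro conjI)
      show "set (?u # us) \<subseteq> carrier_vec m" using uc U by simp
      show "set (ps @ [w]) \<subseteq> carrier_vec m" using P w by simp
      show "length (?u # ?F) \<le> length (ps @ [w])" using len by simp
      show "V.span (set (?u # ?F)) = V.span (set (ps @ [w]))" using spw spu ueq by simp
      show "\<not> V.lin_dep (set (?u # ?F))" using li' by simp
      show "\<forall>i<length (?u # ?F). \<forall>j<i. (ps @ [w]) ! j \<bullet>c rev (?u # ?F) ! i = 0" using tri' by blast
    qed (fact co')
  qed
qed

lemma gs_inv_sub: "gs_inv m us ps \<Longrightarrow> set ws \<subseteq> carrier_vec m \<Longrightarrow> gs_inv m (gram_schmidt_sub m us ws) (ps @ ws)"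
proof (induction ws arbitrary: us ps)
  case (Cons w ws)
  have "gs_inv m ((adjuster m w us + w) # us) (ps @ [w])" by (rule gs_step) (use Cons.prems in auto)
  from Cons.IH[OF this] Cons.prems show ?case by simp
qed simp

lemma gs_inv_Nil: "gs_inv m [] []"
proof -
  interpret V: cof_vec_space m "TYPE(complex)" .
  have "\<not> V.lin_dep {}" unfolding V.lin_dep_def by simp
  then show ?thesis unfolding gs_inv_def by (auto simp: corthogonal_def)
qed

lemma scale_sprod:
  assumes "v \<in> carrier_vec m" "w \<in> carrier_vec m"
  shows "(a \<cdot>\<^sub>v v) \<bullet>c (b \<cdot>\<^sub>v w) = a * cnj b * (v \<bullet>c (w::complex vec))"
  using assms by (simp add: conjugate_smult_vec algebra_simps)

lemma qr_Q:
  fixes A :: "complex mat"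
  assumes A: "A \<in> carrier_mat m k"
  shows "qr_Q A \<in> carrier_mat m (mrank A)"
    and "mat_adjoint (qr_Q A) * qr_Q A = 1\<^sub>m (mrank A)"
    and "qr_Q A * (mat_adjoint (qr_Q A) * A) = A"
    and "\<And>i j. i < mrank A \<Longrightarrow> j < k \<Longrightarrow> j < i \<Longrightarrow> (mat_adjoint (qr_Q A) * A) $$ (i, j) = 0"
proof -
  interpret V: cof_vec_space m "TYPE(complex)" .
  have m: "dim_row A = m" "dim_col A = k" using A by auto
  define us where "us = gram_schmidt_sub m [] (cols A)"
  define vs where "vs = nonzero_vecs m (gram_schmidt m (cols A))"
  have vsF: "vs = rev (nonzero_vecs m us)" unfolding vs_def us_def gram_schmidt_def rev_filter ..
  have cA: "set (cols A) \<subseteq> carrier_vec m" using A cols_dim by blast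
  have "gs_inv m us (cols A)" unfolding us_def using gs_inv_sub[OF gs_inv_Nil cA] by simp
  note I = this[unfolded gs_inv_def]
  have U: "set us \<subseteq> carrier_vec m" and co0: "corthogonal (nonzero_vecs m us)"
    and sp: "V.span (set vs) = V.span (set (cols A))" and li: "\<not> V.lin_dep (set vs)"
    and tri: "\<And>i j. i<length vs \<Longrightarrow> j<i \<Longrightarrow> cols A ! j \<bullet>c vs ! i = 0"
    unfolding vsF set_rev length_rev by (use I in blast)+
  have VS: "set vs \<subseteq> carrier_vec m" using U unfolding vsF by auto
  have co: "corthogonal vs"
    by (rule corthogonal_sort[OF _ _ co0]) (use corthogonal_distinct[OF co0] in \<open>simp_all add: vsF\<close>)
  have dist: "distinct vs" using corthogonal_distinct[OF co] .
  have rk: "mrank A = length vs"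
  proof -
    have "V.rank A = vectorspace.dim class_ring (V.span_vs (set vs))" unfolding V.rank_def sp ..
    also have "\<dots> = card (set vs)"
      by (rule V.dim_span[OF VS]) (use li in \<open>auto simp: maximal_def\<close>)
    finally show ?thesis using dist by (simp add: m distinct_card)
  qed
  let ?r = "length vs"
  define s where "s v = complex_of_real (1 / sqrt (Re (v \<bullet>c v)))" for v :: "complex vec"
  have vi: "vs ! i \<in> carrier_vec m" if "i < ?r" for i using VS that by auto
  have s: "s v \<noteq> 0 \<and> s v * cnj (s v) * (v \<bullet>c v) = 1" if v: "v \<in> set vs" for v
  proof -
    have c: "v \<in> carrier_vec m" using v VS by auto
    have n0: "v \<noteq> 0\<^sub>v m" using v unfolding vs_def by simp
    have "v \<bullet>c v \<noteq> 0" using n0 c by simp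
    moreover have "0 \<le> v \<bullet>c v" by (rule conjugate_square_ge_0_vec)
    ultimately have "0 < Re (v \<bullet>c v)" "v \<bullet>c v = complex_of_real (Re (v \<bullet>c v))"
      by (auto simp: less_eq_complex_def complex_eq_iff)
    then obtain x where x: "0 < x" "v \<bullet>c v = complex_of_real x" by blast
    have "complex_of_real (1 / sqrt x * (1 / sqrt x) * x) = 1" using x(1) by simp
    then show ?thesis unfolding s_def x(2) Re_complex_of_real complex_cnj_complex_of_real
        of_real_mult[symmetric] using x(1) by (simp only: of_real_eq_0_iff) simp
  qed
  define Q where "Q = qr_Q A"
  have Qd: "Q = mat_of_cols m (map (\<lambda>v. s v \<cdot>\<^sub>v v) vs)" unfolding Q_def qr_Q_def m vs_def s_def ..
  have Qc: "Q \<in> carrier_mat m ?r" unfolding Qd by (metis length_map mat_of_cols_carrier(1))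
  have colQ: "col Q i = s (vs ! i) \<cdot>\<^sub>v vs ! i" if "i < ?r" for i
    unfolding Qd by (subst col_mat_of_cols) (use that vi in auto)
  have adjc: "mat_adjoint Q \<in> carrier_mat ?r m" using Qc unfolding mat_adjoint_def by (metis carrier_matD cols_length length_map mat_of_rows_carrier(1))
  have rowQ: "row (mat_adjoint Q) i = conjugate (col Q i)" if "i < ?r" for i
    unfolding mat_adjoint_def by (subst mat_of_rows_row) (use that Qc in auto)
  have QQ: "mat_adjoint Q * Q = 1\<^sub>m ?r"
  proof (rule eq_matI)
    fix i j assume "i < dim_row (1\<^sub>m ?r :: complex mat)" "j < dim_col (1\<^sub>m ?r :: complex mat)"
    then have i: "i < ?r" and j: "j < ?r" by auto
    have "(mat_adjoint Q * Q) $$ (i,j) = conjugate (col Q i) \<bullet> col Q j"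
      using i j adjc Qc rowQ[OF i] by simp
    also have "\<dots> = col Q j \<bullet>c col Q i" by (rule comm_scalar_prod[of _ m]) (use Qc i j in auto)
    also have "\<dots> = s (vs ! j) * cnj (s (vs ! i)) * (vs ! j \<bullet>c vs ! i)"
      unfolding colQ[OF i] colQ[OF j] by (rule scale_sprod[OF vi[OF j] vi[OF i]])
    also have "\<dots> = (if i = j then 1 else 0)"
      using s[of "vs ! i"] corthogonalD[OF co j i] i by auto
    finally show "(mat_adjoint Q * Q) $$ (i,j) = 1\<^sub>m ?r $$ (i,j)" using i j by simp
  qed (use adjc Qc in auto)
  have colA: "\<exists>y. y \<in> carrier_vec ?r \<and> col A j = Q *\<^sub>v y" if j: "j < k" for j
  proof -
    have "col A j \<in> set (cols A)" using j m by (metis cols_length cols_nth nth_mem)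
    then have "col A j \<in> V.span (set vs)" unfolding sp using V.span_mem[OF cA] by auto
    then obtain a where a: "col A j = V.lincomb a (set vs)" using V.finite_span[OF finite_set VS] by blast
    define B where "B = mat_of_cols m vs"
    have B: "B \<in> carrier_mat m ?r" and cB: "cols B = vs" unfolding B_def using VS by auto
    have Bi: "col B i = vs ! i" if "i < ?r" for i using that B cB by (metis carrier_matD(2) cols_nth)
    have 1: "B *\<^sub>v (vec ?r (\<lambda>i. a (col B i))) = col A j"
      using V.mat_mult_eq_lincomb[OF B, of a] dist cB a by simp
    let ?y = "vec ?r (\<lambda>i. a (col B i) / s (vs ! i))"
    have "Q *\<^sub>v ?y = B *\<^sub>v (vec ?r (\<lambda>i. a (col B i)))"
    proof (rule eq_vecI)
      fix l assume "l < dim_vec (B *\<^sub>v (vec ?r (\<lambda>i. a (col B i))))"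
      then have l: "l < m" using B by simp
      have e: "Q $$ (l,i) = s (vs ! i) * (B $$ (l,i))" if "i < ?r" for i
        using colQ[OF that] Bi[OF that] l Qc B that vi[OF that]
        by (metis carrier_matD carrier_vecD index_col index_smult_vec(1))
      show "(Q *\<^sub>v ?y) $ l = (B *\<^sub>v (vec ?r (\<lambda>i. a (col B i)))) $ l"
        using l Qc B s by (auto simp: scalar_prod_def e intro!: sum.cong)
    qed (use Qc B in auto)
    then show ?thesis using 1 by (intro exI[of _ ?y]) auto
  qed
  have recon: "Q * (mat_adjoint Q * A) = A"
  proof (rule mat_col_eqI)
    fix j assume "j < dim_col A"
    then have j: "j < k" using m by simp
    obtain y where y: "y \<in> carrier_vec ?r" "col A j = Q *\<^sub>v y" using colA[OF j] by blast
    have QA: "mat_adjoint Q * A \<in> carrier_mat ?r k" using adjc A by simp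
    have "col (Q * (mat_adjoint Q * A)) j = Q *\<^sub>v (mat_adjoint Q *\<^sub>v col A j)"
      using col_mult2[OF Qc QA j] col_mult2[OF adjc A j] by simp
    also have "\<dots> = Q *\<^sub>v ((mat_adjoint Q * Q) *\<^sub>v y)"
      unfolding y(2) using assoc_mult_mat_vec[OF adjc Qc y(1)] by simp
    also have "\<dots> = col A j" unfolding QQ y(2) using y(1) by simp
    finally show "col (Q * (mat_adjoint Q * A)) j = col A j" .
  qed (use Qc A adjc in auto)
  have trig: "(mat_adjoint Q * A) $$ (i, j) = 0" if "i < ?r" "j < k" "j < i" for i j
  proof -
    have i: "i < ?r" using that by simp
    have c: "col A j \<in> carrier_vec m" using A that by simp
    have "(mat_adjoint Q * A) $$ (i, j) = conjugate (col Q i) \<bullet> col A j"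
      using that adjc A rowQ[OF i] by simp
    also have "\<dots> = col A j \<bullet>c col Q i" by (rule comm_scalar_prod[of _ m]) (use Qc c i in auto)
    also have "\<dots> = cnj (s (vs ! i)) * (col A j \<bullet>c vs ! i)"
      unfolding colQ[OF i] using scale_sprod[OF c vi[OF i], of 1] by simp
    also have "col A j \<bullet>c vs ! i = 0" using tri[OF i that(3)] that m by simp
    finally show ?thesis by simp
  qed
  show "qr_Q A \<in> carrier_mat m (mrank A)" using Qc unfolding rk Q_def .
  show "mat_adjoint (qr_Q A) * qr_Q A = 1\<^sub>m (mrank A)" using QQ unfolding rk Q_def .
  show "qr_Q A * (mat_adjoint (qr_Q A) * A) = A" using recon unfolding Q_def .
  show "(mat_adjoint (qr_Q A) * A) $$ (i, j) = 0" if "i < mrank A" "j < k" "j < i" for i j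
    using trig that unfolding rk Q_def by blast
qed

end

theory Submission
  imports Defs
begin


text \<open>Condition on the matrix \<open>X\<close> that maps the source signal to the signal sent by some layer. Up to
  constant factors, uniformly in \<open>snr \<ge> 1\<close>, the remaining outage probability is that of the plain
  Gaussian product \<open>G\<^sub>m \<cdots> G\<^sub>1 X\<close>, without any processing at the relays. Indeed, an orthonormal factor in
  front of \<open>X\<close> is absorbed by the unitary invariance of \<open>G\<^sub>1\<close>. A diagonal normalization, whose entries
  lie between \<open>min \<kappa> (c / sqrt (1 + \<parallel>E\<parallel>\<^sup>2))\<close> and \<open>\<kappa>\<close>, only rescales the columns of \<open>G\<^sub>1\<close>: this changes
  its density by a factor that is polynomial in the channel \<open>E\<close> of the previous hop, and such a factor is
  absorbed by a change of the variance of \<open>E\<close>, that is, by a constant rescaling of \<open>X\<close>, which again costs a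
  constant. So the outage probabilities of both schemes are comparable to the same quantity, and
  constant factors do not affect the exponent of \<open>snr\<close>.\<close>

subsection \<open>The Borel structure on complex matrices of arbitrary size\<close>

text \<open>Neither DMT is computed; existence of the limit is transferred together with its value.
  The obstacle is that a normalization depends on the very channel \<open>E\<close> that it follows,
  and that its entries have no positive lower bound over all \<open>E\<close>; so no constant works
  realization by realization. The loss \<open>distortion\<close> is therefore averaged over the same
  \<open>E\<close> that causes it, before any earlier hop is averaged. This dictates the recursion
  over the hops: the remaining hops form a functional of an arbitrary matrix \<open>X\<close>, and a
  comparison constant may depend on the number of rows of \<open>X\<close>, but neither on
  \<open>X\<close> itself nor on the rate \<open>R\<close>, which moves with \<open>snr\<close>.
  Antenna selection is harmless since, given the past, a choice of distinct columns of a fresh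
  Gaussian matrix is again Gaussian. As the number of rows of \<open>X\<close> is a random rank, the
  integrands live on matrices of all sizes, and the single Borel structure \<open>mat_borel\<close>
  covers them all.\<close>

definition mat_borel :: "complex mat measure" where
  "mat_borel = vimage_algebra UNIV (\<lambda>A. ((dim_row A, dim_col A), \<lambda>ij. A $$ ij))
     ((count_space UNIV \<Otimes>\<^sub>M count_space UNIV) \<Otimes>\<^sub>M (\<Pi>\<^sub>M ij\<in>UNIV. borel))"

lemma space_mat_borel [simp]: "space mat_borel = UNIV"
  by (simp add: mat_borel_def)

lemma mat_borel_measurable1:
  "(\<lambda>A. ((dim_row A, dim_col A), \<lambda>ij. A $$ ij)) \<in>
     mat_borel \<rightarrow>\<^sub>M (count_space UNIV \<Otimes>\<^sub>M count_space UNIV) \<Otimes>\<^sub>M (\<Pi>\<^sub>M ij\<in>UNIV. borel)"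
  unfolding mat_borel_def by (rule measurable_vimage_algebra1) (simp add: space_pair_measure space_PiM)

lemma measurable_dim_row [measurable]: "dim_row \<in> mat_borel \<rightarrow>\<^sub>M count_space UNIV"
  using measurable_compose[OF measurable_compose[OF mat_borel_measurable1 measurable_fst] measurable_fst] by simp

lemma measurable_dim_col [measurable]: "dim_col \<in> mat_borel \<rightarrow>\<^sub>M count_space UNIV"
  using measurable_compose[OF measurable_compose[OF mat_borel_measurable1 measurable_fst] measurable_snd] by simp

lemma measurable_index_mat [measurable]: "(\<lambda>A. A $$ ij) \<in> borel_measurable mat_borel"
  using measurable_compose[OF measurable_compose[OF mat_borel_measurable1 measurable_snd]
      measurable_component_singleton[of ij UNIV "\<lambda>_. borel"]] by simp

text \<open>Out of bounds, an entry of \<open>mat a b f\<close> is a junk value that does not depend on \<open>f\<close>; therefore all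
  entries, and all products of matrices of mismatched sizes, are measurable.\<close>

lemma mk_mat_out_of_bounds:
  assumes "\<not> (i < a \<and> j < b)"
  shows "mk_mat a b f (i, j) = mk_mat a b g (i, j)"
proof -
  define U where "U h = map (\<lambda>i. map (\<lambda>j. h (i, j)) [0..<b]) [0..<a]" for h :: "nat \<times> nat \<Rightarrow> 'a"
  have ge: "\<not> l < length xs \<Longrightarrow> xs ! l = [] ! (l - length xs)" for l xs
    by (metis append_Nil2 nth_append)
  have len: "length (U h) = a" for h by (simp add: U_def)
  have "U f ! i ! j = U g ! i ! j"
  proof (cases "i < a")
    case True
    have row: "U h ! i = map (\<lambda>j. h (i, j)) [0..<b]" for h using True by (simp add: U_def)
    have "U h ! i ! j = [] ! (j - b)" for h
    proof -
      have "\<not> j < length (U h ! i)" using assms True row by simp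
      from ge[OF this] show ?thesis unfolding row length_map length_upt by (simp only: minus_nat.diff_0)
    qed
    then show ?thesis by metis
  next
    case False
    have "U h ! i = [] ! (i - a)" for h
      using ge[of i "U h"] False unfolding len by blast
    then show ?thesis by metis
  qed
  then show ?thesis using assms unfolding mk_mat_def undef_mat_def case_prod_conv U_def by (simp only: if_False)
qed

lemma index_mat_out_of_bounds:
  "\<not> (i < a \<and> j < b) \<Longrightarrow> mat a b f $$ (i, j) = mat a b g $$ (i, j)"
  unfolding index_mat.rep_eq Matrix.mat.rep_eq by (simp add: mk_mat_out_of_bounds[of i a j b f g])

lemma measurable_mat_fixed_dimI:
  assumes f: "\<And>i j. i < a \<Longrightarrow> j < b \<Longrightarrow> (\<lambda>x. f x (i, j)) \<in> borel_measurable M"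
  shows "(\<lambda>x. mat a b (f x)) \<in> M \<rightarrow>\<^sub>M mat_borel"
  unfolding mat_borel_def
proof (rule measurable_vimage_algebra2, simp, intro measurable_Pair measurable_PiM_single')
  fix ij :: "nat \<times> nat"
  obtain i j where ij: "ij = (i, j)" by (cases ij)
  show "(\<lambda>x. mat a b (f x) $$ ij) \<in> borel_measurable M"
  proof (cases "i < a \<and> j < b")
    case True
    then show ?thesis unfolding ij using f by simp
  next
    case False
    have "(\<lambda>x. mat a b (f x) $$ ij) = (\<lambda>x. mat a b (\<lambda>_. 0) $$ ij)"
      unfolding ij using index_mat_out_of_bounds[OF False] by blast
    then show ?thesis by simp
  qed
qed auto

text \<open>There are countably many sizes, so measurability may be checked with the size frozen.
  The same device handles the other random dimensions below.\<close>

lemma measurable_matI: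
  assumes nr: "nr \<in> M \<rightarrow>\<^sub>M count_space UNIV" and nc: "nc \<in> M \<rightarrow>\<^sub>M count_space UNIV"
    and f: "\<And>i j. (\<lambda>x. f x (i, j)) \<in> borel_measurable M"
  shows "(\<lambda>x. mat (nr x) (nc x) (f x)) \<in> M \<rightarrow>\<^sub>M mat_borel"
proof -
  have 2: "(\<lambda>x. mat (fst p) (snd p) (f x)) \<in> M \<rightarrow>\<^sub>M mat_borel" for p
    by (rule measurable_mat_fixed_dimI) (rule f)
  have 3: "(\<lambda>x. (nr x, nc x)) \<in> M \<rightarrow>\<^sub>M count_space UNIV"
  proof -
    have "(\<lambda>x. (nr x, nc x)) \<in> M \<rightarrow>\<^sub>M count_space UNIV \<Otimes>\<^sub>M count_space UNIV" using nr nc by simp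
    then show ?thesis by (simp add: pair_measure_countable)
  qed
  show ?thesis using measurable_compose_countable[where f="\<lambda>p x. mat (fst p) (snd p) (f x)", OF 2 3] by simp
qed

lemma row_index_out_of_bounds: "row A i $ k = (if k < dim_col A then A $$ (i, k) else undef_vec (k - dim_col A))"
  unfolding row_def by transfer (simp add: mk_vec_def)

text \<open>The scalar product behind a matrix product sums over the length of the second vector, so
  the formula also covers factors of mismatched sizes. This keeps size assumptions out of the
  measurability of products.\<close>

lemma mult_mat_eq:
  "A * B = mat (dim_row A) (dim_col B) (\<lambda>(i, j). \<Sum>k<dim_row B.
     (if k < dim_col A then A $$ (i, k) else undef_vec (k - dim_col A)) * B $$ (k, j))"
  by (intro eq_matI) (auto simp: scalar_prod_def row_index_out_of_bounds atLeast0LessThan intro!: sum.cong)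

lemma measurable_sum_lessThan:
  fixes f :: "'x \<Rightarrow> nat \<Rightarrow> 'b :: {second_countable_topology, topological_comm_monoid_add}"
  assumes "n \<in> M \<rightarrow>\<^sub>M count_space UNIV" "\<And>k. (\<lambda>x. f x k) \<in> borel_measurable M"
  shows "(\<lambda>x. \<Sum>k<n x. f x k) \<in> borel_measurable M"
  by (rule measurable_compose_countable[OF _ assms(1)]) (use assms(2) in measurable)

lemma measurable_mult_mat [measurable]:
  assumes A[measurable]: "A \<in> M \<rightarrow>\<^sub>M mat_borel" and B[measurable]: "B \<in> M \<rightarrow>\<^sub>M mat_borel"
  shows "(\<lambda>x. A x * B x) \<in> M \<rightarrow>\<^sub>M mat_borel"
proof -
  have *: "(\<lambda>x. undef_vec (k - dim_col (A x)) :: complex) \<in> borel_measurable M" for k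
    by (rule measurable_compose_countable[where f="\<lambda>d x. undef_vec (k - d)" and g="\<lambda>x. dim_col (A x)"]) simp_all
  show ?thesis unfolding mult_mat_eq
    by (intro measurable_matI) (auto intro!: measurable_sum_lessThan borel_measurable_times measurable_If * simp: case_prod_beta)
qed

lemma measurable_add_mat [measurable]:
  assumes A[measurable]: "A \<in> M \<rightarrow>\<^sub>M mat_borel" and B[measurable]: "B \<in> M \<rightarrow>\<^sub>M mat_borel"
  shows "(\<lambda>x. A x + B x) \<in> M \<rightarrow>\<^sub>M mat_borel"
proof -
  have e: "A x + B x = mat (dim_row (B x)) (dim_col (B x)) (\<lambda>ij. A x $$ ij + B x $$ ij)" for x
    by (rule eq_matI) auto
  show ?thesis unfolding e by (intro measurable_matI) auto
qed

lemma measurable_minus_mat [measurable]: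
  assumes A[measurable]: "A \<in> M \<rightarrow>\<^sub>M mat_borel" and B[measurable]: "B \<in> M \<rightarrow>\<^sub>M mat_borel"
  shows "(\<lambda>x. A x - B x) \<in> M \<rightarrow>\<^sub>M mat_borel"
proof -
  have e: "A x - B x = mat (dim_row (B x)) (dim_col (B x)) (\<lambda>ij. A x $$ ij - B x $$ ij)" for x
    by (rule eq_matI) auto
  show ?thesis unfolding e by (intro measurable_matI) auto
qed

lemma measurable_smult_mat [measurable]:
  assumes A[measurable]: "A \<in> M \<rightarrow>\<^sub>M mat_borel" and c[measurable]: "c \<in> borel_measurable M"
  shows "(\<lambda>x. c x \<cdot>\<^sub>m A x) \<in> M \<rightarrow>\<^sub>M mat_borel"
proof -
  have e: "c x \<cdot>\<^sub>m A x = mat (dim_row (A x)) (dim_col (A x)) (\<lambda>ij. c x * A x $$ ij)" for x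
    by (rule eq_matI) auto
  show ?thesis unfolding e by (intro measurable_matI) auto
qed

lemma measurable_one_mat [measurable]:
  assumes n[measurable]: "n \<in> M \<rightarrow>\<^sub>M count_space UNIV"
  shows "(\<lambda>x. 1\<^sub>m (n x)) \<in> M \<rightarrow>\<^sub>M mat_borel"
  unfolding one_mat_def by (intro measurable_matI) auto

lemma mat_adjoint_eq: "mat_adjoint A = mat (dim_col A) (dim_row A) (\<lambda>(i, j). cnj (A $$ (j, i)))"
  by (rule eq_matI) (auto simp: mat_adjoint_def mat_of_rows_index)

lemma dim_mat_adjoint [simp]:
  "dim_row (mat_adjoint (A :: complex mat)) = dim_col A" "dim_col (mat_adjoint (A :: complex mat)) = dim_row A"
  unfolding mat_adjoint_def by simp_all

lemma index_mat_adjoint [simp]: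
  "i < dim_col A \<Longrightarrow> j < dim_row A \<Longrightarrow> mat_adjoint A $$ (i, j) = cnj (A $$ (j, i))"
  by (subst mat_adjoint_eq) simp

lemma adjoint_carrier [simp]: "mat_adjoint (A :: complex mat) \<in> carrier_mat a b \<longleftrightarrow> A \<in> carrier_mat b a"
  unfolding carrier_mat_def mem_Collect_eq dim_mat_adjoint by (rule conj_commute)

lemma measurable_cnj [measurable]: "cnj \<in> borel_measurable borel"
  by (intro borel_measurable_continuous_onI continuous_intros)

lemma measurable_mat_adjoint [measurable]:
  assumes A[measurable]: "A \<in> M \<rightarrow>\<^sub>M mat_borel"
  shows "(\<lambda>x. mat_adjoint (A x)) \<in> M \<rightarrow>\<^sub>M mat_borel"
  unfolding mat_adjoint_eq by (intro measurable_matI) auto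

lemma measurable_normalizer [measurable]:
  assumes A[measurable]: "A \<in> M \<rightarrow>\<^sub>M mat_borel"
  shows "(\<lambda>x. normalizer \<kappa> snr (A x)) \<in> M \<rightarrow>\<^sub>M mat_borel"
proof -
  have [measurable]: "(\<lambda>x. real (dim_col (A x))) \<in> borel_measurable M" "(\<lambda>x. real (dim_row (A x))) \<in> borel_measurable M"
    by simp_all
  have [measurable]: "(\<lambda>x. \<Sum>k<dim_col (A x). (cmod (A x $$ (j, k)))\<^sup>2) \<in> borel_measurable M" for j
    by (rule measurable_sum_lessThan) measurable
  show ?thesis unfolding normalizer_def
    by (intro measurable_matI) (auto simp: case_prod_beta)
qed

lemma measurable_eq_nat:
  assumes [measurable]: "f \<in> M \<rightarrow>\<^sub>M count_space UNIV" "g \<in> M \<rightarrow>\<^sub>M count_space (UNIV :: nat set)"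
  shows "Measurable.pred M (\<lambda>x. f x = g x)"
  by (rule measurable_compose_countable[where f="\<lambda>d x. d = g x" and g=f]) measurable

lemma measurable_det [measurable]:
  assumes A[measurable]: "A \<in> M \<rightarrow>\<^sub>M mat_borel"
  shows "(\<lambda>x. Determinant.det (A x)) \<in> borel_measurable M"
proof -
  have 1: "(\<lambda>x. \<Sum>p | p permutes {0..<n}. signof p * (\<Prod>i = 0..<n. A x $$ (i, p i))) \<in> borel_measurable M" for n
    by (intro borel_measurable_sum borel_measurable_times borel_measurable_prod) (use A in measurable)
  have "(\<lambda>x. \<Sum>p | p permutes {0..<dim_row (A x)}. signof p * (\<Prod>i = 0..<dim_row (A x). A x $$ (i, p i))) \<in> borel_measurable M"
    by (rule measurable_compose_countable[where g="\<lambda>x. dim_row (A x)", OF 1 measurable_compose[OF A measurable_dim_row]])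
  then have [measurable]: "(\<lambda>x. \<Sum>p | p permutes {0..<dim_row (A x)}. signof p * (\<Prod>i = 0..<dim_row (A x). A x $$ (i, p i))) \<in> borel_measurable M" .
  have [measurable]: "Measurable.pred M (\<lambda>x. dim_row (A x) = dim_col (A x))"
    by (rule measurable_eq_nat) measurable
  show ?thesis unfolding Determinant.det_def by measurable
qed


subsection \<open>Lebesgue and Gaussian measure on matrices\<close>

definition complex_gauss :: "complex measure" where
  "complex_gauss = density lborel (\<lambda>z. ennreal (exp (- (cmod z)\<^sup>2) / pi))"

text \<open>The density factors over the real and the imaginary part into two normal densities of
  variance 1/2.\<close>

lemma prob_space_complex_gauss: "prob_space complex_gauss"
proof
  have real: "(\<integral>\<^sup>+x. ennreal (exp (- x\<^sup>2) / sqrt pi) \<partial>lborel) = 1"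
  proof -
    have "prob_space (density lborel (\<lambda>x. ennreal (normal_density 0 (1 / sqrt 2) x)))"
      by (rule prob_space_normal_density) simp
    from prob_space.emeasure_space_1[OF this]
    have "(\<integral>\<^sup>+x. ennreal (normal_density 0 (1 / sqrt 2) x) \<partial>lborel) = 1"
      by (simp add: emeasure_density)
    then show ?thesis by (simp add: normal_density_def power_divide)
  qed
  have "emeasure complex_gauss (space complex_gauss) = (\<integral>\<^sup>+z. ennreal (exp (- (cmod z)\<^sup>2) / pi) \<partial>lborel)"
    by (simp add: complex_gauss_def emeasure_density)
  also have "\<dots> = (\<integral>\<^sup>+z. (\<Prod>b\<in>Basis. ennreal (exp (- (z \<bullet> b)\<^sup>2) / sqrt pi)) \<partial>(lborel :: complex measure))"
  proof (intro nn_integral_cong)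
    fix z :: complex
    show "ennreal (exp (- (cmod z)\<^sup>2) / pi) = (\<Prod>b\<in>Basis. ennreal (exp (- (z \<bullet> b)\<^sup>2) / sqrt pi))"
      by (simp add: Basis_complex_def ennreal_mult[symmetric] exp_add[symmetric] cmod_power2 inner_complex_def)
  qed
  also have "\<dots> = (\<Prod>b\<in>(Basis :: complex set). \<integral>\<^sup>+x. ennreal (exp (- x\<^sup>2) / sqrt pi) \<partial>lborel)"
    by (rule nn_integral_lborel_prod) auto
  also have "\<dots> = 1" by (simp add: real)
  finally show "emeasure complex_gauss (space complex_gauss) = 1" .
qed

abbreviation idx :: "nat \<Rightarrow> nat \<Rightarrow> (nat \<times> nat) set" where
  "idx a k \<equiv> {..<a} \<times> {..<k}"

definition lebm :: "nat \<Rightarrow> nat \<Rightarrow> complex mat measure" where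
  "lebm a k = distr (\<Pi>\<^sub>M _\<in>idx a k. lborel) mat_borel (mat a k)"

lemma sets_lebm [simp, measurable_cong]: "sets (lebm a k) = sets mat_borel"
  by (simp add: lebm_def)

lemma space_lebm [simp]: "space (lebm a k) = UNIV"
  by (simp add: lebm_def)

lemma measurable_mat_PiM:
  assumes "\<And>x. sets (S x) = sets borel"
  shows "mat a k \<in> (\<Pi>\<^sub>M x\<in>idx a k. S x) \<rightarrow>\<^sub>M mat_borel"
proof (rule measurable_mat_fixed_dimI)
  fix i j assume "i < a" "j < k"
  then have "(\<lambda>g. g (i, j)) \<in> (\<Pi>\<^sub>M x\<in>idx a k. S x) \<rightarrow>\<^sub>M S (i, j)" by (intro measurable_component_singleton) auto
  then show "(\<lambda>g. g (i, j)) \<in> borel_measurable (\<Pi>\<^sub>M x\<in>idx a k. S x)"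
    by (simp add: measurable_cong_sets[OF refl assms])
qed

lemma nn_integral_lebm:
  assumes [measurable]: "f \<in> borel_measurable mat_borel"
  shows "(\<integral>\<^sup>+A. f A \<partial>lebm a k) = (\<integral>\<^sup>+g. f (mat a k g) \<partial>(\<Pi>\<^sub>M _\<in>idx a k. lborel))"
  unfolding lebm_def by (rule nn_integral_distr) (auto intro: measurable_mat_PiM)

interpretation lborel_product: product_sigma_finite "\<lambda>_. lborel :: complex measure"
  by standard

text \<open>A pushforward of a sigma-finite measure need not be sigma-finite. Here reading off the
  entries inverts \<open>mat a k\<close> measurably, and sigma-finiteness is pulled back from the
  product measure along that map.\<close>

lemma sigma_finite_lebm: "sigma_finite_measure (lebm a k)"
proof -
  let ?P = "\<Pi>\<^sub>M _\<in>idx a k. (lborel :: complex measure)" and ?r = "\<lambda>A. \<lambda>ij\<in>idx a k. A $$ ij"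
  have r: "?r \<in> mat_borel \<rightarrow>\<^sub>M ?P"
    by (intro measurable_restrict) measurable
  have "distr (lebm a k) ?P ?r = distr ?P ?P (\<lambda>g. ?r (mat a k g))"
    unfolding lebm_def by (subst distr_distr) (auto simp: r measurable_mat_PiM comp_def)
  also have "\<dots> = distr ?P ?P (\<lambda>g. g)"
    by (intro distr_cong) (auto simp: space_PiM PiE_def extensional_def fun_eq_iff)
  also have "\<dots> = ?P" by (rule distr_id)
  finally have e: "distr (lebm a k) ?P ?r = ?P" .
  show ?thesis
  proof (rule sigma_finite_measure_distr)
    show "sigma_finite_measure (distr (lebm a k) ?P ?r)"
      unfolding e by (rule lborel_product.sigma_finite) simp
    show "?r \<in> lebm a k \<rightarrow>\<^sub>M ?P" using r by simp
  qed
qed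

lemma measurable_carrier_mat [measurable]: "carrier_mat a k \<in> sets mat_borel"
proof -
  have "Measurable.pred mat_borel (\<lambda>A. dim_row A = a \<and> dim_col A = k)" by measurable
  then have "{A \<in> space mat_borel. dim_row A = a \<and> dim_col A = k} \<in> sets mat_borel" by (rule predE)
  then show ?thesis unfolding carrier_mat_def by simp
qed

lemma AE_lebm_carrier: "AE A in lebm a k. A \<in> carrier_mat a k"
  unfolding lebm_def by (subst AE_distr_iff) (auto intro: measurable_mat_PiM)

lemma nn_integral_lebm_cong:
  "(\<And>A. A \<in> carrier_mat a k \<Longrightarrow> f A = g A) \<Longrightarrow> (\<integral>\<^sup>+A. f A \<partial>lebm a k) = (\<integral>\<^sup>+A. g A \<partial>lebm a k)"
  by (rule nn_integral_cong_AE, rule AE_mp[OF AE_lebm_carrier]) simp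

text \<open>A product measure is determined by its values on boxes, and the preimage of a box under
  a coordinatewise map is a box. Translation and scaling of matrices are the two instances in
  use.\<close>

lemma nn_integral_PiM_lborel_map:
  fixes T :: "'i \<Rightarrow> complex \<Rightarrow> complex" and c :: "'i \<Rightarrow> real"
  assumes I: "finite I" and c: "\<And>x. x \<in> I \<Longrightarrow> 0 < c x"
    and T[measurable]: "\<And>x. x \<in> I \<Longrightarrow> T x \<in> borel_measurable borel"
    and em: "\<And>x A. x \<in> I \<Longrightarrow> A \<in> sets borel \<Longrightarrow> emeasure lborel (T x -` A) = ennreal (c x) * emeasure lborel A"
    and f[measurable]: "f \<in> borel_measurable (\<Pi>\<^sub>M _\<in>I. lborel)"
  shows "(\<integral>\<^sup>+g. f (\<lambda>x\<in>I. T x (g x)) \<partial>(\<Pi>\<^sub>M _\<in>I. lborel)) = ennreal (\<Prod>x\<in>I. c x) * (\<integral>\<^sup>+g. f g \<partial>(\<Pi>\<^sub>M _\<in>I. lborel))"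
proof -
  let ?P = "\<Pi>\<^sub>M _\<in>I. (lborel :: complex measure)" and ?T = "\<lambda>g. \<lambda>x\<in>I. T x (g x)"
  have Tm[measurable]: "?T \<in> ?P \<rightarrow>\<^sub>M ?P" by (intro measurable_restrict) measurable
  define C where "C = (\<Prod>x\<in>I. c x)"
  have C: "0 < C" unfolding C_def using c by (intro prod_pos) auto
  have e: "scale_measure (ennreal (1 / C)) (distr ?P ?P ?T) = ?P"
  proof (rule lborel_product.PiM_eqI[OF I])
    fix A :: "'i \<Rightarrow> complex set" assume A: "\<And>i. i \<in> I \<Longrightarrow> A i \<in> sets lborel"
    have "emeasure (distr ?P ?P ?T) (Pi\<^sub>E I A) = emeasure ?P (?T -` Pi\<^sub>E I A \<inter> space ?P)"
      by (rule emeasure_distr[OF Tm]) (use A I in \<open>auto intro!: sets_PiM_I_finite\<close>)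
    also have "?T -` Pi\<^sub>E I A \<inter> space ?P = (\<Pi>\<^sub>E x\<in>I. T x -` A x)"
      by (auto simp: space_PiM PiE_def Pi_def)
    also have "emeasure ?P (\<Pi>\<^sub>E x\<in>I. T x -` A x) = (\<Prod>x\<in>I. emeasure lborel (T x -` A x))"
    proof (rule lborel_product.emeasure_PiM[OF I])
      fix x assume x: "x \<in> I"
      have "A x \<in> sets borel" using A[OF x] by simp
      then show "T x -` A x \<in> sets lborel" using measurable_sets[OF T[OF x], of "A x"] by simp
    qed
    also have "\<dots> = (\<Prod>x\<in>I. ennreal (c x) * emeasure lborel (A x))"
      by (rule prod.cong[OF refl]) (use em A in auto)
    also have "\<dots> = ennreal C * (\<Prod>x\<in>I. emeasure lborel (A x))"
      unfolding prod.distrib C_def by (subst prod_ennreal) (use c less_imp_le in auto)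
    finally have "emeasure (distr ?P ?P ?T) (Pi\<^sub>E I A) = ennreal C * (\<Prod>x\<in>I. emeasure lborel (A x))" .
    then show "emeasure (scale_measure (ennreal (1 / C)) (distr ?P ?P ?T)) (Pi\<^sub>E I A) = (\<Prod>x\<in>I. emeasure lborel (A x))"
      using C by (simp add: mult.assoc[symmetric] ennreal_mult[symmetric])
  qed simp
  have "(\<integral>\<^sup>+g. f g \<partial>?P) = ennreal (1 / C) * (\<integral>\<^sup>+g. f (?T g) \<partial>?P)"
    by (subst (1) e[symmetric]) (simp add: nn_integral_scale_measure nn_integral_distr)
  then have "ennreal C * (\<integral>\<^sup>+g. f g \<partial>?P) = (\<integral>\<^sup>+g. f (?T g) \<partial>?P)"
    using C by (simp add: mult.assoc[symmetric] ennreal_mult[symmetric])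
  then show ?thesis unfolding C_def by simp
qed

lemma nn_integral_lebm_translate:
  assumes B: "B \<in> carrier_mat a k" and [measurable]: "f \<in> borel_measurable mat_borel"
  shows "(\<integral>\<^sup>+A. f (A + B) \<partial>lebm a k) = (\<integral>\<^sup>+A. f A \<partial>lebm a k)"
proof -
  let ?P = "\<Pi>\<^sub>M _\<in>idx a k. (lborel :: complex measure)"
  have [measurable]: "mat a k \<in> ?P \<rightarrow>\<^sub>M mat_borel" by (rule measurable_mat_PiM) simp
  have "(\<integral>\<^sup>+A. f (A + B) \<partial>lebm a k) = (\<integral>\<^sup>+g. f (mat a k (\<lambda>x\<in>idx a k. B $$ x + g x)) \<partial>?P)"
  proof (subst nn_integral_lebm, measurable, intro nn_integral_cong arg_cong[where f=f])
    fix g show "mat a k g + B = mat a k (\<lambda>x\<in>idx a k. B $$ x + g x)"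
      by (rule eq_matI) (use B in auto)
  qed
  also have "\<dots> = ennreal (\<Prod>x\<in>idx a k. 1) * (\<integral>\<^sup>+g. f (mat a k g) \<partial>?P)"
  proof (rule nn_integral_PiM_lborel_map[where f = "\<lambda>g. f (mat a k g)" and T = "\<lambda>x z. B $$ x + z"])
    fix x A assume A: "A \<in> sets (borel :: complex measure)"
    have "emeasure lborel A = emeasure (distr lborel borel ((+) (B $$ x))) A" by (simp add: lborel_distr_plus)
    also have "\<dots> = emeasure lborel ((\<lambda>z. B $$ x + z) -` A)" using A by (simp add: emeasure_distr)
    finally show "emeasure lborel ((\<lambda>z. B $$ x + z) -` A) = ennreal 1 * emeasure lborel A" by simp
  qed auto
  also have "\<dots> = (\<integral>\<^sup>+A. f A \<partial>lebm a k)" by (simp add: nn_integral_lebm)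
  finally show ?thesis .
qed

definition diagm :: "nat \<Rightarrow> (nat \<Rightarrow> real) \<Rightarrow> complex mat" where
  "diagm k d = mat k k (\<lambda>(i, j). if i = j then complex_of_real (d i) else 0)"

lemma diagm_carrier [simp]: "diagm k d \<in> carrier_mat k k"
  by (simp add: diagm_def)

lemma dim_diagm [simp]: "dim_row (diagm k d) = k" "dim_col (diagm k d) = k"
  by (simp_all add: diagm_def)

lemma mult_diagm: "A \<in> carrier_mat a k \<Longrightarrow> A * diagm k d = mat a k (\<lambda>(i, j). A $$ (i, j) * complex_of_real (d j))"
  by (rule eq_matI) (auto simp: diagm_def scalar_prod_def if_distrib sum.delta cong: if_cong)

text \<open>Column \<open>j\<close> has \<open>a\<close> entries, each ranging over a plane on which
  multiplication by \<open>d j\<close> scales area by its square; hence the exponent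
  \<open>2 * a\<close>.\<close>

lemma nn_integral_lebm_scale:
  assumes d: "\<And>j. j < k \<Longrightarrow> 0 < d j" and [measurable]: "f \<in> borel_measurable mat_borel"
  shows "(\<integral>\<^sup>+A. f (A * diagm k d) \<partial>lebm a k) = ennreal (\<Prod>j<k. (1 / d j) ^ (2 * a)) * (\<integral>\<^sup>+A. f A \<partial>lebm a k)"
proof -
  let ?P = "\<Pi>\<^sub>M _\<in>idx a k. (lborel :: complex measure)"
  have [measurable]: "mat a k \<in> ?P \<rightarrow>\<^sub>M mat_borel" by (rule measurable_mat_PiM) simp
  have "(\<integral>\<^sup>+A. f (A * diagm k d) \<partial>lebm a k) = (\<integral>\<^sup>+g. f (mat a k (\<lambda>x\<in>idx a k. d (snd x) *\<^sub>R g x)) \<partial>?P)"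
  proof (subst nn_integral_lebm, measurable, intro nn_integral_cong arg_cong[where f=f])
    fix g show "mat a k g * diagm k d = mat a k (\<lambda>x\<in>idx a k. d (snd x) *\<^sub>R g x)"
      by (subst mult_diagm) (auto intro!: eq_matI simp: scaleR_conv_of_real)
  qed
  also have "\<dots> = ennreal (\<Prod>x\<in>idx a k. (1 / d (snd x))\<^sup>2) * (\<integral>\<^sup>+g. f (mat a k g) \<partial>?P)"
  proof (rule nn_integral_PiM_lborel_map[where f = "\<lambda>g. f (mat a k g)" and T = "\<lambda>x z. d (snd x) *\<^sub>R z"])
    fix x A assume x: "x \<in> idx a k" and A: "A \<in> sets (borel :: complex measure)"
    let ?s = "d (snd x)"
    have s: "0 < ?s" using x d by auto
    have "emeasure lborel A = emeasure (density (distr lborel borel (\<lambda>z. 0 + ?s *\<^sub>R z)) (\<lambda>_. \<bar>?s\<bar>^DIM(complex))) A"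
      by (subst (1) lborel_affine[of ?s 0]) (use s in auto)
    also have "\<dots> = ennreal (?s\<^sup>2) * emeasure lborel ((\<lambda>z. ?s *\<^sub>R z) -` A)" using A s
      by (simp add: emeasure_density nn_integral_cmult emeasure_distr)
    finally show "emeasure lborel ((\<lambda>z. ?s *\<^sub>R z) -` A) = ennreal ((1 / ?s)\<^sup>2) * emeasure lborel A"
      using s by (simp add: mult.assoc[symmetric] ennreal_mult[symmetric] power_mult_distrib[symmetric])
  next
    fix x assume "x \<in> idx a k"
    then show "0 < (1 / d (snd x))\<^sup>2" using d[of "snd x"] by auto
  qed auto
  also have "(\<Prod>x\<in>idx a k. (1 / d (snd x))\<^sup>2) = (\<Prod>i<a. \<Prod>j<k. (1 / d j)\<^sup>2)"
    by (subst prod.cartesian_product) (auto intro!: prod.cong)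
  also have "\<dots> = (\<Prod>j<k. (1 / d j) ^ (2 * a))"
    by (subst prod.swap) (simp only: prod_constant card_lessThan power_mult)
  finally show ?thesis by (simp add: nn_integral_lebm)
qed


section \<open>The squared Frobenius norm \<open>fro\<close> and the Frobenius inner product
  \<open>frip\<close>\<close>

definition fro :: "complex mat \<Rightarrow> real" where
  "fro A = (\<Sum>i<dim_row A. \<Sum>j<dim_col A. (cmod (A $$ (i, j)))\<^sup>2)"

lemma fro_nonneg: "0 \<le> fro A"
  unfolding fro_def by (intro sum_nonneg) auto

lemma measurable_fro [measurable]:
  assumes A[measurable]: "A \<in> M \<rightarrow>\<^sub>M mat_borel"
  shows "(\<lambda>x. fro (A x)) \<in> borel_measurable M"
  unfolding fro_def by (intro measurable_sum_lessThan) measurable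

definition frip :: "complex mat \<Rightarrow> complex mat \<Rightarrow> complex" where
  "frip A B = (\<Sum>i<dim_row A. \<Sum>j<dim_col A. A $$ (i, j) * cnj (B $$ (i, j)))"

lemma frip_self: "frip A A = complex_of_real (fro A)"
  by (simp add: frip_def fro_def complex_norm_square flip: of_real_power)

lemma frip_add_left: "A \<in> carrier_mat a k \<Longrightarrow> B \<in> carrier_mat a k \<Longrightarrow> frip (A + B) C = frip A C + frip B C"
  by (simp add: frip_def sum.distrib algebra_simps)

lemma frip_minus_left: "A \<in> carrier_mat a k \<Longrightarrow> B \<in> carrier_mat a k \<Longrightarrow> frip (A - B) C = frip A C - frip B C"
  by (simp add: frip_def sum_subtractf algebra_simps)

lemma frip_add_right: "A \<in> carrier_mat a k \<Longrightarrow> B \<in> carrier_mat a k \<Longrightarrow> C \<in> carrier_mat a k \<Longrightarrow>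
    frip A (B + C) = frip A B + frip A C"
  by (simp add: frip_def sum.distrib algebra_simps)

lemma frip_minus_right: "A \<in> carrier_mat a k \<Longrightarrow> B \<in> carrier_mat a k \<Longrightarrow> C \<in> carrier_mat a k \<Longrightarrow>
    frip A (B - C) = frip A B - frip A C"
  by (simp add: frip_def sum_subtractf algebra_simps)

lemma frip_commute: "A \<in> carrier_mat a k \<Longrightarrow> B \<in> carrier_mat a k \<Longrightarrow> frip B A = cnj (frip A B)"
  by (simp add: frip_def mult.commute)

lemma frip_mult:
  assumes A: "A \<in> carrier_mat a n" and Q: "Q \<in> carrier_mat n r" and B: "B \<in> carrier_mat a r"
  shows "frip (A * Q) B = frip A (B * mat_adjoint Q)"
proof -
  have "frip (A * Q) B = (\<Sum>i<a. \<Sum>j<r. \<Sum>l<n. A $$ (i, l) * Q $$ (l, j) * cnj (B $$ (i, j)))"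
    unfolding frip_def using A Q B
    by (auto simp: scalar_prod_def atLeast0LessThan sum_distrib_right intro!: sum.cong)
  also have "\<dots> = (\<Sum>i<a. \<Sum>l<n. \<Sum>j<r. A $$ (i, l) * Q $$ (l, j) * cnj (B $$ (i, j)))"
    by (intro sum.cong refl sum.swap)
  also have "\<dots> = frip A (B * mat_adjoint Q)"
    unfolding frip_def using A Q B
    by (auto simp: scalar_prod_def atLeast0LessThan sum_distrib_left intro!: sum.cong)
  finally show ?thesis .
qed

lemma mat_adjoint_mat_adjoint: "mat_adjoint (mat_adjoint A) = (A :: complex mat)"
  by (rule eq_matI) auto

lemma mat_adjoint_mult:
  assumes A: "A \<in> carrier_mat a n" and Q: "Q \<in> carrier_mat n r"
  shows "mat_adjoint (A * Q) = mat_adjoint Q * (mat_adjoint A :: complex mat)"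
  by (rule eq_matI) (use A Q in \<open>auto simp: scalar_prod_def mult.commute intro!: sum.cong\<close>)

lemma fro_adjoint: "fro (mat_adjoint A) = fro A"
proof -
  have "fro (mat_adjoint A) = (\<Sum>i<dim_col A. \<Sum>j<dim_row A. (cmod (A $$ (j, i)))\<^sup>2)" by (simp add: fro_def)
  also have "\<dots> = fro A" unfolding fro_def by (rule sum.swap)
  finally show ?thesis .
qed

lemma fro_mult_right_isometry:
  assumes V: "V \<in> carrier_mat a r" and Q: "Q \<in> carrier_mat n r" and QQ: "mat_adjoint Q * Q = 1\<^sub>m r"
  shows "fro (V * mat_adjoint Q) = fro V"
proof -
  have Q': "mat_adjoint Q \<in> carrier_mat r n" using Q by simp
  have "complex_of_real (fro (V * mat_adjoint Q)) = frip V (V * mat_adjoint Q * mat_adjoint (mat_adjoint Q))"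
    unfolding frip_self[symmetric] by (rule frip_mult[OF V Q']) (use V Q in auto)
  also have "V * mat_adjoint Q * mat_adjoint (mat_adjoint Q) = V"
    unfolding mat_adjoint_mat_adjoint using assoc_mult_mat[OF V Q' Q] QQ V by simp
  finally show ?thesis unfolding frip_self by simp
qed

text \<open>This identity makes the composition of shears in the proof of unitary invariance
  norm-preserving. With \<open>U = G Q\<close> and \<open>V = H + U\<close>, the cross terms of
  \<open>G\<close> with \<open>W\<close> become those of \<open>U\<close> with \<open>V\<close> by
  adjointness, and \<open>W\<close> is as long as \<open>V\<close>; expanding \<open>V\<close>
  cancels the rest.\<close>

lemma fro_shear:
  assumes G: "G \<in> carrier_mat a n" and H: "H \<in> carrier_mat a r" and Q: "Q \<in> carrier_mat n r"
    and QQ: "mat_adjoint Q * Q = 1\<^sub>m r"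
  shows "fro (G - (H + G * Q) * mat_adjoint Q) + fro (G * Q) = fro G + fro H"
proof -
  define U where "U = G * Q" define V where "V = H + U" define W where "W = V * mat_adjoint Q"
  have U: "U \<in> carrier_mat a r" and V: "V \<in> carrier_mat a r" and W: "W \<in> carrier_mat a n"
    using G H Q by (auto simp: U_def V_def W_def)
  have "complex_of_real (fro (G - W)) = frip G G - frip G W - (frip W G - frip W W)"
    unfolding frip_self[symmetric] using G W
    by (simp add: frip_minus_left[of _ a n] frip_minus_right[of _ a n])
  also have "frip G W = frip U V" unfolding U_def W_def by (rule frip_mult[OF G Q V, symmetric])
  also have "frip W G = cnj (frip U V)"
    using \<open>frip G W = frip U V\<close> frip_commute[OF G W] by simp
  also have "frip W W = complex_of_real (fro V)"
    unfolding frip_self W_def by (simp add: fro_mult_right_isometry[OF V Q QQ])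
  finally have 1: "complex_of_real (fro (G - W)) = frip G G - frip U V - (cnj (frip U V) - complex_of_real (fro V))"
    by (simp add: frip_self)
  have 2: "frip U V = frip U H + frip U U" unfolding V_def by (rule frip_add_right[OF U H U])
  have 3: "frip V V = frip H H + frip H U + (frip U H + frip U U)"
    unfolding V_def using H U by (simp add: frip_add_left[of _ a r] frip_add_right[of _ a r])
  have 4: "cnj (frip U H) = frip H U" using frip_commute[OF U H] by simp
  have "complex_of_real (fro (G - W) + fro U) = complex_of_real (fro G + fro H)"
    using 1 3 by (simp add: 2 4 frip_self)
  then have "fro (G - W) + fro U = fro G + fro H" by (simp only: of_real_eq_iff)
  then show ?thesis unfolding W_def V_def U_def .
qed

section \<open>Gaussian matrices: density, product form and invariance\<close>

definition gauss_density :: "nat \<Rightarrow> nat \<Rightarrow> complex mat \<Rightarrow> ennreal" where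
  "gauss_density a k A = ennreal (exp (- fro A) / pi ^ (a * k))"

lemma measurable_gauss_density [measurable]:
  assumes A[measurable]: "A \<in> M \<rightarrow>\<^sub>M mat_borel"
  shows "(\<lambda>x. gauss_density a k (A x)) \<in> borel_measurable M"
  unfolding gauss_density_def by measurable

definition gaussm :: "nat \<Rightarrow> nat \<Rightarrow> complex mat measure" where
  "gaussm a k = density (lebm a k) (gauss_density a k)"

lemma sets_gaussm [simp, measurable_cong]: "sets (gaussm a k) = sets mat_borel"
  by (simp add: gaussm_def)

lemma space_gaussm [simp]: "space (gaussm a k) = UNIV"
  by (simp add: gaussm_def)

lemma gauss_density_mat: "gauss_density a k (mat a k g) = (\<Prod>x\<in>idx a k. ennreal (exp (- (cmod (g x))\<^sup>2) / pi))"
proof -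
  have "(\<Prod>x\<in>idx a k. ennreal (exp (- (cmod (g x))\<^sup>2) / pi)) = ennreal (\<Prod>x\<in>idx a k. exp (- (cmod (g x))\<^sup>2) / pi)"
    by (rule prod_ennreal) auto
  also have "(\<Prod>x\<in>idx a k. exp (- (cmod (g x))\<^sup>2) / pi) = exp (- (\<Sum>x\<in>idx a k. (cmod (g x))\<^sup>2)) / pi ^ (a * k)"
    by (simp add: prod_dividef exp_sum sum_negf[symmetric])
  also have "(\<Sum>x\<in>idx a k. (cmod (g x))\<^sup>2) = fro (mat a k g)"
    by (simp add: fro_def sum.cartesian_product)
  finally show ?thesis by (simp add: gauss_density_def)
qed

interpretation gauss_product: product_sigma_finite "\<lambda>_. complex_gauss"
  by (intro product_sigma_finite.intro prob_space_imp_sigma_finite prob_space_complex_gauss)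

lemma sets_complex_gauss [simp, measurable_cong]: "sets complex_gauss = sets borel"
  by (simp add: complex_gauss_def)

lemma PiM_complex_gauss_eq_density:
  assumes I: "finite I"
  shows "(\<Pi>\<^sub>M _\<in>I. complex_gauss) = density (\<Pi>\<^sub>M _\<in>I. lborel) (\<lambda>g. \<Prod>x\<in>I. ennreal (exp (- (cmod (g x))\<^sup>2) / pi))"
proof (rule gauss_product.PiM_eqI[OF I, symmetric])
  let ?w = "\<lambda>z. ennreal (exp (- (cmod z)\<^sup>2) / pi)" and ?P = "\<Pi>\<^sub>M _\<in>I. (lborel :: complex measure)"
  show "sets (density ?P (\<lambda>g. \<Prod>x\<in>I. ?w (g x))) = sets (\<Pi>\<^sub>M _\<in>I. complex_gauss)"
    unfolding sets_density by (rule sets_PiM_cong) simp_all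
  fix A :: "'a \<Rightarrow> complex set" assume A: "\<And>i. i \<in> I \<Longrightarrow> A i \<in> sets complex_gauss"
  then have AE: "Pi\<^sub>E I A \<in> sets ?P" using I by (intro sets_PiM_I_finite) auto
  have [measurable]: "(\<lambda>g. \<Prod>x\<in>I. ?w (g x)) \<in> borel_measurable ?P" by measurable
  have "emeasure (density ?P (\<lambda>g. \<Prod>x\<in>I. ?w (g x))) (Pi\<^sub>E I A) =
      (\<integral>\<^sup>+g. (\<Prod>x\<in>I. ?w (g x)) * indicator (Pi\<^sub>E I A) g \<partial>?P)"
    by (rule emeasure_density) (use AE in measurable)
  also have "\<dots> = (\<integral>\<^sup>+g. (\<Prod>x\<in>I. ?w (g x) * indicator (A x) (g x)) \<partial>?P)"
  proof (rule nn_integral_cong)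
    fix g assume "g \<in> space ?P"
    then have "indicator (Pi\<^sub>E I A) g = (\<Prod>x\<in>I. indicator (A x) (g x) :: ennreal)"
      using I by (auto simp: indicator_def space_PiM PiE_def Pi_def)
    then show "(\<Prod>x\<in>I. ?w (g x)) * indicator (Pi\<^sub>E I A) g = (\<Prod>x\<in>I. ?w (g x) * indicator (A x) (g x))"
      by (simp add: prod.distrib)
  qed
  also have "\<dots> = (\<Prod>x\<in>I. \<integral>\<^sup>+z. ?w z * indicator (A x) z \<partial>lborel)"
    by (rule lborel_product.product_nn_integral_prod[OF I]) (use A in auto)
  also have "\<dots> = (\<Prod>x\<in>I. emeasure complex_gauss (A x))"
    by (intro prod.cong refl) (use A in \<open>simp add: complex_gauss_def emeasure_density\<close>)
  finally show "emeasure (density ?P (\<lambda>g. \<Prod>x\<in>I. ?w (g x))) (Pi\<^sub>E I A) = (\<Prod>x\<in>I. emeasure complex_gauss (A x))" .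
qed

lemma nn_integral_gaussm_lebm:
  assumes [measurable]: "f \<in> borel_measurable mat_borel"
  shows "(\<integral>\<^sup>+A. f A \<partial>gaussm a k) = (\<integral>\<^sup>+A. gauss_density a k A * f A \<partial>lebm a k)"
  unfolding gaussm_def by (rule nn_integral_density) measurable

text \<open>Links the two descriptions of a Gaussian matrix: the density is suited to changes of
  variables, independent entries are what the channel model supplies.\<close>

lemma nn_integral_gaussm:
  assumes [measurable]: "f \<in> borel_measurable mat_borel"
  shows "(\<integral>\<^sup>+A. f A \<partial>gaussm a k) = (\<integral>\<^sup>+g. f (mat a k g) \<partial>(\<Pi>\<^sub>M _\<in>idx a k. complex_gauss))"
proof -
  have [measurable]: "mat a k \<in> (\<Pi>\<^sub>M _\<in>idx a k. lborel) \<rightarrow>\<^sub>M mat_borel" by (rule measurable_mat_PiM) simp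
  show ?thesis
    unfolding PiM_complex_gauss_eq_density[OF finite_cartesian_product[OF finite_lessThan finite_lessThan]] 
    by (simp add: nn_integral_gaussm_lebm nn_integral_lebm gauss_density_mat nn_integral_density)
qed

lemma prob_space_gaussm: "prob_space (gaussm a k)"
proof
  interpret P: prob_space "\<Pi>\<^sub>M _\<in>idx a k. complex_gauss" by (rule prob_space_PiM) (rule prob_space_complex_gauss)
  have "emeasure (gaussm a k) (space (gaussm a k)) = (\<integral>\<^sup>+A. 1 \<partial>gaussm a k)" by simp
  also have "\<dots> = 1" by (subst nn_integral_gaussm) (simp_all add: P.emeasure_space_1)
  finally show "emeasure (gaussm a k) (space (gaussm a k)) = 1" .
qed

lemma AE_gaussm_carrier: "AE A in gaussm a k. A \<in> carrier_mat a k"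
  unfolding gaussm_def using AE_lebm_carrier[of a k] by (subst AE_density) auto

lemma nn_integral_gaussm_mono:
  "(\<And>G. G \<in> carrier_mat a k \<Longrightarrow> f G \<le> g G) \<Longrightarrow> (\<integral>\<^sup>+G. f G \<partial>gaussm a k) \<le> (\<integral>\<^sup>+G. g G \<partial>gaussm a k)"
  by (rule nn_integral_mono_AE, rule AE_mp[OF AE_gaussm_carrier]) simp

lemma nn_integral_gaussm_cong:
  "(\<And>G. G \<in> carrier_mat a k \<Longrightarrow> f G = g G) \<Longrightarrow> (\<integral>\<^sup>+G. f G \<partial>gaussm a k) = (\<integral>\<^sup>+G. g G \<partial>gaussm a k)"
  by (rule nn_integral_cong_AE, rule AE_mp[OF AE_gaussm_carrier]) simp

lemma nn_integral_gauss_density: "(\<integral>\<^sup>+A. gauss_density a k A \<partial>lebm a k) = 1"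
proof -
  interpret prob_space "gaussm a k" by (rule prob_space_gaussm)
  show ?thesis using nn_integral_gaussm_lebm[of "\<lambda>_. 1" a k] emeasure_space_1 by simp
qed

text \<open>\<open>(G, H) \<mapsto> (_, G Q)\<close> is the product of the three block shears \<open>H += G Q\<close>, \<open>G -= H Q\<^sup>*\<close>,
  \<open>H += G Q\<close>. Each of them preserves Lebesgue measure, and their product is unitary.\<close>

lemma nn_integral_gaussm_isometry:
  assumes Q: "Q \<in> carrier_mat n r" and QQ: "mat_adjoint Q * Q = 1\<^sub>m r"
    and f[measurable]: "f \<in> borel_measurable mat_borel"
  shows "(\<integral>\<^sup>+G. f (G * Q) \<partial>gaussm a n) = (\<integral>\<^sup>+H. f H \<partial>gaussm a r)"
proof -
  interpret P: pair_sigma_finite "lebm a n" "lebm a r"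
    by (intro pair_sigma_finite.intro sigma_finite_lebm)
  let ?Q = "mat_adjoint Q"
  have Q': "?Q \<in> carrier_mat r n" using Q by simp
  define F where "F G H = gauss_density a n G * (gauss_density a r H * f H)" for G H
  have F[measurable]: "(\<lambda>x. F (u x) (v x)) \<in> borel_measurable M"
    if [measurable]: "u \<in> M \<rightarrow>\<^sub>M mat_borel" "v \<in> M \<rightarrow>\<^sub>M mat_borel" for u v and M :: "'z measure"
    unfolding F_def by measurable
  have trH: "(\<integral>\<^sup>+H. g (H + G * Q) \<partial>lebm a r) = (\<integral>\<^sup>+H. g H \<partial>lebm a r)"
    if "G \<in> carrier_mat a n" and [measurable]: "g \<in> borel_measurable mat_borel" for G and g :: "complex mat \<Rightarrow> ennreal"
    by (rule nn_integral_lebm_translate) (use that Q in auto)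
  have trG: "(\<integral>\<^sup>+G. g (G + (- H) * ?Q) \<partial>lebm a n) = (\<integral>\<^sup>+G. g G \<partial>lebm a n)"
    if "H \<in> carrier_mat a r" and [measurable]: "g \<in> borel_measurable mat_borel" for H and g :: "complex mat \<Rightarrow> ennreal"
    by (rule nn_integral_lebm_translate) (use that Q' in auto)
  \<comment> \<open>An independent Gaussian \<open>H\<close> is inserted at no cost, its density
    having integral 1. It supplies the second block on which the shears act.\<close>
  have "(\<integral>\<^sup>+G. f (G * Q) \<partial>gaussm a n) = (\<integral>\<^sup>+G. \<integral>\<^sup>+H. gauss_density a n G * (gauss_density a r H * f (G * Q)) \<partial>lebm a r \<partial>lebm a n)"
    by (simp add: nn_integral_gaussm_lebm nn_integral_cmult nn_integral_multc nn_integral_gauss_density)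
  also have "\<dots> = (\<integral>\<^sup>+G. \<integral>\<^sup>+H. F (G - (H + G * Q) * ?Q) (H + G * Q + (G - (H + G * Q) * ?Q) * Q) \<partial>lebm a r \<partial>lebm a n)"
  proof (rule nn_integral_lebm_cong,
         rule nn_integral_lebm_cong)
    fix G H :: "complex mat" assume G: "G \<in> carrier_mat a n" and H: "H \<in> carrier_mat a r"
    let ?V = "H + G * Q"
    have V: "?V \<in> carrier_mat a r" using G H Q by auto
    have VQ: "?V * ?Q \<in> carrier_mat a n" using V Q' by auto
    have "(G - ?V * ?Q) * Q = G * Q - ?V * ?Q * Q" by (rule minus_mult_distrib_mat[OF G VQ Q])
    also have "?V * ?Q * Q = ?V" using assoc_mult_mat[OF V Q' Q] unfolding QQ right_mult_one_mat[OF V] .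
    finally have "?V + (G - ?V * ?Q) * Q = ?V + (G * Q - ?V)" by simp
    also have "\<dots> = G * Q" by (rule eq_matI) (use G Q H in auto)
    finally have e: "?V + (G - ?V * ?Q) * Q = G * Q" .
    have "gauss_density a n G * gauss_density a r H = gauss_density a n (G - ?V * ?Q) * gauss_density a r (G * Q)"
      using fro_shear[OF G H Q QQ]
      by (simp add: gauss_density_def ennreal_mult[symmetric] exp_add[symmetric])
    then show "gauss_density a n G * (gauss_density a r H * f (G * Q)) =
        F (G - ?V * ?Q) (?V + (G - ?V * ?Q) * Q)"
      unfolding e F_def by (simp add: mult.assoc[symmetric])
  qed
  also have "\<dots> = (\<integral>\<^sup>+G. \<integral>\<^sup>+H. F (G - H * ?Q) (H + (G - H * ?Q) * Q) \<partial>lebm a r \<partial>lebm a n)"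
  proof (rule nn_integral_lebm_cong)
    fix G :: "complex mat" assume G: "G \<in> carrier_mat a n"
    show "(\<integral>\<^sup>+H. F (G - (H + G * Q) * ?Q) (H + G * Q + (G - (H + G * Q) * ?Q) * Q) \<partial>lebm a r) =
        (\<integral>\<^sup>+H. F (G - H * ?Q) (H + (G - H * ?Q) * Q) \<partial>lebm a r)"
      by (rule trH[OF G, of "\<lambda>H. F (G - H * ?Q) (H + (G - H * ?Q) * Q)"]) measurable
  qed
  \<comment> \<open>The order is exchanged because the next shear translates \<open>G\<close> by an
    amount that is constant only for fixed \<open>H\<close>.\<close>
  also have "\<dots> = (\<integral>\<^sup>+H. \<integral>\<^sup>+G. F (G - H * ?Q) (H + (G - H * ?Q) * Q) \<partial>lebm a n \<partial>lebm a r)"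
    by (rule P.Fubini'[symmetric]) measurable
  also have "\<dots> = (\<integral>\<^sup>+H. \<integral>\<^sup>+G. F G (H + G * Q) \<partial>lebm a n \<partial>lebm a r)"
  proof (rule nn_integral_lebm_cong)
    fix H :: "complex mat" assume H: "H \<in> carrier_mat a r"
    have "(\<integral>\<^sup>+G. F (G - H * ?Q) (H + (G - H * ?Q) * Q) \<partial>lebm a n) =
        (\<integral>\<^sup>+G. F (G + (- H) * ?Q) (H + (G + (- H) * ?Q) * Q) \<partial>lebm a n)"
    proof (rule nn_integral_lebm_cong)
      fix G :: "complex mat" assume G: "G \<in> carrier_mat a n"
      have "G - H * ?Q = G + (- H) * ?Q" using G H Q' by (subst uminus_mult_left_mat) auto
      then show "F (G - H * ?Q) (H + (G - H * ?Q) * Q) = F (G + (- H) * ?Q) (H + (G + (- H) * ?Q) * Q)" by simp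
    qed
    also have "\<dots> = (\<integral>\<^sup>+G. F G (H + G * Q) \<partial>lebm a n)"
      by (rule trG[OF H, of "\<lambda>G. F G (H + G * Q)"]) measurable
    finally show "(\<integral>\<^sup>+G. F (G - H * ?Q) (H + (G - H * ?Q) * Q) \<partial>lebm a n) = (\<integral>\<^sup>+G. F G (H + G * Q) \<partial>lebm a n)" .
  qed
  also have "\<dots> = (\<integral>\<^sup>+G. \<integral>\<^sup>+H. F G (H + G * Q) \<partial>lebm a r \<partial>lebm a n)"
    by (rule P.Fubini') measurable
  also have "\<dots> = (\<integral>\<^sup>+G. \<integral>\<^sup>+H. F G H \<partial>lebm a r \<partial>lebm a n)"
  proof (rule nn_integral_lebm_cong)
    fix G :: "complex mat" assume G: "G \<in> carrier_mat a n"
    show "(\<integral>\<^sup>+H. F G (H + G * Q) \<partial>lebm a r) = (\<integral>\<^sup>+H. F G H \<partial>lebm a r)"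
      by (rule trH[OF G]) measurable
  qed
  also have "\<dots> = (\<integral>\<^sup>+H. f H \<partial>gaussm a r)"
    unfolding F_def by (simp add: nn_integral_cmult nn_integral_multc nn_integral_gauss_density nn_integral_gaussm_lebm)
  finally show ?thesis .
qed

text \<open>After a substitution the scaled matrix has a density that is a Jacobian times a Gaussian
  weight. Passing from \<open>d\<close> to the larger \<open>d'\<close> increases the weight
  pointwise, so only the ratio of the two Jacobians is lost.\<close>

lemma nn_integral_gaussm_diagm_mono:
  assumes d: "\<And>j. j < k \<Longrightarrow> 0 < d j" and dd': "\<And>j. j < k \<Longrightarrow> d j \<le> d' j"
    and f[measurable]: "f \<in> borel_measurable mat_borel"
  shows "(\<integral>\<^sup>+G. f (G * diagm k d) \<partial>gaussm a k) \<le>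
     ennreal (\<Prod>j<k. (d' j / d j) ^ (2 * a)) * (\<integral>\<^sup>+G. f (G * diagm k d') \<partial>gaussm a k)"
proof -
  have d': "0 < d' j" if "j < k" for j using d[OF that] dd'[OF that] by simp
  define i where "i d j = 1 / d j" for d :: "nat \<Rightarrow> real" and j
  have inv: "G * diagm k e * diagm k (i e) = G" if "G \<in> carrier_mat a k" "\<And>j. j < k \<Longrightarrow> 0 < e j" for G e
    using that by (subst mult_diagm; (subst mult_diagm)?) (auto intro!: eq_matI simp: i_def dest!: that(2))
  have *: "(\<integral>\<^sup>+G. f (G * diagm k e) \<partial>gaussm a k) = 
     ennreal (\<Prod>j<k. (1 / e j) ^ (2 * a)) * (\<integral>\<^sup>+G. gauss_density a k (G * diagm k (i e)) * f G \<partial>lebm a k)"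
    if e: "\<And>j. j < k \<Longrightarrow> 0 < e j" for e
  proof -
    have "(\<integral>\<^sup>+G. f (G * diagm k e) \<partial>gaussm a k) =
      (\<integral>\<^sup>+G. gauss_density a k (G * diagm k e * diagm k (i e)) * f (G * diagm k e) \<partial>lebm a k)"
      by (subst nn_integral_gaussm_lebm, measurable, rule nn_integral_lebm_cong)
        (simp add: inv e)
    also have "\<dots> = ennreal (\<Prod>j<k. (1 / e j) ^ (2 * a)) * (\<integral>\<^sup>+G. gauss_density a k (G * diagm k (i e)) * f G \<partial>lebm a k)"
      by (rule nn_integral_lebm_scale[OF e]) measurable
    finally show ?thesis .
  qed
  have "(\<integral>\<^sup>+G. gauss_density a k (G * diagm k (i d)) * f G \<partial>lebm a k) \<le>
      (\<integral>\<^sup>+G. gauss_density a k (G * diagm k (i d')) * f G \<partial>lebm a k)"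
  proof (rule nn_integral_mono_AE, rule AE_mp[OF AE_lebm_carrier], rule AE_I2, rule impI, rule mult_right_mono)
    fix G :: "complex mat" assume G: "G \<in> carrier_mat a k"
    have "fro (G * diagm k (i d')) \<le> fro (G * diagm k (i d))"
      unfolding mult_diagm[OF G] fro_def
    proof (simp add: i_def, intro sum_mono power_mono norm_ge_zero)
      fix l j assume "j \<in> {..<k}"
      then have "0 < d j" "d j \<le> d' j" "0 < d' j" using d dd' d' by auto
      then show "cmod (G $$ (l, j) / complex_of_real (d' j)) \<le> cmod (G $$ (l, j) / complex_of_real (d j))"
        by (auto simp: norm_divide intro!: divide_left_mono)
    qed
    then show "gauss_density a k (G * diagm k (i d)) \<le> gauss_density a k (G * diagm k (i d'))"
      unfolding gauss_density_def by (intro ennreal_leI divide_right_mono) auto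
  qed simp
  moreover have "(\<Prod>j<k. (1 / d j) ^ (2 * a)) = (\<Prod>j<k. (d' j / d j) ^ (2 * a)) * (\<Prod>j<k. (1 / d' j) ^ (2 * a))"
    unfolding prod.distrib[symmetric] power_mult_distrib[symmetric]
    by (intro prod.cong refl) (use d' in force)
  ultimately show ?thesis
    using d d' less_imp_le by (simp add: * ennreal_mult prod_nonneg mult.assoc mult_left_mono)
qed


subsection \<open>Outage of a product of Gaussian matrices\<close>

definition outage :: "real \<Rightarrow> real \<Rightarrow> complex mat \<Rightarrow> bool" where
  "outage snr R X \<longleftrightarrow> ln (Re (Determinant.det (1\<^sub>m (dim_row X) +
     complex_of_real snr \<cdot>\<^sub>m (X * mat_adjoint X)))) < R"

lemma measurable_outage [measurable]: "Measurable.pred mat_borel (outage snr R)"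
  unfolding outage_def by measurable

section \<open>Monotonicity of the outage event in the SNR\<close>

lemma cscalar_prod_mult_mat_vec:
  assumes X: "X \<in> carrier_mat n m" and u: "u \<in> carrier_vec m" and v: "v \<in> carrier_vec n"
  shows "(X *\<^sub>v u) \<bullet>c v = u \<bullet>c (mat_adjoint X *\<^sub>v (v :: complex vec))"
proof -
  have "(X *\<^sub>v u) \<bullet>c v = (\<Sum>i<n. \<Sum>j<m. X $$ (i, j) * u $ j * cnj (v $ i))"
    using X u v by (auto simp: scalar_prod_def atLeast0LessThan sum_distrib_right intro!: sum.cong)
  also have "\<dots> = (\<Sum>j<m. \<Sum>i<n. X $$ (i, j) * u $ j * cnj (v $ i))" by (rule sum.swap)
  also have "\<dots> = u \<bullet>c (mat_adjoint X *\<^sub>v v)"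
    using X u v by (auto simp: scalar_prod_def atLeast0LessThan sum_distrib_left intro!: sum.cong)
  finally show ?thesis .
qed

lemma eigenvalue_gram_nonneg:
  assumes X: "X \<in> carrier_mat n m" and e: "eigenvalue (X * mat_adjoint X) e"
  shows "0 \<le> (e :: complex)"
proof -
  have X': "mat_adjoint X \<in> carrier_mat m n" using X by simp
  obtain v where v: "v \<in> carrier_vec n" "v \<noteq> 0\<^sub>v n" "(X * mat_adjoint X) *\<^sub>v v = e \<cdot>\<^sub>v v"
    using e X unfolding eigenvalue_def eigenvector_def by auto
  let ?u = "mat_adjoint X *\<^sub>v v"
  have u: "?u \<in> carrier_vec m" using X' v by simp
  have "?u \<bullet>c ?u = (X *\<^sub>v ?u) \<bullet>c v" by (rule cscalar_prod_mult_mat_vec[OF X u v(1), symmetric])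
  also have "X *\<^sub>v ?u = e \<cdot>\<^sub>v v" using v(3) assoc_mult_mat_vec[OF X X' v(1)] by simp
  also have "(e \<cdot>\<^sub>v v) \<bullet>c v = e * (v \<bullet>c v)" using v(1) by simp
  finally have 1: "e * (v \<bullet>c v) = ?u \<bullet>c ?u" by simp
  have 2: "0 \<le> ?u \<bullet>c ?u" by (rule conjugate_square_ge_0_vec)
  have 3: "0 < v \<bullet>c v" using conjugate_square_greater_0_vec[OF v(1)] v(2) by blast
  obtain x where x: "v \<bullet>c v = complex_of_real x" "0 < x"
    using 3 by (metis complex_is_Real_iff less_complex_def of_real_Re zero_complex.sel)
  have "Re e * x \<ge> 0" "Im e * x = 0" using 1 2 unfolding x by (auto simp: less_eq_complex_def complex_eq_iff)
  then show ?thesis using x(2) by (simp add: less_eq_complex_def zero_le_mult_iff)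
qed

text \<open>For \<open>t\<close> different from 0 this is the characteristic polynomial at -1/t,
  because I + t B equals -t times ((-1/t) I - B).\<close>

lemma det_one_plus_smult_eigenvalues:
  assumes B: "(B :: complex mat) \<in> carrier_mat n n" and es: "char_poly B = (\<Prod>e\<leftarrow>es. [:- e, 1:])" and len: "length es = n"
  shows "Determinant.det (1\<^sub>m n + t \<cdot>\<^sub>m B) = (\<Prod>e\<leftarrow>es. 1 + t * e)"
proof (cases "t = 0")
  case True
  have "1\<^sub>m n + 0 \<cdot>\<^sub>m B = 1\<^sub>m n" by (rule eq_matI) (use B in auto)
  then show ?thesis using True by (simp add: map_replicate_const)
next
  case False
  let ?e = "- (1 / t)"
  have "1\<^sub>m n + t \<cdot>\<^sub>m B = (- t) \<cdot>\<^sub>m (- char_matrix B ?e)"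
    by (rule eq_matI) (use B False in \<open>auto simp: char_matrix_def field_simps\<close>)
  then have "Determinant.det (1\<^sub>m n + t \<cdot>\<^sub>m B) = (- t) ^ n * Determinant.det (- char_matrix B ?e)"
    using B by (simp add: char_matrix_def)
  also have "Determinant.det (- char_matrix B ?e) = poly (char_poly B) ?e"
    using char_poly_matrix[OF B, of ?e] by simp
  also have "(- t) ^ n * poly (char_poly B) ?e = (\<Prod>e\<leftarrow>es. 1 + t * e)"
    unfolding es len[symmetric] using False
    by (induction es) (auto simp: field_simps)
  finally show ?thesis .
qed

text \<open>The eigenvalues of the Gram matrix are nonnegative, and every factor 1 + t e of the
  determinant is positive and nondecreasing in t. Positivity is what the logarithm in the outage
  event requires.\<close>

lemma det_gram_mono:
  fixes X :: "complex mat"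
  assumes s: "0 \<le> s" and st: "s \<le> t"
  defines "D \<equiv> \<lambda>t. Re (Determinant.det (1\<^sub>m (dim_row X) + complex_of_real t \<cdot>\<^sub>m (X * mat_adjoint X)))"
  shows "0 < D s" and "D s \<le> D t"
proof -
  let ?n = "dim_row X" and ?B = "X * mat_adjoint X"
  have X: "X \<in> carrier_mat ?n (dim_col X)" by simp
  have B: "?B \<in> carrier_mat ?n ?n" by (rule carrier_matI) (simp_all only: index_mult_mat dim_mat_adjoint)
  obtain es where es: "char_poly ?B = (\<Prod>e\<leftarrow>es. [:- e, 1:])" "length es = ?n"
    using char_poly_factorized[OF B] by blast
  have pos: "0 \<le> e" if "e \<in> set es" for e
  proof -
    have "poly (char_poly ?B) e = 0" unfolding es using that by (induction es) auto
    then show ?thesis using eigenvalue_gram_nonneg[OF X] eigenvalue_root_char_poly[OF B] by blast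
  qed
  have D: "D t = (\<Prod>e\<leftarrow>map Re es. 1 + t * e)" for t
  proof -
    have "(\<Prod>e\<leftarrow>es. 1 + complex_of_real t * e) = complex_of_real (\<Prod>e\<leftarrow>map Re es. 1 + t * e)"
      using pos
    proof (induction es)
      case (Cons e es)
      have "e = complex_of_real (Re e)" using Cons.prems[of e] by (auto simp: less_eq_complex_def complex_eq_iff)
      then have "1 + complex_of_real t * e = complex_of_real (1 + t * Re e)"
        by (metis of_real_1 of_real_add of_real_mult)
      then show ?case using Cons by simp
    qed simp
    then show ?thesis unfolding D_def det_one_plus_smult_eigenvalues[OF B es] by simp
  qed
  have pos': "0 \<le> e" if "e \<in> set (map Re es)" for e
    using that pos by (auto simp: less_eq_complex_def)
  have *: "0 < (\<Prod>e\<leftarrow>xs. 1 + s * e) \<and> (\<Prod>e\<leftarrow>xs. 1 + s * e) \<le> (\<Prod>e\<leftarrow>xs. 1 + t * e)"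
    if "\<And>e. e \<in> set xs \<Longrightarrow> 0 \<le> e" for xs :: "real list"
    using that
  proof (induction xs)
    case (Cons e xs)
    have "0 \<le> e" using Cons.prems by simp
    then have "0 < 1 + s * e" "1 + s * e \<le> 1 + t * e"
      using s st by (auto intro!: mult_right_mono add_pos_nonneg)
    then show ?case using Cons by (auto intro!: mult_mono mult_pos_pos)
  qed simp
  show "0 < D s" "D s \<le> D t" using *[of "map Re es", OF pos'] unfolding D by blast+
qed

text \<open>Scaling the channel by \<open>c\<close> has the same effect as lowering the SNR to
  \<open>snr * c\<^sup>2\<close>.\<close>

lemma outage_smult:
  assumes c: "0 \<le> c" "c \<le> 1" and snr: "0 \<le> snr" and X: "outage snr R X"
  shows "outage snr R (complex_of_real c \<cdot>\<^sub>m X)"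
proof -
  let ?Y = "complex_of_real c \<cdot>\<^sub>m X" and ?s = "snr * c\<^sup>2"
  have s: "0 \<le> ?s" "?s \<le> snr" using c snr by (auto simp: power_le_one mult_left_le)
  have "complex_of_real snr \<cdot>\<^sub>m (?Y * mat_adjoint ?Y) = complex_of_real ?s \<cdot>\<^sub>m (X * mat_adjoint X)"
    by (rule eq_matI) (auto simp: scalar_prod_def sum_distrib_left power2_eq_square mult_ac intro!: sum.cong)
  then have "outage snr R ?Y \<longleftrightarrow> ln (Re (Determinant.det (1\<^sub>m (dim_row X) + complex_of_real ?s \<cdot>\<^sub>m (X * mat_adjoint X)))) < R"
    by (simp add: outage_def)
  moreover have "ln (Re (Determinant.det (1\<^sub>m (dim_row X) + complex_of_real ?s \<cdot>\<^sub>m (X * mat_adjoint X)))) \<le>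
      ln (Re (Determinant.det (1\<^sub>m (dim_row X) + complex_of_real snr \<cdot>\<^sub>m (X * mat_adjoint X))))"
    using det_gram_mono[OF s, of X] ln_mono by simp
  ultimately show ?thesis using X unfolding outage_def by simp
qed

text \<open>The outage probability of \<open>G\<^sub>m \<cdots> G\<^sub>1 X\<close> for independent standard Gaussian matrices \<open>G\<^sub>i\<close>
  whose numbers of rows are listed in the argument.\<close>

fun gauss_outage :: "real \<Rightarrow> real \<Rightarrow> nat list \<Rightarrow> complex mat \<Rightarrow> ennreal" where
  "gauss_outage snr R [] X = indicator (Collect (outage snr R)) X"
| "gauss_outage snr R (a # as) X = (\<integral>\<^sup>+G. gauss_outage snr R as (G * X) \<partial>gaussm a (dim_row X))"

text \<open>The measure of integration varies with \<open>X\<close> only through its row count, so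
  it is constant on each of countably many measurable pieces.\<close>

lemma measurable_gaussm_integral:
  assumes f[measurable]: "(\<lambda>(X, G). f X G) \<in> borel_measurable (mat_borel \<Otimes>\<^sub>M mat_borel)"
  shows "(\<lambda>X. \<integral>\<^sup>+G. f X G \<partial>gaussm a (dim_row X)) \<in> borel_measurable mat_borel"
proof (rule measurable_compose_countable[OF _ measurable_dim_row])
  fix k
  interpret G: prob_space "gaussm a k" by (rule prob_space_gaussm)
  show "(\<lambda>X. \<integral>\<^sup>+G. f X G \<partial>gaussm a k) \<in> borel_measurable mat_borel"
    by (rule G.borel_measurable_nn_integral) measurable
qed

lemma measurable_gauss_outage [measurable]: "gauss_outage snr R as \<in> borel_measurable mat_borel"
proof (induction as)
  case Nil
  have "Collect (outage snr R) \<in> sets mat_borel"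
    using predE[OF measurable_outage[of snr R]] by simp
  then show ?case by (simp add: borel_measurable_indicator[of _ mat_borel, simplified])
next
  case (Cons a as)
  note [measurable] = Cons
  show ?case unfolding gauss_outage.simps by (rule measurable_gaussm_integral) measurable
qed

lemma gauss_outage_smult:
  assumes c: "0 \<le> c" "c \<le> 1" and snr: "0 \<le> snr"
  shows "gauss_outage snr R as X \<le> gauss_outage snr R as (complex_of_real c \<cdot>\<^sub>m X)"
proof (induction as arbitrary: X)
  case Nil
  then show ?case using outage_smult[OF c snr] by (auto simp: indicator_def)
next
  case (Cons a as)
  have "gauss_outage snr R (a # as) X \<le> (\<integral>\<^sup>+G. gauss_outage snr R as (complex_of_real c \<cdot>\<^sub>m (G * X)) \<partial>gaussm a (dim_row X))"
    unfolding gauss_outage.simps by (intro nn_integral_mono Cons)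
  also have "\<dots> = gauss_outage snr R (a # as) (complex_of_real c \<cdot>\<^sub>m X)"
    unfolding gauss_outage.simps index_smult_mat
  proof (rule nn_integral_gaussm_cong)
    fix G :: "complex mat" assume G: "G \<in> carrier_mat a (dim_row X)"
    have "complex_of_real c \<cdot>\<^sub>m (G * X) = G * (complex_of_real c \<cdot>\<^sub>m X)"
      using mult_smult_distrib[OF G, of X "dim_col X"] by simp
    then show "gauss_outage snr R as (complex_of_real c \<cdot>\<^sub>m (G * X)) = gauss_outage snr R as (G * (complex_of_real c \<cdot>\<^sub>m X))"
      by simp
  qed
  finally show ?case .
qed

text \<open>The leading Gaussian factor absorbs \<open>Q\<close>, while the number of its columns
  changes from \<open>n\<close> to \<open>r\<close>. This is why a projection costs nothing.\<close>

lemma gauss_outage_isometry: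
  assumes Q: "Q \<in> carrier_mat n r" and QQ: "mat_adjoint Q * Q = 1\<^sub>m r" and X: "X \<in> carrier_mat r m"
  shows "gauss_outage snr R (a # as) (Q * X) = gauss_outage snr R (a # as) X"
proof -
  have "gauss_outage snr R (a # as) (Q * X) = (\<integral>\<^sup>+G. gauss_outage snr R as (G * Q * X) \<partial>gaussm a n)"
    unfolding gauss_outage.simps index_mult_mat carrier_matD(1)[OF Q]
    by (intro nn_integral_gaussm_cong) (simp only: assoc_mult_mat[OF _ Q X])
  also have "\<dots> = (\<integral>\<^sup>+G. gauss_outage snr R as (G * X) \<partial>gaussm a r)"
    by (rule nn_integral_gaussm_isometry[OF Q QQ]) measurable
  finally show ?thesis using X by simp
qed

lemma gauss_outage_diagm_mono:
  assumes X: "X \<in> carrier_mat k m" and d: "\<And>j. j < k \<Longrightarrow> 0 < d j" and dd': "\<And>j. j < k \<Longrightarrow> d j \<le> d' j"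
  shows "gauss_outage snr R (a # as) (diagm k d * X) \<le>
     ennreal (\<Prod>j<k. (d' j / d j) ^ (2 * a)) * gauss_outage snr R (a # as) (diagm k d' * X)"
proof -
  have *: "gauss_outage snr R (a # as) (diagm k e * X) = (\<integral>\<^sup>+G. gauss_outage snr R as (G * diagm k e * X) \<partial>gaussm a k)" for e
    unfolding gauss_outage.simps index_mult_mat dim_diagm
    by (intro nn_integral_gaussm_cong) (simp only: assoc_mult_mat[OF _ diagm_carrier X])
  show ?thesis unfolding * by (rule nn_integral_gaussm_diagm_mono[OF d dd']) measurable
qed

lemma diagm_const_mult: "X \<in> carrier_mat k m \<Longrightarrow> diagm k (\<lambda>_. c) * X = complex_of_real c \<cdot>\<^sub>m X"
  by (rule eq_matI) (auto simp: diagm_def scalar_prod_def if_distrib if_distribR sum.delta cong: if_cong)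

text \<open>Raising the scale is paid for by the Jacobian of the leading Gaussian factor; lowering
  it is free because outage is monotone. The maximum with 1 covers both cases.\<close>

lemma gauss_outage_scale:
  assumes X: "X \<in> carrier_mat k m" and "0 < l" "0 < u" and snr: "0 \<le> snr"
  shows "gauss_outage snr R (a # as) (complex_of_real l \<cdot>\<^sub>m X) \<le>
     ennreal (max 1 (u / l) ^ (2 * a * k)) * gauss_outage snr R (a # as) (complex_of_real u \<cdot>\<^sub>m X)"
proof (cases "l \<le> u")
  case True
  have "gauss_outage snr R (a # as) (diagm k (\<lambda>_. l) * X) \<le>
      ennreal (\<Prod>j<k. (u / l) ^ (2 * a)) * gauss_outage snr R (a # as) (diagm k (\<lambda>_. u) * X)"
    by (rule gauss_outage_diagm_mono[OF X]) (use assms True in auto)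
  moreover have "max 1 (u / l) = u / l" using True assms by (simp add: max_def)
  ultimately show ?thesis by (simp only: diagm_const_mult[OF X] prod_constant card_lessThan power_mult)
next
  case False
  have "gauss_outage snr R (a # as) (complex_of_real l \<cdot>\<^sub>m X) \<le>
      gauss_outage snr R (a # as) (complex_of_real (u / l) \<cdot>\<^sub>m (complex_of_real l \<cdot>\<^sub>m X))"
    by (rule gauss_outage_smult) (use False assms in auto)
  also have "complex_of_real (u / l) \<cdot>\<^sub>m (complex_of_real l \<cdot>\<^sub>m X) = complex_of_real u \<cdot>\<^sub>m X"
    by (rule eq_matI) (use assms in auto)
  moreover have "max 1 (u / l) = 1" using False assms by (simp add: max_def)
  ultimately show ?thesis by simp
qed

text \<open>A change of the scale of \<open>X\<close> is an exponential tilt of the first Gaussian matrix; the tilt dominates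
  every power of \<open>1 + fro G\<close>.\<close>

lemma gauss_outage_tilt:
  assumes X: "X \<in> carrier_mat k m" and c: "0 < c"
  shows "gauss_outage snr R (a # as) (complex_of_real c \<cdot>\<^sub>m X) =
     ennreal ((1 / c) ^ (2 * a * k)) *
     (\<integral>\<^sup>+G. ennreal (exp ((1 - 1 / c\<^sup>2) * fro G)) * gauss_outage snr R as (G * X) \<partial>gaussm a k)"
proof -
  let ?c = "diagm k (\<lambda>_. c)" and ?i = "diagm k (\<lambda>_. 1 / c)"
  have "gauss_outage snr R (a # as) (complex_of_real c \<cdot>\<^sub>m X) =
      (\<integral>\<^sup>+G. gauss_density a k G * gauss_outage snr R as (G * (complex_of_real c \<cdot>\<^sub>m X)) \<partial>lebm a k)"
    using X by (simp add: nn_integral_gaussm_lebm)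
  also have "\<dots> = (\<integral>\<^sup>+G. gauss_density a k (G * ?c * ?i) * gauss_outage snr R as (G * ?c * X) \<partial>lebm a k)"
  proof (rule nn_integral_lebm_cong)
    fix G :: "complex mat" assume G: "G \<in> carrier_mat a k"
    have "G * ?c * ?i = G" using G c
      by (subst mult_diagm; (subst mult_diagm)?) (auto intro!: eq_matI)
    moreover have "G * ?c * X = G * (complex_of_real c \<cdot>\<^sub>m X)"
      using assoc_mult_mat[OF G diagm_carrier X] by (simp add: diagm_const_mult[OF X])
    ultimately show "gauss_density a k G * gauss_outage snr R as (G * (complex_of_real c \<cdot>\<^sub>m X)) =
        gauss_density a k (G * ?c * ?i) * gauss_outage snr R as (G * ?c * X)" by simp
  qed
  also have "\<dots> = ennreal (\<Prod>j<k. (1 / c) ^ (2 * a)) * (\<integral>\<^sup>+G. gauss_density a k (G * ?i) * gauss_outage snr R as (G * X) \<partial>lebm a k)"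
    by (rule nn_integral_lebm_scale) (use c in measurable)
  also have "(\<integral>\<^sup>+G. gauss_density a k (G * ?i) * gauss_outage snr R as (G * X) \<partial>lebm a k) =
      (\<integral>\<^sup>+G. gauss_density a k G * (ennreal (exp ((1 - 1 / c\<^sup>2) * fro G)) * gauss_outage snr R as (G * X)) \<partial>lebm a k)"
  proof (rule nn_integral_lebm_cong)
    fix G :: "complex mat" assume G: "G \<in> carrier_mat a k"
    have "fro (G * ?i) = fro G / c\<^sup>2"
      using G c by (simp add: mult_diagm fro_def norm_divide power_divide sum_divide_distrib)
    then have "gauss_density a k (G * ?i) = gauss_density a k G * ennreal (exp ((1 - 1 / c\<^sup>2) * fro G))"
      by (simp add: gauss_density_def ennreal_mult[symmetric] exp_add[symmetric] algebra_simps)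
    then show "gauss_density a k (G * ?i) * gauss_outage snr R as (G * X) =
        gauss_density a k G * (ennreal (exp ((1 - 1 / c\<^sup>2) * fro G)) * gauss_outage snr R as (G * X))"
      by (simp add: mult.assoc)
  qed
  finally show ?thesis by (simp add: nn_integral_gaussm_lebm power_mult)
qed


subsection \<open>The effect of a relay on the outage probability\<close>

text \<open>The common shape of both schemes: an isometry whose range contains the columns of
  \<open>E\<close>. The identity gives amplify-and-forward, \<open>PF_Q\<close> gives
  project-and-forward.\<close>

definition projector :: "(complex mat \<Rightarrow> complex mat) \<Rightarrow> bool" where
  "projector q \<longleftrightarrow> q \<in> mat_borel \<rightarrow>\<^sub>M mat_borel \<and>
     (\<forall>E. q E \<in> carrier_mat (dim_row E) (dim_col (q E)) \<and> dim_col (q E) \<le> dim_row E \<and>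
       mat_adjoint (q E) * q E = 1\<^sub>m (dim_col (q E)) \<and> q E * (mat_adjoint (q E) * E) = E)"

definition relay :: "(complex mat \<Rightarrow> complex mat) \<Rightarrow> real \<Rightarrow> real \<Rightarrow> complex mat \<Rightarrow> complex mat" where
  "relay q \<kappa> snr E = normalizer \<kappa> snr (mat_adjoint (q E) * E) * mat_adjoint (q E)"

lemma measurable_relay:
  assumes "projector q"
  shows "relay q \<kappa> snr \<in> mat_borel \<rightarrow>\<^sub>M mat_borel"
proof -
  have [measurable]: "q \<in> mat_borel \<rightarrow>\<^sub>M mat_borel" using assms by (simp add: projector_def)
  show ?thesis unfolding relay_def[abs_def] by measurable
qed

text \<open>As \<^const>\<open>gauss_outage\<close>, but every layer except the last one processes what it receives.\<close>

fun relayed_outage :: "(complex mat \<Rightarrow> complex mat) \<Rightarrow> real \<Rightarrow> real \<Rightarrow> real \<Rightarrow> nat list \<Rightarrow> complex mat \<Rightarrow> ennreal" where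
  "relayed_outage q \<kappa> snr R [] X = indicator (Collect (outage snr R)) X"
| "relayed_outage q \<kappa> snr R [a] X = gauss_outage snr R [a] X"
| "relayed_outage q \<kappa> snr R (a # b # as) X =
     (\<integral>\<^sup>+E. relayed_outage q \<kappa> snr R (b # as) (relay q \<kappa> snr E * (E * X)) \<partial>gaussm a (dim_row X))"

lemma measurable_relayed_outage:
  assumes "projector q"
  shows "relayed_outage q \<kappa> snr R as \<in> borel_measurable mat_borel"
proof (induction as rule: induct_list012)
  case 1
  then show ?case using measurable_gauss_outage[of snr R "[]"] by (simp cong: measurable_cong)
next
  case (2 a)
  then show ?case using measurable_gauss_outage[of snr R "[a]"] by (simp cong: measurable_cong)
next
  case (3 a b as)
  note [measurable] = 3(2) measurable_relay[OF assms]
  show ?case unfolding relayed_outage.simps by (rule measurable_gaussm_integral) measurable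
qed

text \<open>\<open>Q\<close> times its adjoint fixes the columns of \<open>E\<close>, so projecting
  loses no energy. The gains behind the projection can thus be bounded below through
  \<open>fro E\<close>, the same quantity for both schemes.\<close>

lemma fro_adjoint_mult:
  assumes Q: "Q \<in> carrier_mat n r" and E: "E \<in> carrier_mat n k" and QE: "Q * (mat_adjoint Q * E) = E"
  shows "fro (mat_adjoint Q * E) = fro E"
proof -
  have Q': "mat_adjoint Q \<in> carrier_mat r n" and E': "mat_adjoint E \<in> carrier_mat k n" using Q E by simp_all
  have QsE: "mat_adjoint Q * E \<in> carrier_mat r k" using Q' E by simp
  have EQ: "mat_adjoint E * Q \<in> carrier_mat k r" using E' Q by simp
  have adj: "mat_adjoint (mat_adjoint Q * E) = mat_adjoint E * Q"
    unfolding mat_adjoint_mult[OF Q' E] mat_adjoint_mat_adjoint ..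
  have "mat_adjoint E * Q * mat_adjoint Q = mat_adjoint (Q * (mat_adjoint Q * E))"
    unfolding mat_adjoint_mult[OF Q QsE] adj ..
  then have e: "mat_adjoint E * Q * mat_adjoint Q = mat_adjoint E" unfolding QE .
  have "complex_of_real (fro (mat_adjoint E * Q)) = frip (mat_adjoint E) (mat_adjoint E * Q * mat_adjoint Q)"
    unfolding frip_self[symmetric] by (rule frip_mult[OF E' Q EQ])
  also have "\<dots> = complex_of_real (fro (mat_adjoint E))" unfolding e frip_self ..
  finally have "fro (mat_adjoint E * Q) = fro (mat_adjoint E)" by (simp only: of_real_eq_iff)
  then show ?thesis using fro_adjoint[of "mat_adjoint Q * E"] fro_adjoint[of E] unfolding adj by simp
qed

text \<open>\<open>gain\<close> is the diagonal of \<^const>\<open>normalizer\<close>, and \<open>min_gain\<close> a lower bound for it that does not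
  depend on \<open>snr \<ge> 1\<close>; \<open>Suc a\<close> instead of \<open>a\<close> keeps it positive when \<open>a = 0\<close>.\<close>

definition gain :: "real \<Rightarrow> real \<Rightarrow> complex mat \<Rightarrow> nat \<Rightarrow> real" where
  "gain \<kappa> snr G j = min \<kappa> ((snr / real (dim_col G) * (\<Sum>k<dim_col G. (cmod (G $$ (j, k)))\<^sup>2) + 1) powr (- 1 / 2)
        * sqrt (snr / real (dim_row G)))"

lemma normalizer_eq_diagm: "normalizer \<kappa> snr G = diagm (dim_row G) (gain \<kappa> snr G)"
  unfolding normalizer_def diagm_def gain_def by (rule eq_matI) auto

definition min_gain :: "real \<Rightarrow> nat \<Rightarrow> real \<Rightarrow> real" where
  "min_gain \<kappa> a x = min \<kappa> (1 / sqrt (real (Suc a) * (1 + x)))"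

lemma min_gain_pos: "0 < \<kappa> \<Longrightarrow> 0 \<le> x \<Longrightarrow> 0 < min_gain \<kappa> a x"
  unfolding min_gain_def by (auto intro!: divide_pos_pos mult_pos_pos add_pos_nonneg)

text \<open>For \<open>snr\<close> \<ge> 1 the received power including noise is at most
  \<open>snr * (1 + fro G)\<close>, so \<open>snr\<close> cancels against the transmit power in the
  numerator.\<close>

lemma min_gain_le_gain:
  assumes snr: "1 \<le> snr" and j: "j < dim_row G" and a: "dim_row G \<le> a"
  shows "min_gain \<kappa> a (fro G) \<le> gain \<kappa> snr G j"
proof -
  define S where "S = (\<Sum>k<dim_col G. (cmod (G $$ (j, k)))\<^sup>2)"
  have S0: "0 \<le> S" unfolding S_def by (intro sum_nonneg) auto
  have SF: "S \<le> fro G" unfolding S_def fro_def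
    by (rule member_le_sum[where f = "\<lambda>i. \<Sum>k<dim_col G. (cmod (G $$ (i, k)))\<^sup>2"]) (use j in \<open>auto intro!: sum_nonneg\<close>)
  define r where "r = real (dim_row G)"
  have r: "1 \<le> r" "r \<le> real (Suc a)" using j a by (auto simp: r_def)
  define x where "x = snr / real (dim_col G) * S + 1"
  have "snr / real (dim_col G) * S \<le> snr * S"
  \<comment> \<open>Without columns the quotient is 0 by the convention on division.\<close>
  proof (cases "dim_col G = 0")
    case False
    then have "snr / real (dim_col G) \<le> snr / 1" using snr by (intro divide_left_mono) auto
    then show ?thesis using S0 by (intro mult_right_mono) auto
  qed (use S0 snr in auto)
  then have x: "1 \<le> x" "x \<le> snr * (1 + fro G)"
  proof -
    show "1 \<le> x" using S0 snr by (simp add: x_def)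
    have "x \<le> snr * S + snr" using \<open>snr / real (dim_col G) * S \<le> snr * S\<close> snr by (simp add: x_def)
    also have "\<dots> \<le> snr * fro G + snr" using mult_left_mono[OF SF, of snr] snr by simp
    finally show "x \<le> snr * (1 + fro G)" by (simp add: algebra_simps)
  qed
  have "x * r \<le> snr * (1 + fro G) * real (Suc a)" using x r by (intro mult_mono) auto
  then have "1 / (real (Suc a) * (1 + fro G)) \<le> snr / (x * r)"
    using x r fro_nonneg[of G] snr by (simp add: divide_simps mult_ac add_pos_nonneg mult_pos_pos)
  then have "sqrt (1 / (real (Suc a) * (1 + fro G))) \<le> sqrt (snr / (x * r))" by (rule real_sqrt_le_mono)
  also have "\<dots> = x powr (- 1 / 2) * sqrt (snr / r)"
    using x by (simp add: powr_minus powr_half_sqrt real_sqrt_divide real_sqrt_mult divide_simps)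
  finally have "1 / sqrt (real (Suc a) * (1 + fro G)) \<le> x powr (- 1 / 2) * sqrt (snr / r)"
    by (simp only: real_sqrt_divide real_sqrt_one)
  then show ?thesis unfolding min_gain_def gain_def S_def[symmetric] x_def[symmetric] r_def[symmetric] by auto
qed

text \<open>The minimum leaves either 1 or \<open>\<kappa>\<^sup>2 * real (Suc a) * (1 + x)\<close>,
  and the bound dominates their sum. It is linear in \<open>x\<close>, which keeps the total loss
  polynomial.\<close>

lemma ratio_min_gain:
  assumes \<kappa>: "0 < \<kappa>" and x: "0 \<le> x"
  shows "(\<kappa> / min_gain \<kappa> a x)\<^sup>2 \<le> (1 + \<kappa>\<^sup>2 * real (Suc a)) * (1 + x)"
proof -
  let ?s = "real (Suc a) * (1 + x)"
  have s: "0 < ?s" using x by (intro mult_pos_pos) auto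
  have K: "(1 + \<kappa>\<^sup>2 * real (Suc a)) * (1 + x) = 1 + x + \<kappa>\<^sup>2 * ?s" by (simp add: algebra_simps)
  show ?thesis
  proof (cases "\<kappa> \<le> 1 / sqrt ?s")
    case True
    then have "min_gain \<kappa> a x = \<kappa>" by (simp add: min_gain_def min_def)
    then show ?thesis using \<kappa> x s unfolding K by simp
  next
    case False
    then have "min_gain \<kappa> a x = 1 / sqrt ?s" by (simp add: min_gain_def min_def)
    then have "(\<kappa> / min_gain \<kappa> a x)\<^sup>2 = \<kappa>\<^sup>2 * ?s" using s by (simp add: power_mult_distrib del: of_nat_Suc)
    then show ?thesis unfolding K using x by simp
  qed
qed

text \<open>A relay rescales at most \<open>a\<close> columns of the next Gaussian matrix, which has
  \<open>b\<close> rows. By the Jacobian each column costs the ratio of extreme gains to the power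
  \<open>2 * b\<close>, and \<open>ratio_min_gain\<close> bounds the square of that ratio.\<close>

definition distortion :: "real \<Rightarrow> nat \<Rightarrow> nat \<Rightarrow> real \<Rightarrow> real" where
  "distortion \<kappa> a b x = ((1 + \<kappa>\<^sup>2 * real (Suc a)) * (1 + x)) ^ (a * b)"

lemma prod_ratio_le_distortion:
  assumes \<kappa>: "0 < \<kappa>" and x: "0 \<le> x" and r: "r \<le> a"
    and q: "\<And>j. j < r \<Longrightarrow> 0 \<le> q j" "\<And>j. j < r \<Longrightarrow> q j \<le> \<kappa> / min_gain \<kappa> a x"
  shows "(\<Prod>j<r. q j ^ (2 * b)) \<le> distortion \<kappa> a b x"
proof -
  let ?K = "(1 + \<kappa>\<^sup>2 * real (Suc a)) * (1 + x)"
  have "1 * 1 \<le> ?K" using x by (intro mult_mono) auto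
  then have K: "1 \<le> ?K" by simp
  have "(\<Prod>j<r. q j ^ (2 * b)) \<le> (\<Prod>j<r. ?K ^ b)"
  proof (intro prod_mono conjI)
    fix j assume j: "j \<in> {..<r}"
    then have "q j ^ 2 \<le> (\<kappa> / min_gain \<kappa> a x)\<^sup>2" using q by (intro power_mono) auto
    also have "\<dots> \<le> ?K" by (rule ratio_min_gain[OF \<kappa> x])
    finally show "q j ^ (2 * b) \<le> ?K ^ b" unfolding power_mult by (intro power_mono) auto
    show "0 \<le> q j ^ (2 * b)" using q j by simp
  qed
  also have "\<dots> = ?K ^ (b * r)" by (simp only: prod_constant card_lessThan power_mult)
  also have "\<dots> \<le> ?K ^ (a * b)" using K r by (intro power_increasing) (auto simp: mult.commute)
  finally show ?thesis unfolding distortion_def .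
qed

text \<open>exp (x / 2) is the \<open>m\<close>-th power of exp (x / (2 m)), whose base dominates a
  linear function of x. Any rate below 1 would leave a Gaussian weight integrable; the choice 1/2
  determines the scales \<open>c1\<close> and \<open>c2\<close> used for the tilts.\<close>

lemma distortion_le_exp: "\<exists>C>0. \<forall>x\<ge>0. distortion \<kappa> a b x \<le> C * exp (x / 2)"
proof -
  \<comment> \<open>The successor keeps \<open>m\<close> positive when \<open>a * b\<close> is 0;
    raising the exponent is allowed since the base is at least 1.\<close>
  define m where "m = Suc (a * b)"
  define K where "K = 1 + \<kappa>\<^sup>2 * real (Suc a)"
  have K: "1 \<le> K" by (simp add: K_def)
  show ?thesis
  proof (intro exI[of _ "(K * (2 * real m)) ^ m"] conjI allI impI)
    show "0 < (K * (2 * real m)) ^ m" using K by (intro zero_less_power mult_pos_pos) (auto simp del: of_nat_Suc simp: m_def)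
    fix x :: real assume x: "0 \<le> x"
    have m: "1 \<le> real m" by (simp add: m_def)
    have "1 + x \<le> 2 * real m * (1 + x / (2 * real m))" using x m by (simp add: algebra_simps)
    also have "\<dots> \<le> 2 * real m * exp (x / (2 * real m))" using m by (intro mult_left_mono exp_ge_add_one_self) auto
    finally have 1: "K * (1 + x) \<le> K * (2 * real m) * exp (x / (2 * real m))" using K by simp
    have "1 * 1 \<le> K * (1 + x)" using K x by (intro mult_mono) auto
    then have "distortion \<kappa> a b x \<le> (K * (1 + x)) ^ m"
      unfolding distortion_def K_def[symmetric] m_def by (intro power_increasing) auto
    also have "\<dots> \<le> (K * (2 * real m) * exp (x / (2 * real m))) ^ m"
      using 1 K x by (intro power_mono) auto
    also have "\<dots> = (K * (2 * real m)) ^ m * exp (x / 2)"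
      using m by (simp add: power_mult_distrib exp_of_nat_mult[symmetric])
    finally show "distortion \<kappa> a b x \<le> (K * (2 * real m)) ^ m * exp (x / 2)" .
  qed
qed

text \<open>The next Gaussian matrix does not see \<open>Q\<close>, so the two sides differ only by
  a diagonal \<open>d\<close> against the scalar \<kappa>, and every relevant \<open>d j\<close>
  lies between \<mu> and \<kappa>.\<close>

lemma gauss_outage_relay:
  assumes q: "projector q" and \<kappa>: "0 < \<kappa>" and snr: "1 \<le> snr"
    and E: "E \<in> carrier_mat a k" and X: "X \<in> carrier_mat k m"
  shows "gauss_outage snr R (b # bs) (relay q \<kappa> snr E * (E * X)) \<le>
       ennreal (distortion \<kappa> a b (fro E)) * gauss_outage snr R (b # bs) (E * (complex_of_real \<kappa> \<cdot>\<^sub>m X))" (is ?upper)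
    and "gauss_outage snr R (b # bs) (E * (complex_of_real \<kappa> \<cdot>\<^sub>m X)) \<le>
       ennreal (distortion \<kappa> a b (fro E)) * gauss_outage snr R (b # bs) (relay q \<kappa> snr E * (E * X))" (is ?lower)
proof -
  define Q where "Q = q E"
  define r where "r = dim_col Q"
  have Q: "Q \<in> carrier_mat a r" and r: "r \<le> a" and QQ: "mat_adjoint Q * Q = 1\<^sub>m r" and QE: "Q * (mat_adjoint Q * E) = E"
    using q E unfolding projector_def Q_def r_def by auto
  have Q': "mat_adjoint Q \<in> carrier_mat r a" using Q by simp
  define G where "G = mat_adjoint Q * E"
  have G: "G \<in> carrier_mat r k" using Q' E by (simp add: G_def)
  have froG: "fro G = fro E" unfolding G_def by (rule fro_adjoint_mult[OF Q E QE])
  define Y where "Y = G * X"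
  have Y: "Y \<in> carrier_mat r m" using G X by (simp add: Y_def)
  define d where "d = gain \<kappa> snr G"
  have relay: "relay q \<kappa> snr E * (E * X) = diagm r d * Y"
  proof -
    have "relay q \<kappa> snr E * (E * X) = diagm r d * mat_adjoint Q * (E * X)"
      unfolding relay_def Q_def[symmetric] G_def[symmetric] normalizer_eq_diagm d_def using G by simp
    also have "\<dots> = diagm r d * (mat_adjoint Q * (E * X))"
      by (rule assoc_mult_mat[OF diagm_carrier Q']) (rule mult_carrier_mat[OF E X])
    also have "mat_adjoint Q * (E * X) = Y"
      unfolding Y_def G_def by (rule assoc_mult_mat[OF Q' E X, symmetric])
    finally show ?thesis .
  qed
  have QcY: "gauss_outage snr R (b # bs) (complex_of_real c \<cdot>\<^sub>m Y) = gauss_outage snr R (b # bs) (E * (complex_of_real c \<cdot>\<^sub>m X))" for c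
  proof -
    have "E * (complex_of_real c \<cdot>\<^sub>m X) = Q * G * (complex_of_real c \<cdot>\<^sub>m X)" unfolding G_def QE ..
    also have "\<dots> = Q * (G * (complex_of_real c \<cdot>\<^sub>m X))" using X by (intro assoc_mult_mat[OF Q G, of _ m]) simp
    also have "G * (complex_of_real c \<cdot>\<^sub>m X) = complex_of_real c \<cdot>\<^sub>m Y"
      unfolding Y_def by (rule mult_smult_distrib[OF G X])
    finally show ?thesis using gauss_outage_isometry[OF Q QQ, of "complex_of_real c \<cdot>\<^sub>m Y" m snr R b bs] Y by simp
  qed
  define \<mu> where "\<mu> = min_gain \<kappa> a (fro E)"
  have \<mu>: "0 < \<mu>" "\<mu> \<le> \<kappa>" using min_gain_pos[OF \<kappa> fro_nonneg] by (auto simp: \<mu>_def min_gain_def)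
  have d: "\<mu> \<le> d j" "d j \<le> \<kappa>" if "j < r" for j
    using min_gain_le_gain[OF snr, of j G a \<kappa>] that G r by (auto simp: \<mu>_def d_def froG gain_def)
  have dpos: "0 < d j" if "j < r" for j using d[OF that] \<mu> by simp
  have "gauss_outage snr R (b # bs) (diagm r d * Y) \<le>
      ennreal (\<Prod>j<r. (\<kappa> / d j) ^ (2 * b)) * gauss_outage snr R (b # bs) (diagm r (\<lambda>_. \<kappa>) * Y)"
    by (rule gauss_outage_diagm_mono[OF Y]) (use d dpos in auto)
  also have "\<dots> \<le> ennreal (distortion \<kappa> a b (fro E)) * gauss_outage snr R (b # bs) (diagm r (\<lambda>_. \<kappa>) * Y)"
    by (intro mult_right_mono ennreal_leI prod_ratio_le_distortion[OF \<kappa> fro_nonneg r])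
      (use \<kappa> d dpos \<mu> in \<open>auto simp: \<mu>_def[symmetric] less_imp_le intro!: divide_left_mono\<close>)
  finally show ?upper unfolding relay diagm_const_mult[OF Y] QcY .
  \<comment> \<open>The comparison of densities only raises diagonal entries, hence a detour:
    lowering the scalar \<kappa> to \<mu> enlarges the outage probability, and \<mu> is then raised
    to \<open>d j\<close>.\<close>
  have "gauss_outage snr R (b # bs) (complex_of_real \<kappa> \<cdot>\<^sub>m Y) \<le>
      gauss_outage snr R (b # bs) (complex_of_real (\<mu> / \<kappa>) \<cdot>\<^sub>m (complex_of_real \<kappa> \<cdot>\<^sub>m Y))"
    by (rule gauss_outage_smult) (use \<mu> \<kappa> snr in auto)
  also have "complex_of_real (\<mu> / \<kappa>) \<cdot>\<^sub>m (complex_of_real \<kappa> \<cdot>\<^sub>m Y) = diagm r (\<lambda>_. \<mu>) * Y"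
    unfolding diagm_const_mult[OF Y] by (rule eq_matI) (use \<kappa> in auto)
  also have "gauss_outage snr R (b # bs) (diagm r (\<lambda>_. \<mu>) * Y) \<le>
      ennreal (\<Prod>j<r. (d j / \<mu>) ^ (2 * b)) * gauss_outage snr R (b # bs) (diagm r d * Y)"
    by (rule gauss_outage_diagm_mono[OF Y]) (use d \<mu> in auto)
  also have "\<dots> \<le> ennreal (distortion \<kappa> a b (fro E)) * gauss_outage snr R (b # bs) (diagm r d * Y)"
    by (intro mult_right_mono ennreal_leI prod_ratio_le_distortion[OF \<kappa> fro_nonneg r])
      (use \<kappa> d dpos \<mu> in \<open>auto simp: \<mu>_def[symmetric] less_imp_le intro!: divide_right_mono\<close>)
  finally show ?lower unfolding relay QcY .
qed

text \<open>The constant is uniform in \<open>X\<close> so that the bounds survive integration over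
  the past, and uniform in \<open>R\<close> because for positive multiplexing gain the rate moves
  with \<open>snr\<close>.\<close>

definition comparable :: "(real \<Rightarrow> real \<Rightarrow> complex mat \<Rightarrow> ennreal) \<Rightarrow> (real \<Rightarrow> real \<Rightarrow> complex mat \<Rightarrow> ennreal) \<Rightarrow> bool" where
  "comparable f g \<longleftrightarrow> (\<forall>k. \<exists>C\<ge>0. \<forall>snr\<ge>1. \<forall>R X. dim_row X = k \<longrightarrow>
     f snr R X \<le> ennreal C * g snr R X \<and> g snr R X \<le> ennreal C * f snr R X)"

text \<open>The loss is dominated by exp (\<open>fro E\<close> / 2), which tilts the law of
  \<open>E\<close>; the tilt amounts to a rescaling of \<open>X\<close>, and
  \<open>gauss_outage_scale\<close> removes the scale. Here a loss that is unbounded in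
  \<open>E\<close> becomes a constant.\<close>

lemma gauss_outage_relay_integral:
  assumes q: "projector q" and \<kappa>: "0 < \<kappa>"
  shows "comparable (\<lambda>snr R X. \<integral>\<^sup>+E. gauss_outage snr R (b # bs) (relay q \<kappa> snr E * (E * X)) \<partial>gaussm a (dim_row X))
    (\<lambda>snr R. gauss_outage snr R (a # b # bs))"
  unfolding comparable_def
proof
  fix k
  note [measurable] = measurable_relay[OF q]
  obtain D where D: "0 < D" "\<And>x. 0 \<le> x \<Longrightarrow> distortion \<kappa> a b x \<le> D * exp (x / 2)"
    using distortion_le_exp[of \<kappa> a b] by blast
  \<comment> \<open>The scales whose tilts \<open>1 - 1 / c\<^sup>2\<close> are 1/2 and
    -1/2.\<close>
  define c1 where "c1 = sqrt (2::real)" define c2 where "c2 = sqrt (2 / 3 :: real)"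
  have c: "0 < c1" "0 < c2" "1 - 1 / c1\<^sup>2 = 1 / 2" "1 - 1 / c2\<^sup>2 = - (1 / 2)" by (auto simp: c1_def c2_def)
  define C1 where "C1 = D * c1 ^ (2 * a * k) * max 1 (1 / (c1 * \<kappa>)) ^ (2 * a * k)"
  define C2 where "C2 = max 1 (c2 * \<kappa> / 1) ^ (2 * a * k) * ((1 / c2) ^ (2 * a * k) * D)"
  show "\<exists>C\<ge>0. \<forall>snr\<ge>1. \<forall>R X. dim_row X = k \<longrightarrow>
     (\<integral>\<^sup>+E. gauss_outage snr R (b # bs) (relay q \<kappa> snr E * (E * X)) \<partial>gaussm a (dim_row X)) \<le> ennreal C * gauss_outage snr R (a # b # bs) X \<and>
     gauss_outage snr R (a # b # bs) X \<le> ennreal C * (\<integral>\<^sup>+E. gauss_outage snr R (b # bs) (relay q \<kappa> snr E * (E * X)) \<partial>gaussm a (dim_row X))"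
  proof (rule exI[of _ "max C1 C2"], intro conjI allI impI)
    have C1: "0 \<le> C1" and C2: "0 \<le> C2" using D c by (auto simp: C1_def C2_def)
    then show "0 \<le> max C1 C2" by simp
    fix snr R :: real and X :: "complex mat" assume snr: "1 \<le> snr" and k: "dim_row X = k"
    define m where "m = dim_col X"
    have X: "X \<in> carrier_mat k m" using k by (auto simp: m_def)
    have snr0: "0 \<le> snr" using snr by simp
    let ?p = "gauss_outage snr R (b # bs)" and ?X = "complex_of_real \<kappa> \<cdot>\<^sub>m X"
    have X': "?X \<in> carrier_mat k m" using X by simp
    let ?I = "\<integral>\<^sup>+E. ?p (relay q \<kappa> snr E * (E * X)) \<partial>gaussm a k"
    have smult1: "complex_of_real 1 \<cdot>\<^sub>m X = X" by (rule eq_matI) auto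
    have smult2: "complex_of_real c \<cdot>\<^sub>m ?X = complex_of_real (c * \<kappa>) \<cdot>\<^sub>m X" for c by (rule eq_matI) auto
    have "?I \<le> (\<integral>\<^sup>+E. ennreal D * (ennreal (exp ((1 - 1 / c1\<^sup>2) * fro E)) * ?p (E * ?X)) \<partial>gaussm a k)"
    proof (rule nn_integral_gaussm_mono)
      fix E :: "complex mat" assume E: "E \<in> carrier_mat a k"
      have "?p (relay q \<kappa> snr E * (E * X)) \<le> ennreal (distortion \<kappa> a b (fro E)) * ?p (E * ?X)"
        by (rule gauss_outage_relay(1)[OF q \<kappa> snr E X])
      also have "\<dots> \<le> ennreal (D * exp (fro E / 2)) * ?p (E * ?X)"
        by (intro mult_right_mono ennreal_leI D fro_nonneg) simp
      finally show "?p (relay q \<kappa> snr E * (E * X)) \<le> ennreal D * (ennreal (exp ((1 - 1 / c1\<^sup>2) * fro E)) * ?p (E * ?X))"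
        using D(1) unfolding c by (simp add: ennreal_mult mult.assoc)
    qed
    also have "\<dots> = ennreal D * (\<integral>\<^sup>+E. ennreal (exp ((1 - 1 / c1\<^sup>2) * fro E)) * ?p (E * ?X) \<partial>gaussm a k)"
      by (rule nn_integral_cmult) measurable
    \<comment> \<open>The tilt formula is read from right to left: a growing weight corresponds to a
      scale above 1.\<close>
    also have "(\<integral>\<^sup>+E. ennreal (exp ((1 - 1 / c1\<^sup>2) * fro E)) * ?p (E * ?X) \<partial>gaussm a k) =
        ennreal (c1 ^ (2 * a * k)) * gauss_outage snr R (a # b # bs) (complex_of_real c1 \<cdot>\<^sub>m ?X)"
      unfolding gauss_outage_tilt[OF X' c(1)] using c
      by (simp add: mult.assoc[symmetric] ennreal_mult[symmetric] power_mult_distrib[symmetric])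
    also have "gauss_outage snr R (a # b # bs) (complex_of_real c1 \<cdot>\<^sub>m ?X) \<le>
        ennreal (max 1 (1 / (c1 * \<kappa>)) ^ (2 * a * k)) * gauss_outage snr R (a # b # bs) X"
      using gauss_outage_scale[OF X _ _ snr0, of "c1 * \<kappa>" 1 R a "b # bs"] \<kappa> c unfolding smult1 smult2 by simp
    finally have "?I \<le> ennreal C1 * gauss_outage snr R (a # b # bs) X"
      unfolding C1_def using D c by (simp add: ennreal_mult mult.assoc mult_left_mono)
    also have "\<dots> \<le> ennreal (max C1 C2) * gauss_outage snr R (a # b # bs) X"
      by (intro mult_right_mono ennreal_leI) auto
    finally show "(\<integral>\<^sup>+E. ?p (relay q \<kappa> snr E * (E * X)) \<partial>gaussm a (dim_row X)) \<le> ennreal (max C1 C2) * gauss_outage snr R (a # b # bs) X"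
      unfolding k .
    \<comment> \<open>In the reverse direction the scale \<open>c2\<close> < 1 produces the decaying
      weight exp (- \<open>fro E\<close> / 2), which cancels the distortion pointwise before
      integration.\<close>
    have "gauss_outage snr R (a # b # bs) X \<le> ennreal (max 1 (c2 * \<kappa> / 1) ^ (2 * a * k)) * gauss_outage snr R (a # b # bs) (complex_of_real c2 \<cdot>\<^sub>m ?X)"
      using gauss_outage_scale[OF X _ _ snr0, of 1 "c2 * \<kappa>" R a "b # bs"] \<kappa> c unfolding smult1 smult2 by simp
    also have "gauss_outage snr R (a # b # bs) (complex_of_real c2 \<cdot>\<^sub>m ?X) =
        ennreal ((1 / c2) ^ (2 * a * k)) * (\<integral>\<^sup>+E. ennreal (exp ((1 - 1 / c2\<^sup>2) * fro E)) * ?p (E * ?X) \<partial>gaussm a k)"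
      by (rule gauss_outage_tilt[OF X' c(2)])
    also have "(\<integral>\<^sup>+E. ennreal (exp ((1 - 1 / c2\<^sup>2) * fro E)) * ?p (E * ?X) \<partial>gaussm a k) \<le>
        (\<integral>\<^sup>+E. ennreal D * ?p (relay q \<kappa> snr E * (E * X)) \<partial>gaussm a k)"
    proof (rule nn_integral_gaussm_mono)
      fix E :: "complex mat" assume E: "E \<in> carrier_mat a k"
      have "?p (E * ?X) \<le> ennreal (distortion \<kappa> a b (fro E)) * ?p (relay q \<kappa> snr E * (E * X))"
        by (rule gauss_outage_relay(2)[OF q \<kappa> snr E X])
      also have "\<dots> \<le> ennreal (D * exp (fro E / 2)) * ?p (relay q \<kappa> snr E * (E * X))"
        by (intro mult_right_mono ennreal_leI D fro_nonneg) simp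
      finally have "ennreal (exp (- (fro E / 2))) * ?p (E * ?X) \<le>
          ennreal (exp (- (fro E / 2))) * (ennreal (D * exp (fro E / 2)) * ?p (relay q \<kappa> snr E * (E * X)))"
        by (rule mult_left_mono) simp
      also have "\<dots> = ennreal D * ?p (relay q \<kappa> snr E * (E * X))"
        using D(1) by (simp add: mult.assoc[symmetric] ennreal_mult[symmetric] exp_minus field_simps)
      finally show "ennreal (exp ((1 - 1 / c2\<^sup>2) * fro E)) * ?p (E * ?X) \<le> ennreal D * ?p (relay q \<kappa> snr E * (E * X))"
        unfolding c by simp
    qed
    also have "\<dots> = ennreal D * ?I" by (rule nn_integral_cmult) measurable
    finally have "gauss_outage snr R (a # b # bs) X \<le> ennreal C2 * ?I"
      unfolding C2_def using D c by (simp add: ennreal_mult mult.assoc mult_left_mono)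
    also have "\<dots> \<le> ennreal (max C1 C2) * ?I"
      by (intro mult_right_mono ennreal_leI) auto
    finally show "gauss_outage snr R (a # b # bs) X \<le> ennreal (max C1 C2) * (\<integral>\<^sup>+E. ?p (relay q \<kappa> snr E * (E * X)) \<partial>gaussm a (dim_row X))"
      unfolding k .
  qed
qed

lemma comparable_refl: "comparable f f"
  unfolding comparable_def by (intro allI exI[of _ 1]) simp

lemma comparable_sym: "comparable f g \<Longrightarrow> comparable g f"
  unfolding comparable_def by meson

lemma comparable_trans:
  assumes "comparable f g" "comparable g h"
  shows "comparable f h"
  unfolding comparable_def
proof
  fix k
  obtain A where A: "0 \<le> A" "\<And>snr R X. 1 \<le> snr \<Longrightarrow> dim_row X = k \<Longrightarrow>
      f snr R X \<le> ennreal A * g snr R X \<and> g snr R X \<le> ennreal A * f snr R X"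
    using assms(1) unfolding comparable_def by meson
  obtain B where B: "0 \<le> B" "\<And>snr R X. 1 \<le> snr \<Longrightarrow> dim_row X = k \<Longrightarrow>
      g snr R X \<le> ennreal B * h snr R X \<and> h snr R X \<le> ennreal B * g snr R X"
    using assms(2) unfolding comparable_def by meson
  show "\<exists>C\<ge>0. \<forall>snr\<ge>1. \<forall>R X. dim_row X = k \<longrightarrow>
      f snr R X \<le> ennreal C * h snr R X \<and> h snr R X \<le> ennreal C * f snr R X"
  proof (intro exI[of _ "A * B"] conjI allI impI)
    show "0 \<le> A * B" using A B by simp
    fix snr R :: real and X :: "complex mat" assume *: "1 \<le> snr" "dim_row X = k"
    have "f snr R X \<le> ennreal A * (ennreal B * h snr R X)"
      using A(2)[OF *, of R] B(2)[OF *, of R] by (meson mult_left_mono order_trans zero_le)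
    then show "f snr R X \<le> ennreal (A * B) * h snr R X" using A B by (simp add: ennreal_mult mult.assoc)
    have "h snr R X \<le> ennreal B * (ennreal A * f snr R X)"
      using A(2)[OF *, of R] B(2)[OF *, of R] by (meson mult_left_mono order_trans zero_le)
    then show "h snr R X \<le> ennreal (A * B) * f snr R X" using A B by (simp add: ennreal_mult ac_simps)
  qed
qed

text \<open>Relays are removed from the destination backwards: the induction hypothesis clears the
  tail at the matrix behind the first relay, and only then is that relay itself removed.\<close>

lemma relayed_outage_comparable:
  assumes q: "projector q" and \<kappa>: "0 < \<kappa>"
  shows "comparable (\<lambda>snr R. relayed_outage q \<kappa> snr R as) (\<lambda>snr R. gauss_outage snr R as)"
proof (induction as rule: induct_list012)
  case 1
  then show ?case using comparable_refl by simp
next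
  case (2 a)
  then show ?case using comparable_refl by simp
next
  case (3 a b bs)
  note [measurable] = measurable_relay[OF q] measurable_relayed_outage[OF q]
  obtain C where C: "\<And>r. 0 \<le> C r" "\<And>r snr R X. 1 \<le> snr \<Longrightarrow> dim_row X = r \<Longrightarrow>
      relayed_outage q \<kappa> snr R (b # bs) X \<le> ennreal (C r) * gauss_outage snr R (b # bs) X \<and>
      gauss_outage snr R (b # bs) X \<le> ennreal (C r) * relayed_outage q \<kappa> snr R (b # bs) X"
    using 3(2) unfolding comparable_def by metis
  \<comment> \<open>Behind the relay the number of rows is \<open>dim_col (q E)\<close>, which
    varies with \<open>E\<close> but is at most \<open>a\<close>; the sum dominates the constants of
    all these sizes.\<close>
  define B where "B = (\<Sum>r\<le>a. C r)"
  have B: "C r \<le> B" if "r \<le> a" for r unfolding B_def using that C(1) by (intro member_le_sum) auto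
  have "comparable (\<lambda>snr R. relayed_outage q \<kappa> snr R (a # b # bs))
      (\<lambda>snr R X. \<integral>\<^sup>+E. gauss_outage snr R (b # bs) (relay q \<kappa> snr E * (E * X)) \<partial>gaussm a (dim_row X))"
    unfolding comparable_def
  proof (intro allI exI[of _ B] conjI impI)
    show "0 \<le> B" unfolding B_def using C(1) by (intro sum_nonneg) auto
    fix k snr R and X :: "complex mat" assume snr: "(1::real) \<le> snr" and k: "dim_row X = k"
    have *: "relayed_outage q \<kappa> snr R (b # bs) (relay q \<kappa> snr E * (E * X)) \<le>
          ennreal B * gauss_outage snr R (b # bs) (relay q \<kappa> snr E * (E * X)) \<and>
        gauss_outage snr R (b # bs) (relay q \<kappa> snr E * (E * X)) \<le>
          ennreal B * relayed_outage q \<kappa> snr R (b # bs) (relay q \<kappa> snr E * (E * X))"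
      if E: "E \<in> carrier_mat a (dim_row X)" for E
    proof -
      define r where "r = dim_row (relay q \<kappa> snr E * (E * X))"
      have "r = dim_col (q E)" by (simp add: r_def relay_def normalizer_def)
      also have "\<dots> \<le> a" using q E unfolding projector_def by auto
      finally have "ennreal (C r) \<le> ennreal B" by (intro ennreal_leI B)
      then show ?thesis using C(2)[OF snr r_def[symmetric], of R]
        by (meson mult_right_mono order_trans zero_le)
    qed
    have "relayed_outage q \<kappa> snr R (a # b # bs) X \<le> (\<integral>\<^sup>+E. ennreal B * gauss_outage snr R (b # bs) (relay q \<kappa> snr E * (E * X)) \<partial>gaussm a (dim_row X))"
      unfolding relayed_outage.simps by (rule nn_integral_gaussm_mono) (use * in blast)
    also have "\<dots> = ennreal B * (\<integral>\<^sup>+E. gauss_outage snr R (b # bs) (relay q \<kappa> snr E * (E * X)) \<partial>gaussm a (dim_row X))"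
      by (rule nn_integral_cmult) measurable
    finally show "relayed_outage q \<kappa> snr R (a # b # bs) X \<le>
      ennreal B * (\<integral>\<^sup>+E. gauss_outage snr R (b # bs) (relay q \<kappa> snr E * (E * X)) \<partial>gaussm a (dim_row X))" .
    have "(\<integral>\<^sup>+E. gauss_outage snr R (b # bs) (relay q \<kappa> snr E * (E * X)) \<partial>gaussm a (dim_row X)) \<le>
       (\<integral>\<^sup>+E. ennreal B * relayed_outage q \<kappa> snr R (b # bs) (relay q \<kappa> snr E * (E * X)) \<partial>gaussm a (dim_row X))"
      by (rule nn_integral_gaussm_mono) (use * in blast)
    also have "\<dots> = ennreal B * relayed_outage q \<kappa> snr R (a # b # bs) X"
      unfolding relayed_outage.simps by (rule nn_integral_cmult) measurable
    finally show "(\<integral>\<^sup>+E. gauss_outage snr R (b # bs) (relay q \<kappa> snr E * (E * X)) \<partial>gaussm a (dim_row X)) \<le>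
      ennreal B * relayed_outage q \<kappa> snr R (a # b # bs) X" .
  qed
  then show ?case using gauss_outage_relay_integral[OF q \<kappa>] by (rule comparable_trans)
qed


subsection \<open>Measurability of the QR factor\<close>

lemma mrank_le_dim_row: "mrank A \<le> dim_row A"
proof -
  let ?n = "dim_row A"
  interpret V: vec_space "TYPE(complex)" ?n .
  have A: "A \<in> carrier_mat ?n (dim_col A)" by simp
  have cA: "set (cols A) \<subseteq> carrier_vec ?n" using cols_dim by blast
  have "\<not> V.lin_dep {}" unfolding V.lin_dep_def by simp
  then have "{} \<subseteq> set (cols A) \<and> \<not> V.lin_dep {}" by blast
  then have "\<exists>S. finite S \<and> maximal S (\<lambda>T. T \<subseteq> set (cols A) \<and> \<not> V.lin_dep T) \<and> {} \<subseteq> S"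
    by (intro maximal_exists_superset[OF finite_set]) blast+
  then obtain S where S: "maximal S (\<lambda>T. T \<subseteq> set (cols A) \<and> \<not> V.lin_dep T)" by blast
  then have SA: "S \<subseteq> set (cols A)" and li: "\<not> V.lin_dep S" unfolding maximal_def by blast+
  have "S \<subseteq> carrier_vec ?n" using SA cA by (rule subset_trans)
  then have "card S \<le> V.dim" using V.li_le_dim(2)[OF V.fin_dim _ li] by simp
  then show ?thesis unfolding V.rank_card_indpt[OF A S] V.dim_is_n .
qed

text \<open>Parameter-dependent vectors of a fixed length are handled through their entries, so that
  no sigma-algebra on vectors has to be introduced.\<close>

definition measurable_vec :: "'x measure \<Rightarrow> nat \<Rightarrow> ('x \<Rightarrow> complex vec) \<Rightarrow> bool" where
  "measurable_vec M m u \<longleftrightarrow> (\<forall>x. u x \<in> carrier_vec m) \<and> (\<forall>i<m. (\<lambda>x. u x $ i) \<in> borel_measurable M)"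

lemma measurable_vec_cscalar_prod:
  assumes u: "measurable_vec M m u" and v: "measurable_vec M m v"
  shows "(\<lambda>x. u x \<bullet>c v x) \<in> borel_measurable M"
proof -
  have c: "u x \<in> carrier_vec m" "v x \<in> carrier_vec m" for x using u v by (auto simp: measurable_vec_def)
  have e: "u x \<bullet>c v x = (\<Sum>i<m. u x $ i * cnj (v x $ i))" for x
    using carrier_vecD[OF c(1)[of x]] carrier_vecD[OF c(2)[of x]] by (simp add: scalar_prod_def atLeast0LessThan)
  show ?thesis unfolding e
  proof (intro borel_measurable_sum borel_measurable_times)
    fix i assume "i \<in> {..<m}"
    then have [measurable]: "(\<lambda>x. v x $ i) \<in> borel_measurable M" "(\<lambda>x. u x $ i) \<in> borel_measurable M"
      using u v by (auto simp: measurable_vec_def)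
    show "(\<lambda>x. u x $ i) \<in> borel_measurable M" "(\<lambda>x. cnj (v x $ i)) \<in> borel_measurable M" by measurable
  qed
qed

lemma measurable_vec_add:
  assumes "measurable_vec M m u" "measurable_vec M m v"
  shows "measurable_vec M m (\<lambda>x. u x + v x)"
proof -
  have "(u x + v x) $ i = u x $ i + v x $ i" if "i < m" for x i
  proof -
    have "dim_vec (v x) = m" using assms carrier_vecD unfolding measurable_vec_def by blast
    then show ?thesis using that by simp
  qed
  then show ?thesis using assms unfolding measurable_vec_def
    by (auto intro!: borel_measurable_add borel_measurable_times)
qed

lemma measurable_vec_smult:
  assumes "measurable_vec M m u" "c \<in> borel_measurable M"
  shows "measurable_vec M m (\<lambda>x. c x \<cdot>\<^sub>v u x)"
proof -
  have "(c x \<cdot>\<^sub>v u x) $ i = c x * u x $ i" if "i < m" for x i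
  proof -
    have "dim_vec (u x) = m" using assms carrier_vecD unfolding measurable_vec_def by blast
    then show ?thesis using that by simp
  qed
  then show ?thesis using assms unfolding measurable_vec_def
    by (auto intro!: borel_measurable_add borel_measurable_times)
qed

lemma measurable_vec_adjuster:
  assumes w: "measurable_vec M m w" and us: "\<And>u. u \<in> set us \<Longrightarrow> measurable_vec M m u"
  shows "measurable_vec M m (\<lambda>x. adjuster m (w x) (map (\<lambda>u. u x) us))"
  using us
proof (induction us)
  case Nil
  then show ?case by (simp add: measurable_vec_def)
next
  case (Cons u us)
  have [measurable]: "(\<lambda>x. w x \<bullet>c u x) \<in> borel_measurable M" "(\<lambda>x. u x \<bullet>c u x) \<in> borel_measurable M"
    using w Cons.prems by (auto intro: measurable_vec_cscalar_prod)
  show ?case unfolding list.map adjuster.simps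
    by (intro measurable_vec_add measurable_vec_smult Cons) (use Cons.prems in simp_all)
qed

text \<open>Gram-Schmidt keeps zero vectors, so its output has a fixed length and can be written as
  one list of vector-valued functions. Only the later removal of zeros makes the length
  vary.\<close>

lemma measurable_vec_gram_schmidt_sub:
  assumes "\<And>u. u \<in> set us \<Longrightarrow> measurable_vec M m u" "\<And>w. w \<in> set ws \<Longrightarrow> measurable_vec M m w"
  shows "\<exists>vs. (\<forall>v\<in>set vs. measurable_vec M m v) \<and>
    (\<forall>x. gram_schmidt_sub m (map (\<lambda>u. u x) us) (map (\<lambda>w. w x) ws) = map (\<lambda>v. v x) vs)"
  using assms
proof (induction ws arbitrary: us)
  case Nil
  then show ?case by (intro exI[of _ us]) simp
next
  case (Cons w ws)
  let ?u = "\<lambda>x. adjuster m (w x) (map (\<lambda>u. u x) us) + w x"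
  have "measurable_vec M m ?u"
    by (intro measurable_vec_add measurable_vec_adjuster) (use Cons.prems in auto)
  then have "\<exists>vs. (\<forall>v\<in>set vs. measurable_vec M m v) \<and>
    (\<forall>x. gram_schmidt_sub m (map (\<lambda>u. u x) (?u # us)) (map (\<lambda>w. w x) ws) = map (\<lambda>v. v x) vs)"
    by (intro Cons.IH) (use Cons.prems in auto)
  then show ?case by simp
qed

lemma measurable_vec_eq_zero:
  assumes "measurable_vec M m u"
  shows "Measurable.pred M (\<lambda>x. u x = 0\<^sub>v m)"
proof -
  have "u x = 0\<^sub>v m \<longleftrightarrow> (\<forall>i\<in>{..<m}. u x $ i = 0)" for x
    using assms by (auto simp: measurable_vec_def intro!: eq_vecI)
  moreover have "Measurable.pred M (\<lambda>x. \<forall>i\<in>{..<m}. u x $ i = 0)"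
  proof (rule pred_intros_finite(3))
    fix i assume "i \<in> {..<m}"
    then have [measurable]: "(\<lambda>x. u x $ i) \<in> borel_measurable M" using assms by (simp add: measurable_vec_def)
    show "Measurable.pred M (\<lambda>x. u x $ i = 0)" by measurable
  qed simp
  ultimately show ?thesis by simp
qed

text \<open>The length of the filtered list varies with the point, so entries are padded with 0
  beyond its end to become total functions. A new head shifts the positions by one exactly where it
  is nonzero.\<close>

lemma measurable_filter_vecs:
  assumes "\<And>u. u \<in> set us \<Longrightarrow> measurable_vec M m u"
  defines "F \<equiv> \<lambda>us x. nonzero_vecs m (map (\<lambda>u. u x) us)"
  shows "(\<lambda>x. length (F us x)) \<in> M \<rightarrow>\<^sub>M count_space UNIV \<and>
    (\<forall>j i. i < m \<longrightarrow> (\<lambda>x. if j < length (F us x) then F us x ! j $ i else 0) \<in> borel_measurable M)"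
  using assms(1)
proof (induction us)
  case Nil
  then show ?case by (simp add: F_def)
next
  case (Cons u us)
  have IH: "(\<lambda>x. length (F us x)) \<in> M \<rightarrow>\<^sub>M count_space UNIV"
    "\<And>j i. i < m \<Longrightarrow> (\<lambda>x. if j < length (F us x) then F us x ! j $ i else 0) \<in> borel_measurable M"
    using Cons by auto
  note [measurable] = IH(1)
  have u: "measurable_vec M m u" using Cons.prems by simp
  have [measurable]: "Measurable.pred M (\<lambda>x. u x = 0\<^sub>v m)" by (rule measurable_vec_eq_zero[OF u])
  have F: "F (u # us) x = (if u x = 0\<^sub>v m then F us x else u x # F us x)" for x by (simp add: F_def)
  have "(\<lambda>x. if u x = 0\<^sub>v m then length (F us x) else Suc (length (F us x))) \<in> M \<rightarrow>\<^sub>M count_space UNIV"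
    by measurable
  then have 1: "(\<lambda>x. length (F (u # us) x)) \<in> M \<rightarrow>\<^sub>M count_space UNIV"
    by (rule measurable_cong[THEN iffD1, rotated]) (simp add: F)
  have 2: "(\<lambda>x. if j < length (F (u # us) x) then F (u # us) x ! j $ i else 0) \<in> borel_measurable M" if i: "i < m" for j i
  proof -
    have [measurable]: "(\<lambda>x. u x $ i) \<in> borel_measurable M" using u i by (simp add: measurable_vec_def)
    note [measurable] = IH(2)[OF i]
    have "(\<lambda>x. if u x = 0\<^sub>v m then if j < length (F us x) then F us x ! j $ i else 0
        else if j = 0 then u x $ i else if j - 1 < length (F us x) then F us x ! (j - 1) $ i else 0) \<in> borel_measurable M"
      by (intro measurable_If IH(2)[OF i]) measurable
    then show ?thesis
      by (rule measurable_cong[THEN iffD1, rotated]) (cases j; simp add: F)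
  qed
  show ?case using 1 2 by blast
qed

text \<open>Three discrete quantities are frozen: the two dimensions of the argument and the number
  of nonzero Gram-Schmidt vectors. What remains is arithmetic in measurable entries.\<close>

lemma measurable_qr_Q: "qr_Q \<in> mat_borel \<rightarrow>\<^sub>M mat_borel"
proof -
  have "(\<lambda>A. qr_Q (mat m k (\<lambda>ij. A $$ ij))) \<in> mat_borel \<rightarrow>\<^sub>M mat_borel" for m k
  proof -
    define col where "col j A = vec m (\<lambda>i. A $$ (i, j))" for j and A :: "complex mat"
    have col: "measurable_vec mat_borel m (col j)" for j unfolding measurable_vec_def col_def by simp
    have cols: "cols (mat m k (\<lambda>ij. A $$ ij)) = map (\<lambda>u. u A) (map col [0..<k])" for A :: "complex mat"
      by (auto simp: cols_def col_def)
    obtain vs where vs: "\<And>v. v \<in> set vs \<Longrightarrow> measurable_vec mat_borel m v"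
      and gs: "\<And>A. gram_schmidt_sub m [] (map (\<lambda>w. w A) (map col [0..<k])) = map (\<lambda>v. v A) vs"
    proof -
      have "w \<in> set (map col [0..<k]) \<Longrightarrow> measurable_vec mat_borel m w" for w using col by auto
      then have "\<exists>vs. (\<forall>v\<in>set vs. measurable_vec mat_borel m v) \<and>
          (\<forall>A. gram_schmidt_sub m (map (\<lambda>u. u A) []) (map (\<lambda>w. w A) (map col [0..<k])) = map (\<lambda>v. v A) vs)"
        by (intro measurable_vec_gram_schmidt_sub) auto
      then show ?thesis using that unfolding list.map(1) by blast
    qed
    define F where "F A = nonzero_vecs m (map (\<lambda>u. u A) (rev vs))" for A
    define s where "s v = complex_of_real (1 / sqrt (Re (v \<bullet>c v)))" for v :: "complex vec"
    have vc: "v A \<in> carrier_vec m" if "v \<in> set vs" for v A using vs[OF that] by (simp add: measurable_vec_def)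
    have Fc: "F A ! j \<in> carrier_vec m" if "j < length (F A)" for A j
    proof -
      have "F A ! j \<in> set (F A)" using that by simp
      then show ?thesis unfolding F_def using vc by auto
    qed
    have qr: "qr_Q (mat m k (\<lambda>ij. A $$ ij)) = mat m (length (F A)) (\<lambda>(i, j).
        complex_of_real (1 / sqrt (\<Sum>l<m. (cmod (if j < length (F A) then F A ! j $ l else 0))\<^sup>2)) *
        (if j < length (F A) then F A ! j $ i else 0))" for A
    proof -
      have "qr_Q (mat m k (\<lambda>ij. A $$ ij)) = mat_of_cols m (map (\<lambda>v. s v \<cdot>\<^sub>v v) (F A))"
        unfolding qr_Q_def dim_row_mat cols gram_schmidt_def gs F_def s_def rev_map ..
      also have "\<dots> = mat m (length (F A)) (\<lambda>(i, j).
        complex_of_real (1 / sqrt (\<Sum>l<m. (cmod (if j < length (F A) then F A ! j $ l else 0))\<^sup>2)) *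
        (if j < length (F A) then F A ! j $ i else 0))"
      proof (rule eq_matI, unfold dim_row_mat dim_col_mat)
        fix i j assume i: "i < m" and j: "j < length (F A)"
        let ?v = "F A ! j"
        have d: "dim_vec ?v = m" using Fc[OF j] by simp
        have "?v \<bullet>c ?v = complex_of_real (\<Sum>l<m. (cmod (?v $ l))\<^sup>2)"
          using d by (simp add: scalar_prod_def atLeast0LessThan complex_norm_square flip: of_real_power)
        then have "Re (?v \<bullet>c ?v) = (\<Sum>l<m. (cmod (?v $ l))\<^sup>2)" by simp
        then show "mat_of_cols m (map (\<lambda>v. s v \<cdot>\<^sub>v v) (F A)) $$ (i, j) =
          mat m (length (F A)) (\<lambda>(i, j).
        complex_of_real (1 / sqrt (\<Sum>l<m. (cmod (if j < length (F A) then F A ! j $ l else 0))\<^sup>2)) *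
        (if j < length (F A) then F A ! j $ i else 0)) $$ (i, j)"
          using i j d by (simp add: mat_of_cols_index s_def)
      qed simp_all
      finally show ?thesis .
    qed
    have F: "(\<lambda>A. length (F A)) \<in> mat_borel \<rightarrow>\<^sub>M count_space UNIV"
      "\<And>j i. i < m \<Longrightarrow> (\<lambda>A. if j < length (F A) then F A ! j $ i else 0) \<in> borel_measurable mat_borel"
      using measurable_filter_vecs[of "rev vs" mat_borel m] vs unfolding F_def by auto
    have fixed: "(\<lambda>A. mat m d (\<lambda>(i, j).
        complex_of_real (1 / sqrt (\<Sum>l<m. (cmod (if j < length (F A) then F A ! j $ l else 0))\<^sup>2)) *
        (if j < length (F A) then F A ! j $ i else 0))) \<in> mat_borel \<rightarrow>\<^sub>M mat_borel" for d
    proof (rule measurable_mat_fixed_dimI, unfold case_prod_conv, rule borel_measurable_times)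
      fix i j assume i: "i < m"
      have [measurable]: "(\<lambda>A. \<Sum>l<m. (cmod (if j < length (F A) then F A ! j $ l else 0))\<^sup>2) \<in> borel_measurable mat_borel"
      proof (rule borel_measurable_sum)
        fix l assume "l \<in> {..<m}"
        then have "l < m" by simp
        note [measurable] = F(2)[OF this, of j]
        show "(\<lambda>A. (cmod (if j < length (F A) then F A ! j $ l else 0))\<^sup>2) \<in> borel_measurable mat_borel" by measurable
      qed
      show "(\<lambda>A. complex_of_real (1 / sqrt (\<Sum>l<m. (cmod (if j < length (F A) then F A ! j $ l else 0))\<^sup>2))) \<in> borel_measurable mat_borel"
        by measurable
      show "(\<lambda>A. if j < length (F A) then F A ! j $ i else 0) \<in> borel_measurable mat_borel" by (rule F(2)[OF i])
    qed
    show ?thesis unfolding qr by (rule measurable_compose_countable[OF fixed F(1)])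
  qed
  note fixed = this
  have "(\<lambda>A. qr_Q (mat (fst p) (snd p) (\<lambda>ij. A $$ ij))) \<in> mat_borel \<rightarrow>\<^sub>M mat_borel" for p by (rule fixed)
  moreover have "(\<lambda>A. (dim_row A, dim_col A)) \<in> mat_borel \<rightarrow>\<^sub>M count_space UNIV"
  proof -
    have "(\<lambda>A. (dim_row A, dim_col A)) \<in> mat_borel \<rightarrow>\<^sub>M count_space UNIV \<Otimes>\<^sub>M count_space UNIV" by measurable
    then show ?thesis by (simp add: pair_measure_countable)
  qed
  ultimately have "(\<lambda>A. qr_Q (mat (dim_row A) (dim_col A) (\<lambda>ij. A $$ ij))) \<in> mat_borel \<rightarrow>\<^sub>M mat_borel"
    using measurable_compose_countable[where f = "\<lambda>p A. qr_Q (mat (fst p) (snd p) (\<lambda>ij. A $$ ij))" and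
        g = "\<lambda>A. (dim_row A, dim_col A)" and M = mat_borel and N = mat_borel] by simp
  moreover have "mat (dim_row A) (dim_col A) (\<lambda>ij. A $$ ij) = A" for A :: "complex mat" by (rule eq_matI) auto
  ultimately show ?thesis by simp
qed

lemma qr_Q_dims: "dim_row (qr_Q A) = dim_row A" "dim_col (qr_Q A) = mrank A"
proof -
  have "A \<in> carrier_mat (dim_row A) (dim_col A)" by simp
  from qr_Q(1)[OF this] show "dim_row (qr_Q A) = dim_row A" "dim_col (qr_Q A) = mrank A" by auto
qed

lemma dim_col_PF_Q: "dim_col (PF_Q E) = mrank E"
  by (simp add: PF_Q_def qr_Q_dims)

lemma projector_identity: "projector (\<lambda>E. 1\<^sub>m (dim_row E))"
  unfolding projector_def
proof (intro conjI allI)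
  show "(\<lambda>E. 1\<^sub>m (dim_row E)) \<in> mat_borel \<rightarrow>\<^sub>M mat_borel" by measurable
  fix E :: "complex mat"
  have adj: "mat_adjoint (1\<^sub>m (dim_row E)) = (1\<^sub>m (dim_row E) :: complex mat)" by (rule eq_matI) auto
  have E: "E \<in> carrier_mat (dim_row E) (dim_col E)" by (rule carrier_matI) (rule refl)+
  show "mat_adjoint (1\<^sub>m (dim_row E)) * 1\<^sub>m (dim_row E) = (1\<^sub>m (dim_col (1\<^sub>m (dim_row E) :: complex mat)) :: complex mat)"
    unfolding adj by simp
  show "1\<^sub>m (dim_row E) * (mat_adjoint (1\<^sub>m (dim_row E)) * E) = E"
    unfolding adj left_mult_one_mat[OF E] ..
qed simp_all

lemma projector_PF_Q: "projector PF_Q"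
  unfolding projector_def
proof (intro conjI allI)
  note [measurable] = measurable_qr_Q
  have [measurable]: "Measurable.pred mat_borel (\<lambda>E. dim_row E \<le> dim_col E \<and> dim_col (qr_Q E) = dim_row E)"
  proof (intro pred_intros_logic)
    show "Measurable.pred mat_borel (\<lambda>E :: complex mat. dim_row E \<le> dim_col E)"
      by (rule measurable_compose_countable[where f="\<lambda>d E. d \<le> dim_col E" and g=dim_row]) measurable
    show "Measurable.pred mat_borel (\<lambda>E. dim_col (qr_Q E) = dim_row E)"
      by (rule measurable_eq_nat) measurable
  qed
  \<comment> \<open>The rank in the case distinction is read as the number of columns of
    \<open>qr_Q\<close>, whose measurability is known.\<close>
  show "PF_Q \<in> mat_borel \<rightarrow>\<^sub>M mat_borel"
    unfolding PF_Q_def[abs_def] qr_Q_dims(2)[symmetric] by measurable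
  fix E :: "complex mat"
  show "dim_col (PF_Q E) \<le> dim_row E" unfolding dim_col_PF_Q by (rule mrank_le_dim_row)
  have E: "E \<in> carrier_mat (dim_row E) (dim_col E)" by (rule carrier_matI) (rule refl)+
  consider "PF_Q E = 1\<^sub>m (dim_row E)" | "PF_Q E = qr_Q E" unfolding PF_Q_def by meson
  then have "PF_Q E \<in> carrier_mat (dim_row E) (dim_col (PF_Q E)) \<and>
      mat_adjoint (PF_Q E) * PF_Q E = 1\<^sub>m (dim_col (PF_Q E)) \<and>
      PF_Q E * (mat_adjoint (PF_Q E) * E) = E"
  proof cases
    case 1
    then show ?thesis using projector_identity unfolding projector_def by simp
  next
    case 2
    show ?thesis unfolding 2 qr_Q_dims(2) using qr_Q(1-3)[OF E] by blast
  qed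
  then show "PF_Q E \<in> carrier_mat (dim_row E) (dim_col (PF_Q E))"
      "mat_adjoint (PF_Q E) * PF_Q E = 1\<^sub>m (dim_col (PF_Q E))"
      "PF_Q E * (mat_adjoint (PF_Q E) * E) = E" by blast+
qed


subsection \<open>A common recursion for both schemes\<close>

definition used_columns :: "(nat \<Rightarrow> nat \<Rightarrow> nat \<Rightarrow> nat) \<Rightarrow> nat \<Rightarrow> nat \<Rightarrow> complex mat \<Rightarrow> complex mat" where
  "used_columns s i r A = mat (dim_row A) r (\<lambda>(j, k). A $$ (j, s i r k))"

text \<open>The number of rows is the number of antennas in use, which fixes how many columns of the
  next channel matrix matter. Grouping as \<open>E * T\<close> separates the past \<open>T\<close>
  from the fresh hop \<open>E\<close>.\<close>

fun transmitted :: "(complex mat \<Rightarrow> complex mat) \<Rightarrow> (nat \<Rightarrow> nat \<Rightarrow> nat \<Rightarrow> nat) \<Rightarrow> real \<Rightarrow> real \<Rightarrow>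
    (nat \<Rightarrow> complex mat) \<Rightarrow> nat \<Rightarrow> complex mat" where
  "transmitted q s \<kappa> snr h 0 = 1\<^sub>m (dim_col (h 1))"
| "transmitted q s \<kappa> snr h (Suc i) =
     (let T = transmitted q s \<kappa> snr h i; E = used_columns s i (dim_row T) (h (Suc i))
      in relay q \<kappa> snr E * (E * T))"

text \<open>The index is that of the sending layer, so index \<open>i\<close> reads the channel
  matrix \<open>h (Suc i)\<close>.\<close>

definition hop :: "(complex mat \<Rightarrow> complex mat) \<Rightarrow> (nat \<Rightarrow> nat \<Rightarrow> nat \<Rightarrow> nat) \<Rightarrow> real \<Rightarrow> real \<Rightarrow>
    (nat \<Rightarrow> complex mat) \<Rightarrow> nat \<Rightarrow> complex mat" where
  "hop q s \<kappa> snr h i = used_columns s i (dim_row (transmitted q s \<kappa> snr h i)) (h (Suc i))"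

lemma transmitted_Suc:
  "transmitted q s \<kappa> snr h (Suc i) = relay q \<kappa> snr (hop q s \<kappa> snr h i) * (hop q s \<kappa> snr h i * transmitted q s \<kappa> snr h i)"
  by (simp add: hop_def Let_def)

declare transmitted.simps(2) [simp del]

lemma dim_relay [simp]: "dim_row (relay q \<kappa> snr E) = dim_col (q E)" "dim_col (relay q \<kappa> snr E) = dim_row (q E)"
  by (simp_all add: relay_def normalizer_def)

lemma dim_hop [simp]:
  "dim_row (hop q s \<kappa> snr h i) = dim_row (h (Suc i))"
  "dim_col (hop q s \<kappa> snr h i) = dim_row (transmitted q s \<kappa> snr h i)"
  by (simp_all add: hop_def used_columns_def)

lemma dim_row_transmitted_Suc: "dim_row (transmitted q s \<kappa> snr h (Suc i)) = dim_col (q (hop q s \<kappa> snr h i))"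
  by (simp add: transmitted_Suc)

text \<open>What layer \<open>i\<close> sends is a function of the first \<open>i\<close> channel
  matrices, apart from the column count of \<open>h 1\<close> at \<open>i = 0\<close>. This is the
  source of its independence from the next hop.\<close>

lemma transmitted_cong:
  assumes "dim_col (h 1) = dim_col (h' 1)" "\<And>l. l \<in> {1..i} \<Longrightarrow> h l = h' l"
  shows "transmitted q s \<kappa> snr h i = transmitted q s \<kappa> snr h' i"
  using assms(2)
proof (induction i)
  case 0
  then show ?case using assms(1) by simp
next
  case (Suc i)
  have "transmitted q s \<kappa> snr h i = transmitted q s \<kappa> snr h' i" by (rule Suc.IH) (use Suc.prems in simp)
  moreover have "h (Suc i) = h' (Suc i)" by (rule Suc.prems) simp
  ultimately show ?case by (simp add: transmitted_Suc hop_def)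
qed

text \<open>The first hop uses all columns of \<open>h 1\<close>, whence the update of \<open>sel\<close> at \<open>0\<close>.\<close>

lemma PF_matrix_eq_hop:
  assumes s: "s = sel(0 := \<lambda>r k. k)"
  shows "PF_eff sel h (Suc i) = hop PF_Q s \<kappa> snr h i \<and>
    PF_matrix sel \<kappa> snr h (Suc i) = hop PF_Q s \<kappa> snr h i * transmitted PF_Q s \<kappa> snr h i"
proof (induction i)
  case 0
  have "hop PF_Q s \<kappa> snr h 0 = h 1"
    by (rule eq_matI) (auto simp: hop_def used_columns_def s)
  moreover have "h 1 * 1\<^sub>m (dim_col (h 1)) = h 1"
    by (rule right_mult_one_mat[of _ "dim_row (h 1)"], rule carrier_matI) (rule refl)+
  ultimately show ?case by simp
next
  case (Suc i)
  let ?E = "hop PF_Q s \<kappa> snr h i" and ?T = "transmitted PF_Q s \<kappa> snr h i"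
  let ?E' = "hop PF_Q s \<kappa> snr h (Suc i)" and ?P = "relay PF_Q \<kappa> snr ?E"
  have r: "mrank ?E = dim_row (transmitted PF_Q s \<kappa> snr h (Suc i))"
    by (simp only: dim_row_transmitted_Suc dim_col_PF_Q)
  have sS: "s (Suc i) = sel (Suc i)" by (simp add: s)
  have eff: "PF_eff sel h (Suc (Suc i)) = ?E'"
    unfolding PF_eff.simps Let_def conjunct1[OF Suc] r hop_def[of _ _ _ _ _ "Suc i"] used_columns_def sS ..
  have dP: "dim_row (PF_Q ?E) = dim_row ?E" using projector_PF_Q unfolding projector_def by blast
  have E': "?E' \<in> carrier_mat (dim_row ?E') (dim_row ?P)"
    by (rule carrier_matI) (simp_all only: dim_hop dim_relay dim_row_transmitted_Suc)
  have P: "?P \<in> carrier_mat (dim_row ?P) (dim_row ?E)"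
    by (rule carrier_matI) (simp_all only: dim_relay dP)
  have ET: "?E * ?T \<in> carrier_mat (dim_row ?E) (dim_col ?T)"
    by (rule carrier_matI) (simp_all only: index_mult_mat)
  have "PF_matrix sel \<kappa> snr h (Suc (Suc i)) = ?E' * ?P * (?E * ?T)"
    unfolding PF_matrix.simps eff conjunct1[OF Suc] conjunct2[OF Suc] PF_P_def relay_def ..
  also have "\<dots> = ?E' * transmitted PF_Q s \<kappa> snr h (Suc i)"
    unfolding transmitted_Suc[of _ _ _ _ _ i] by (rule assoc_mult_mat[OF E' P ET])
  finally show ?case using eff by simp
qed

text \<open>Nothing is projected away, so all antennas transmit and the selection copies the whole
  matrix; the recursion merely regroups the product.\<close>

lemma AF_matrix_eq_hop:
  fixes q :: "complex mat \<Rightarrow> complex mat" and s :: "nat \<Rightarrow> nat \<Rightarrow> nat \<Rightarrow> nat"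
  defines "q \<equiv> \<lambda>E. 1\<^sub>m (dim_row E)" and "s \<equiv> \<lambda>i r k. k"
  assumes h: "\<And>l. l \<in> {1..N} \<Longrightarrow> h l \<in> carrier_mat (n l) (n (l - 1))" and i: "i < N"
  shows "hop q s \<kappa> snr h i = h (Suc i) \<and>
    AF_matrix \<kappa> snr h (Suc i) = hop q s \<kappa> snr h i * transmitted q s \<kappa> snr h i"
  using i
proof (induction i)
  case 0
  have "hop q s \<kappa> snr h 0 = h 1"
    by (rule eq_matI) (auto simp: hop_def used_columns_def s_def)
  moreover have "h 1 * 1\<^sub>m (dim_col (h 1)) = h 1"
    by (rule right_mult_one_mat[of _ "dim_row (h 1)"], rule carrier_matI) (rule refl)+
  ultimately show ?case by simp
next
  case (Suc i)
  let ?E = "hop q s \<kappa> snr h i" and ?T = "transmitted q s \<kappa> snr h i" and ?E' = "hop q s \<kappa> snr h (Suc i)"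
  have IH: "?E = h (Suc i)" "AF_matrix \<kappa> snr h (Suc i) = ?E * ?T" using Suc by auto
  have h1: "h (Suc i) \<in> carrier_mat (n (Suc i)) (n i)" using h[of "Suc i"] Suc.prems by simp
  have h2: "h (Suc (Suc i)) \<in> carrier_mat (n (Suc (Suc i))) (n (Suc i))" using h[of "Suc (Suc i)"] Suc.prems by simp
  have "dim_row (transmitted q s \<kappa> snr h (Suc i)) = dim_row (h (Suc i))"
    by (simp add: dim_row_transmitted_Suc q_def)
  also have "\<dots> = dim_col (h (Suc (Suc i)))" using h1 h2 by simp
  finally have E': "?E' = h (Suc (Suc i))"
    by (intro eq_matI) (auto simp: hop_def used_columns_def s_def)
  have adj: "mat_adjoint (1\<^sub>m m) = (1\<^sub>m m :: complex mat)" for m by (rule eq_matI) auto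
  have N: "normalizer \<kappa> snr ?E \<in> carrier_mat (n (Suc i)) (n (Suc i))"
    using h1 unfolding IH(1) normalizer_def by simp
  have E: "?E \<in> carrier_mat (n (Suc i)) (n i)" unfolding IH(1) by (rule h1)
  have d: "dim_row ?E = n (Suc i)" using E by (rule carrier_matD(1))
  have qE: "q ?E = 1\<^sub>m (n (Suc i))" unfolding q_def by (simp only: d[unfolded q_def])
  have P: "relay q \<kappa> snr ?E = normalizer \<kappa> snr ?E"
    unfolding relay_def qE adj left_mult_one_mat[OF E] right_mult_one_mat[OF N] ..
  have T: "?E * ?T \<in> carrier_mat (n (Suc i)) (dim_col ?T)"
    by (rule carrier_matI) (simp_all only: index_mult_mat d)
  have "AF_matrix \<kappa> snr h (Suc (Suc i)) = ?E' * normalizer \<kappa> snr ?E * (?E * ?T)"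
    by (simp only: AF_matrix.simps E' IH)
  also have "\<dots> = ?E' * transmitted q s \<kappa> snr h (Suc i)"
    unfolding transmitted_Suc[of _ _ _ _ _ i] P by (rule assoc_mult_mat[OF h2[folded E'] N T])
  finally show ?case using E' by simp
qed

section \<open>Passing to the limit in the exponent\<close>

text \<open>The two logarithms differ by at most ln B, which vanishes after division by ln s. Since
  a finite null sequence is added, infinite limits are transferred as well.\<close>

lemma tendsto_ext_ln_comparable:
  fixes p q :: "real \<Rightarrow> real"
  assumes C: "0 \<le> C" and pq: "\<And>s. 1 \<le> s \<Longrightarrow> 0 \<le> p s \<and> 0 \<le> q s \<and> p s \<le> C * q s \<and> q s \<le> C * p s"
    and lim: "((\<lambda>s. - (ext_ln (p s) / ereal (ln s))) \<longlongrightarrow> d) at_top"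
  shows "((\<lambda>s. - (ext_ln (q s) / ereal (ln s))) \<longlongrightarrow> d) at_top"
proof -
  define B where "B = max C 1"
  have B: "1 \<le> B" "C \<le> B" by (auto simp: B_def)
  \<comment> \<open>Both probabilities vanish together. There the correction is set to 0, which
    keeps it finite while both exponents are infinite.\<close>
  define e where "e s = (if p s = 0 then 0 else (ln (p s) - ln (q s)) / ln s)" for s
  have ev: "eventually (\<lambda>s. 1 < s) (at_top :: real filter)" by (rule eventually_gt_at_top)
  have bound: "\<bar>e s\<bar> \<le> ln B / ln s" if s: "1 < s" for s
  proof (cases "p s = 0")
    case True
    then show ?thesis using s B by (simp add: e_def)
  next
    case False
    have *: "0 \<le> p s" "0 \<le> q s" "p s \<le> C * q s" "q s \<le> C * p s" using pq[of s] s by auto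
    then have "q s \<noteq> 0" using False by auto
    then have pos: "0 < p s" "0 < q s" using * False by auto
    have "p s \<le> B * q s" "q s \<le> B * p s"
      using * pos B by (meson mult_right_mono order_trans less_imp_le)+
    then have "ln (p s) \<le> ln (B * q s)" "ln (q s) \<le> ln (B * p s)"
      using pos B by simp_all
    then have "ln (p s) \<le> ln B + ln (q s)" "ln (q s) \<le> ln B + ln (p s)"
      using pos B by (simp_all add: ln_mult)
    then have "\<bar>ln (p s) - ln (q s)\<bar> \<le> ln B" by simp
    then show ?thesis using s False by (simp add: e_def divide_right_mono)
  qed
  have "((\<lambda>s. ln B / ln s) \<longlongrightarrow> 0) at_top"
    by (intro tendsto_divide_0[OF tendsto_const] filterlim_at_top_imp_at_infinity ln_at_top)
  then have "(e \<longlongrightarrow> 0) at_top"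
    by (rule Lim_null_comparison[rotated]) (use bound in \<open>auto intro: eventually_mono[OF ev]\<close>)
  then have "((\<lambda>s. - (ext_ln (p s) / ereal (ln s)) + ereal (e s)) \<longlongrightarrow> d + ereal 0) at_top"
    by (intro tendsto_add_ereal_general lim) auto
  moreover have "eventually (\<lambda>s. - (ext_ln (p s) / ereal (ln s)) + ereal (e s) = - (ext_ln (q s) / ereal (ln s))) at_top"
  proof (rule eventually_mono[OF ev])
    fix s :: real assume s: "1 < s"
    have *: "0 \<le> p s" "0 \<le> q s" "p s \<le> C * q s" "q s \<le> C * p s" using pq[of s] s by auto
    have "0 < ln s" using s by simp
    have pq0: "p s = 0 \<longleftrightarrow> q s = 0" using * by auto
    show "- (ext_ln (p s) / ereal (ln s)) + ereal (e s) = - (ext_ln (q s) / ereal (ln s))"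
    proof (cases "p s = 0")
      case True
      then show ?thesis using pq0 \<open>0 < ln s\<close> by (simp add: ext_ln_def e_def)
    next
      case False
      then show ?thesis using pq0 \<open>0 < ln s\<close> by (simp add: ext_ln_def e_def diff_divide_distrib)
    qed
  qed
  ultimately show ?thesis by (simp add: tendsto_cong)
qed


subsection \<open>Integrating out the channel matrices\<close>

definition entries :: "(nat \<Rightarrow> nat) \<Rightarrow> nat \<Rightarrow> (nat \<times> nat \<times> nat) set" where
  "entries n m = {(i, j, k). i \<in> {1..m} \<and> j < n i \<and> k < n (i - 1)}"

text \<open>Matrices are read off a flat family of entries, so that \<open>gauss_entries\<close> can
  serve as a canonical probability space.\<close>

definition channel :: "(nat \<Rightarrow> nat) \<Rightarrow> (nat \<times> nat \<times> nat \<Rightarrow> complex) \<Rightarrow> nat \<Rightarrow> complex mat" where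
  "channel n g i = mat (n i) (n (i - 1)) (\<lambda>(j, k). g (i, j, k))"

abbreviation gauss_entries :: "(nat \<Rightarrow> nat) \<Rightarrow> nat \<Rightarrow> (nat \<times> nat \<times> nat \<Rightarrow> complex) measure" where
  "gauss_entries n m \<equiv> \<Pi>\<^sub>M _\<in>entries n m. complex_gauss"

lemma dim_channel [simp]: "dim_row (channel n g i) = n i" "dim_col (channel n g i) = n (i - 1)"
  by (simp_all add: channel_def)

lemma entries_eq: "entries n m = (SIGMA i:{1..m}. idx (n i) (n (i - 1)))"
  by (auto simp: entries_def)

lemma finite_entries: "finite (entries n m)"
  unfolding entries_eq by auto

lemma entries_Suc:
  "entries n (Suc m) = entries n m \<union> Pair (Suc m) ` idx (n (Suc m)) (n m)"
  "entries n m \<inter> Pair (Suc m) ` idx (n (Suc m)) (n m) = {}"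
  by (auto simp: entries_def le_Suc_eq)

lemma measurable_channel:
  assumes "i \<in> {1..m}"
  shows "(\<lambda>g. channel n g i) \<in> gauss_entries n m \<rightarrow>\<^sub>M mat_borel"
  unfolding channel_def
proof (rule measurable_mat_fixed_dimI, unfold case_prod_conv)
  fix j k assume "j < n i" "k < n (i - 1)"
  then have "(i, j, k) \<in> entries n m" using assms by (simp add: entries_def)
  then have "(\<lambda>g. g (i, j, k)) \<in> gauss_entries n m \<rightarrow>\<^sub>M complex_gauss"
    by (rule measurable_component_singleton)
  then show "(\<lambda>g. g (i, j, k)) \<in> borel_measurable (gauss_entries n m)"
    by (simp add: measurable_cong_sets[OF refl sets_complex_gauss])
qed

lemma measurable_used_columns:
  assumes A[measurable]: "A \<in> M \<rightarrow>\<^sub>M mat_borel" and r: "r \<in> M \<rightarrow>\<^sub>M count_space UNIV"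
  shows "(\<lambda>x. used_columns s i (r x) (A x)) \<in> M \<rightarrow>\<^sub>M mat_borel"
proof (rule measurable_compose_countable[OF _ r])
  fix d
  show "(\<lambda>x. used_columns s i d (A x)) \<in> M \<rightarrow>\<^sub>M mat_borel"
    unfolding used_columns_def by (intro measurable_matI) (auto simp: case_prod_beta)
qed

lemma measurable_transmitted:
  assumes q: "projector q" and "i \<le> m"
  shows "(\<lambda>g. transmitted q s \<kappa> snr (channel n g) i) \<in> gauss_entries n m \<rightarrow>\<^sub>M mat_borel"
  using assms(2)
proof (induction i)
  case 0
  then show ?case by simp
next
  case (Suc i)
  have [measurable]: "(\<lambda>g. transmitted q s \<kappa> snr (channel n g) i) \<in> gauss_entries n m \<rightarrow>\<^sub>M mat_borel"
    using Suc by simp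
  have [measurable]: "(\<lambda>g. channel n g (Suc i)) \<in> gauss_entries n m \<rightarrow>\<^sub>M mat_borel"
    by (rule measurable_channel) (use Suc.prems in auto)
  have [measurable]: "(\<lambda>g. hop q s \<kappa> snr (channel n g) i) \<in> gauss_entries n m \<rightarrow>\<^sub>M mat_borel"
    unfolding hop_def by (rule measurable_used_columns) measurable
  note [measurable] = measurable_relay[OF q]
  show ?case unfolding transmitted_Suc by measurable
qed

lemma measurable_hop:
  assumes q: "projector q" and "i < m"
  shows "(\<lambda>g. hop q s \<kappa> snr (channel n g) i) \<in> gauss_entries n m \<rightarrow>\<^sub>M mat_borel"
proof -
  have [measurable]: "(\<lambda>g. transmitted q s \<kappa> snr (channel n g) i) \<in> gauss_entries n m \<rightarrow>\<^sub>M mat_borel"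
    by (rule measurable_transmitted[OF q]) (use assms in simp)
  have [measurable]: "(\<lambda>g. channel n g (Suc i)) \<in> gauss_entries n m \<rightarrow>\<^sub>M mat_borel"
    by (rule measurable_channel) (use assms in auto)
  show ?thesis unfolding hop_def by (rule measurable_used_columns) measurable
qed

text \<open>In contrast to \<open>antenna_selection\<close>, layer 0 is included, which makes the
  first hop no special case.\<close>

definition valid_selection :: "(nat \<Rightarrow> nat) \<Rightarrow> nat \<Rightarrow> (nat \<Rightarrow> nat \<Rightarrow> nat \<Rightarrow> nat) \<Rightarrow> bool" where
  "valid_selection n N s \<longleftrightarrow> (\<forall>i<N. \<forall>r\<le>n i. inj_on (s i r) {..<r} \<and> s i r ` {..<r} \<subseteq> {..<n i})"

lemma dim_row_transmitted_le:
  assumes "projector q"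
  shows "dim_row (transmitted q s \<kappa> snr (channel n g) i) \<le> n i"
proof (cases i)
  case (Suc l)
  have "dim_col (q (hop q s \<kappa> snr (channel n g) l)) \<le> dim_row (hop q s \<kappa> snr (channel n g) l)"
    using assms unfolding projector_def by blast
  then show ?thesis by (simp add: Suc dim_row_transmitted_Suc)
qed simp

text \<open>The transmitted matrix depends on the first \<open>i\<close> channel matrices only.
  Given it, the next hop consists of distinct columns of an independent Gaussian matrix and is
  Gaussian itself, with as many columns as there are transmitted signals.\<close>

lemma nn_integral_hop:
  assumes q: "projector q" and s: "valid_selection n N s" and i: "i < N"
    and \<Phi>[measurable]: "(\<lambda>(T, E). \<Phi> T E) \<in> borel_measurable (mat_borel \<Otimes>\<^sub>M mat_borel)"
  shows "(\<integral>\<^sup>+g. \<Phi> (transmitted q s \<kappa> snr (channel n g) i) (hop q s \<kappa> snr (channel n g) i) \<partial>gauss_entries n (Suc i)) =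
    (\<integral>\<^sup>+g. \<integral>\<^sup>+E. \<Phi> (transmitted q s \<kappa> snr (channel n g) i) E \<partial>gaussm (n (Suc i)) (dim_row (transmitted q s \<kappa> snr (channel n g) i)) \<partial>gauss_entries n i)"
proof -
  let ?a = "n (Suc i)"
  let ?K = "Pair (Suc i) ` idx ?a (n i)" and ?J = "entries n i"
  let ?f = "\<lambda>g. \<Phi> (transmitted q s \<kappa> snr (channel n g) i) (hop q s \<kappa> snr (channel n g) i)"
  have [measurable]: "(\<lambda>g. transmitted q s \<kappa> snr (channel n g) i) \<in> gauss_entries n (Suc i) \<rightarrow>\<^sub>M mat_borel"
    "(\<lambda>g. hop q s \<kappa> snr (channel n g) i) \<in> gauss_entries n (Suc i) \<rightarrow>\<^sub>M mat_borel"
    using measurable_transmitted[OF q, of i "Suc i"] measurable_hop[OF q, of i "Suc i"] by simp_all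
  have f: "?f \<in> borel_measurable (gauss_entries n (Suc i))"
    using \<Phi> by measurable
  have fin: "finite ?K" by simp
  have "(\<integral>\<^sup>+g. ?f g \<partial>gauss_entries n (Suc i)) =
      (\<integral>\<^sup>+x. \<integral>\<^sup>+y. ?f (merge ?J ?K (x, y)) \<partial>(\<Pi>\<^sub>M _\<in>?K. complex_gauss) \<partial>gauss_entries n i)"
    using f unfolding entries_Suc(1)
    by (rule gauss_product.product_nn_integral_fold[OF entries_Suc(2) finite_entries fin])
  also have "\<dots> = (\<integral>\<^sup>+x. \<integral>\<^sup>+E. \<Phi> (transmitted q s \<kappa> snr (channel n x) i) E \<partial>gaussm ?a (dim_row (transmitted q s \<kappa> snr (channel n x) i)) \<partial>gauss_entries n i)"
  proof (rule nn_integral_cong)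
    fix x
    define T where "T = transmitted q s \<kappa> snr (channel n x) i"
    define r where "r = dim_row T"
    have r: "r \<le> n i" unfolding r_def T_def by (rule dim_row_transmitted_le[OF q])
    have inj: "inj_on (s i r) {..<r}" and im: "s i r ` {..<r} \<subseteq> {..<n i}"
      using s i r unfolding valid_selection_def by blast+
    have T: "transmitted q s \<kappa> snr (channel n (merge ?J ?K (x, y))) i = T" for y
      unfolding T_def
    proof (rule transmitted_cong)
      fix l assume l: "l \<in> {1..i}"
      show "channel n (merge ?J ?K (x, y)) l = channel n x l"
        by (rule eq_matI) (use l in \<open>auto simp: channel_def merge_def entries_def\<close>)
    qed simp
    \<comment> \<open>Column \<open>k\<close> of the hop is column \<open>s i r k\<close> of the
      channel matrix. Since the selection is injective, the chosen entries are a reindexed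
      subfamily, whose law is again a product.\<close>
    let ?c = "\<lambda>(j, k). (Suc i, j, s i r k)"
    have c: "?c \<in> idx ?a r \<rightarrow> ?K" "inj_on ?c (idx ?a r)"
      using im inj by (auto simp: inj_on_def)
    have hop: "hop q s \<kappa> snr (channel n (merge ?J ?K (x, y))) i = mat ?a r (\<lambda>ij\<in>idx ?a r. y (?c ij))" for y
    proof (rule eq_matI)
      fix j k assume "j < dim_row (mat ?a r (\<lambda>ij\<in>idx ?a r. y (?c ij)))" "k < dim_col (mat ?a r (\<lambda>ij\<in>idx ?a r. y (?c ij)))"
      then have jk: "j < ?a" "k < r" by auto
      then have sk: "s i r k < n i" using im by auto
      have "(Suc i, j, s i r k) \<in> ?K" "(Suc i, j, s i r k) \<notin> ?J" using jk sk by (auto simp: entries_def)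
      then show "hop q s \<kappa> snr (channel n (merge ?J ?K (x, y))) i $$ (j, k) = mat ?a r (\<lambda>ij\<in>idx ?a r. y (?c ij)) $$ (j, k)"
        using jk sk unfolding hop_def T r_def[symmetric] by (simp add: used_columns_def channel_def merge_def)
    qed (simp_all add: T r_def)
    have [measurable]: "mat ?a r \<in> (\<Pi>\<^sub>M _\<in>idx ?a r. complex_gauss) \<rightarrow>\<^sub>M mat_borel"
      by (rule measurable_mat_PiM) simp
    have [measurable]: "(\<lambda>y. \<lambda>ij\<in>idx ?a r. y (?c ij)) \<in> (\<Pi>\<^sub>M _\<in>?K. complex_gauss) \<rightarrow>\<^sub>M (\<Pi>\<^sub>M _\<in>idx ?a r. complex_gauss)"
      by (rule measurable_restrict, rule measurable_component_singleton) (rule funcset_mem[OF c(1)])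
    have [measurable]: "(\<lambda>E. \<Phi> T E) \<in> borel_measurable mat_borel"
      using measurable_compose[OF _ \<Phi>, of "\<lambda>E. (T, E)" mat_borel] by simp
    have "(\<integral>\<^sup>+y. ?f (merge ?J ?K (x, y)) \<partial>(\<Pi>\<^sub>M _\<in>?K. complex_gauss)) =
        (\<integral>\<^sup>+y. \<Phi> T (mat ?a r (\<lambda>ij\<in>idx ?a r. y (?c ij))) \<partial>(\<Pi>\<^sub>M _\<in>?K. complex_gauss))"
      unfolding T hop ..
    also have "\<dots> = (\<integral>\<^sup>+g. \<Phi> T (mat ?a r g) \<partial>distr (\<Pi>\<^sub>M _\<in>?K. complex_gauss) (\<Pi>\<^sub>M _\<in>idx ?a r. complex_gauss) (\<lambda>y. \<lambda>ij\<in>idx ?a r. y (?c ij)))"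
      by (rule nn_integral_distr[symmetric]) measurable
    also have "distr (\<Pi>\<^sub>M _\<in>?K. complex_gauss) (\<Pi>\<^sub>M _\<in>idx ?a r. complex_gauss) (\<lambda>y. \<lambda>ij\<in>idx ?a r. y (?c ij)) = (\<Pi>\<^sub>M _\<in>idx ?a r. complex_gauss)"
      by (rule distr_PiM_reindex[where M = "\<lambda>_. complex_gauss", OF prob_space_complex_gauss c(2) c(1)])
    also have "(\<integral>\<^sup>+g. \<Phi> T (mat ?a r g) \<partial>(\<Pi>\<^sub>M _\<in>idx ?a r. complex_gauss)) = (\<integral>\<^sup>+E. \<Phi> T E \<partial>gaussm ?a r)"
      by (rule nn_integral_gaussm[symmetric]) measurable
    finally show "(\<integral>\<^sup>+y. ?f (merge ?J ?K (x, y)) \<partial>(\<Pi>\<^sub>M _\<in>?K. complex_gauss)) =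
        (\<integral>\<^sup>+E. \<Phi> (transmitted q s \<kappa> snr (channel n x) i) E \<partial>gaussm ?a (dim_row (transmitted q s \<kappa> snr (channel n x) i)))"
      unfolding r_def T_def .
  qed
  finally show ?thesis .
qed

text \<open>The left-hand side does not depend on \<open>i\<close>: integrating out the last of the
  \<open>Suc i\<close> channel matrices performs one unfolding of \<open>relayed_outage\<close> in
  reverse.\<close>

lemma nn_integral_relayed_outage_transmitted:
  assumes q: "projector q" and s: "valid_selection n N s" and i: "i < N"
  shows "(\<integral>\<^sup>+g. relayed_outage q \<kappa> snr R (map n [Suc i..<Suc N]) (transmitted q s \<kappa> snr (channel n g) i) \<partial>gauss_entries n i) =
    relayed_outage q \<kappa> snr R (map n [1..<Suc N]) (1\<^sub>m (n 0))"
  using i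
proof (induction i)
  case 0
  \<comment> \<open>There are no entries to integrate: the measure has total mass 1 and the
    integrand is constant.\<close>
  interpret prob_space "gauss_entries n 0" by (rule prob_space_PiM) (rule prob_space_complex_gauss)
  show ?case using emeasure_space_1 by simp
next
  case (Suc i)
  note [measurable] = measurable_relay[OF q] measurable_relayed_outage[OF q]
  \<comment> \<open>Because \<open>Suc i < N\<close>, at least two sizes remain and the equation for
    a hop with a relay applies.\<close>
  have l: "map n [Suc i..<Suc N] = n (Suc i) # n (Suc (Suc i)) # map n [Suc (Suc (Suc i))..<Suc N]"
    "map n [Suc (Suc i)..<Suc N] = n (Suc (Suc i)) # map n [Suc (Suc (Suc i))..<Suc N]"
    using Suc.prems by (simp_all add: upt_conv_Cons del: upt_Suc)
  let ?F = "relayed_outage q \<kappa> snr R (map n [Suc (Suc i)..<Suc N])"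
  have "(\<integral>\<^sup>+g. ?F (transmitted q s \<kappa> snr (channel n g) (Suc i)) \<partial>gauss_entries n (Suc i)) =
     (\<integral>\<^sup>+g. \<integral>\<^sup>+E. ?F (relay q \<kappa> snr E * (E * transmitted q s \<kappa> snr (channel n g) i))
       \<partial>gaussm (n (Suc i)) (dim_row (transmitted q s \<kappa> snr (channel n g) i)) \<partial>gauss_entries n i)"
    unfolding transmitted_Suc
    by (rule nn_integral_hop[where \<Phi> = "\<lambda>T E. ?F (relay q \<kappa> snr E * (E * T))", OF q s]) (use Suc.prems in auto)
  also have "\<dots> = (\<integral>\<^sup>+g. relayed_outage q \<kappa> snr R (map n [Suc i..<Suc N]) (transmitted q s \<kappa> snr (channel n g) i) \<partial>gauss_entries n i)"
    unfolding l relayed_outage.simps ..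
  also have "\<dots> = relayed_outage q \<kappa> snr R (map n [1..<Suc N]) (1\<^sub>m (n 0))"
    by (rule Suc.IH) (use Suc.prems in simp)
  finally show ?case .
qed

text \<open>The destination does not process what it receives, so the last hop is integrated without
  a relay; this is the singleton case of \<open>relayed_outage\<close>.\<close>

lemma emeasure_gauss_entries_outage:
  assumes q: "projector q" and s: "valid_selection n (Suc m) s"
  shows "emeasure (gauss_entries n (Suc m)) {g \<in> space (gauss_entries n (Suc m)).
      outage snr R (hop q s \<kappa> snr (channel n g) m * transmitted q s \<kappa> snr (channel n g) m)} =
    relayed_outage q \<kappa> snr R (map n [1..<Suc (Suc m)]) (1\<^sub>m (n 0))"
proof -
  have [measurable]: "(\<lambda>g. transmitted q s \<kappa> snr (channel n g) m) \<in> gauss_entries n (Suc m) \<rightarrow>\<^sub>M mat_borel"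
    "(\<lambda>g. hop q s \<kappa> snr (channel n g) m) \<in> gauss_entries n (Suc m) \<rightarrow>\<^sub>M mat_borel"
    using measurable_transmitted[OF q, of m "Suc m"] measurable_hop[OF q, of m "Suc m"] by simp_all
  let ?F = "gauss_outage snr R []"
  have "emeasure (gauss_entries n (Suc m)) {g \<in> space (gauss_entries n (Suc m)).
      outage snr R (hop q s \<kappa> snr (channel n g) m * transmitted q s \<kappa> snr (channel n g) m)} =
    (\<integral>\<^sup>+g. indicator {g \<in> space (gauss_entries n (Suc m)).
      outage snr R (hop q s \<kappa> snr (channel n g) m * transmitted q s \<kappa> snr (channel n g) m)} g \<partial>gauss_entries n (Suc m))"
    by (rule nn_integral_indicator[symmetric]) measurable
  also have "\<dots> = (\<integral>\<^sup>+g. ?F (hop q s \<kappa> snr (channel n g) m * transmitted q s \<kappa> snr (channel n g) m) \<partial>gauss_entries n (Suc m))"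
    by (rule nn_integral_cong) (simp add: indicator_def)
  also have "\<dots> = (\<integral>\<^sup>+g. \<integral>\<^sup>+E. ?F (E * transmitted q s \<kappa> snr (channel n g) m)
       \<partial>gaussm (n (Suc m)) (dim_row (transmitted q s \<kappa> snr (channel n g) m)) \<partial>gauss_entries n m)"
    by (rule nn_integral_hop[where \<Phi> = "\<lambda>T E. ?F (E * T)", OF q s]) auto
  also have "\<dots> = (\<integral>\<^sup>+g. relayed_outage q \<kappa> snr R (map n [Suc m..<Suc (Suc m)]) (transmitted q s \<kappa> snr (channel n g) m) \<partial>gauss_entries n m)"
    by simp
  also have "\<dots> = relayed_outage q \<kappa> snr R (map n [1..<Suc (Suc m)]) (1\<^sub>m (n 0))"
    by (rule nn_integral_relayed_outage_transmitted[OF q s]) simp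
  finally show ?thesis .
qed

section \<open>Transfer from the given probability space to the product of Gaussian entries\<close>

context multihop_channel
begin

lemma distr_entries:
  "distr M (\<Pi>\<^sub>M _\<in>entries n N. borel) (\<lambda>\<omega>. \<lambda>x\<in>entries n N. case x of (i, j, k) \<Rightarrow> H i \<omega> $$ (j, k)) = gauss_entries n N"
proof -
  let ?X = "\<lambda>(i, j, k) \<omega>. H i \<omega> $$ (j, k)"
  have d: "distributed M lborel (?X x) (\<lambda>z. ennreal (exp (- (cmod z)\<^sup>2) / pi))" if "x \<in> entries n N" for x
    using that H_gaussian by (auto simp: entries_def)
  have rv: "?X x \<in> borel_measurable M" if "x \<in> entries n N" for x
    using distributed_measurable[OF d[OF that]] by simp
  \<comment> \<open>The characterization of independence by a product law is applied to a nonempty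
    index set.\<close>
  have "(1, 0, 0) \<in> entries n N" using hops antennas[of 0] antennas[of 1] by (auto simp: entries_def)
  then have ne: "entries n N \<noteq> {}" by auto
  have ind: "indep_vars (\<lambda>_. borel) ?X (entries n N)" using H_indep unfolding entries_def .
  have "distr M (\<Pi>\<^sub>M _\<in>entries n N. borel) (\<lambda>\<omega>. \<lambda>x\<in>entries n N. ?X x \<omega>) = (\<Pi>\<^sub>M x\<in>entries n N. distr M borel (?X x))"
    using indep_vars_iff_distr_eq_PiM'[where M' = "\<lambda>_. borel" and X = ?X, OF ne rv] ind by blast
  also have "\<dots> = gauss_entries n N"
  proof (rule PiM_cong[OF refl])
    fix x assume x: "x \<in> entries n N"
    have "distr M borel (?X x) = distr M lborel (?X x)" by (rule distr_cong) simp_all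
    then show "distr M borel (?X x) = complex_gauss"
      using distributed_distr_eq_density[OF d[OF x]] by (simp add: complex_gauss_def)
  qed
  finally show ?thesis by (simp add: case_prod_beta)
qed

text \<open>The selection \<open>s\<close> has disappeared on the right: the two schemes are now
  distinguished by \<open>q\<close> alone.\<close>

lemma outage_prob_eq_relayed_outage:
  assumes q: "projector q" and s: "valid_selection n N s"
    and A: "\<And>snr \<omega>. \<omega> \<in> space M \<Longrightarrow> A snr \<omega> =
      hop q s \<kappa> snr (\<lambda>i. H i \<omega>) (N - 1) * transmitted q s \<kappa> snr (\<lambda>i. H i \<omega>) (N - 1)"
  shows "ennreal (outage_prob M A R snr) = relayed_outage q \<kappa> snr R (map n [1..<Suc N]) (1\<^sub>m (n 0))"
proof -
  obtain m where N: "N = Suc m" using hops by (cases N) auto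
  let ?G = "gauss_entries n N" and ?B = "\<Pi>\<^sub>M _\<in>entries n N. (borel :: complex measure)"
  let ?Y = "\<lambda>\<omega>. \<lambda>x\<in>entries n N. case x of (i, j, k) \<Rightarrow> H i \<omega> $$ (j, k)"
  let ?Z = "\<lambda>h. hop q s \<kappa> snr h m * transmitted q s \<kappa> snr h m"
  have ch: "channel n (?Y \<omega>) l = H l \<omega>" if "\<omega> \<in> space M" "l \<in> {1..N}" for \<omega> l
    by (rule eq_matI) (use that H_carrier[OF that(2,1)] in \<open>auto simp: channel_def entries_def\<close>)
  have Z: "?Z (channel n (?Y \<omega>)) = A snr \<omega>" if \<omega>: "\<omega> \<in> space M" for \<omega>
  proof -
    have "transmitted q s \<kappa> snr (channel n (?Y \<omega>)) m = transmitted q s \<kappa> snr (\<lambda>i. H i \<omega>) m"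
      by (rule transmitted_cong) (use ch[OF \<omega>] N in auto)
    moreover have "channel n (?Y \<omega>) (Suc m) = H (Suc m) \<omega>" by (rule ch[OF \<omega>]) (simp add: N)
    ultimately show ?thesis unfolding A[OF \<omega>] hop_def by (simp only: N diff_Suc_1)
  qed
  have sets: "sets ?B = sets ?G" by (rule sets_PiM_cong) simp_all
  have Y: "?Y \<in> M \<rightarrow>\<^sub>M ?B"
  proof (rule measurable_restrict)
    fix x assume x: "x \<in> entries n N"
    obtain i j k where "x = (i, j, k)" by (cases x)
    then show "(\<lambda>\<omega>. case x of (i, j, k) \<Rightarrow> H i \<omega> $$ (j, k)) \<in> borel_measurable M"
      using x H_gaussian[of i j k, THEN distributed_measurable] by (simp add: entries_def)
  qed
  let ?S = "{g \<in> space ?G. outage snr R (?Z (channel n g))}"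
  have [measurable]: "(\<lambda>g. transmitted q s \<kappa> snr (channel n g) m) \<in> ?G \<rightarrow>\<^sub>M mat_borel"
    "(\<lambda>g. hop q s \<kappa> snr (channel n g) m) \<in> ?G \<rightarrow>\<^sub>M mat_borel"
    using measurable_transmitted[OF q, of m N] measurable_hop[OF q, of m N] N by simp_all
  have S: "?S \<in> sets ?B" unfolding sets by measurable
  have pre: "?Y -` ?S \<inter> space M = {\<omega> \<in> space M. outage snr R (A snr \<omega>)}"
    using Z by (auto simp: space_PiM complex_gauss_def)
  have "emeasure ?G ?S = emeasure (distr M ?B ?Y) ?S" by (simp only: distr_entries)
  also have "\<dots> = emeasure M {\<omega> \<in> space M. outage snr R (A snr \<omega>)}"
    unfolding emeasure_distr[OF Y S] pre ..
  finally have "emeasure ?G ?S = emeasure M {\<omega> \<in> space M. outage snr R (A snr \<omega>)}" .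
  moreover have "emeasure ?G ?S = relayed_outage q \<kappa> snr R (map n [1..<Suc N]) (1\<^sub>m (n 0))"
    using emeasure_gauss_entries_outage[OF q s[unfolded N]] unfolding N .
  ultimately show ?thesis
    unfolding outage_prob_def outage_def[symmetric] by (simp add: emeasure_eq_measure)
qed

end

theorem propositionV2:
  fixes M :: "'a measure" and N :: nat and n :: "nat \<Rightarrow> nat"
    and H :: "nat \<Rightarrow> 'a \<Rightarrow> complex mat"
    and sel :: "nat \<Rightarrow> nat \<Rightarrow> nat \<Rightarrow> nat"
    and \<kappa> R0 r :: real and d :: ereal
  assumes "multihop_channel M N n H"
    and "antenna_selection N n sel"
    and "0 < \<kappa>" and "0 < R0" and "0 \<le> r"
  shows "has_DMT M (\<lambda>snr \<omega>. PF_matrix sel \<kappa> snr (\<lambda>i. H i \<omega>) N) R0 r d \<longleftrightarrow>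
         has_DMT M (\<lambda>snr \<omega>. AF_matrix \<kappa> snr (\<lambda>i. H i \<omega>) N) R0 r d"
proof -
  interpret multihop_channel M N n H by fact
  obtain m where N: "N = Suc m" using hops by (cases N) auto
  let ?PF = "\<lambda>snr \<omega>. PF_matrix sel \<kappa> snr (\<lambda>i. H i \<omega>) N" and ?AF = "\<lambda>snr \<omega>. AF_matrix \<kappa> snr (\<lambda>i. H i \<omega>) N"
  let ?I = "\<lambda>E. 1\<^sub>m (dim_row E) :: complex mat" and ?s = "sel(0 := \<lambda>r k. k)" and ?t = "\<lambda>i r k. k"
  let ?ns = "map n [1..<Suc N]"
  have s: "valid_selection n N ?s"
    using \<open>antenna_selection N n sel\<close> unfolding valid_selection_def antenna_selection_def by auto
  have t: "valid_selection n N ?t" unfolding valid_selection_def by auto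
  have PF: "ennreal (outage_prob M ?PF R snr) = relayed_outage PF_Q \<kappa> snr R ?ns (1\<^sub>m (n 0))" for R snr
    by (rule outage_prob_eq_relayed_outage[OF projector_PF_Q s])
      (simp add: N PF_matrix_eq_hop[OF refl])
  have AF: "ennreal (outage_prob M ?AF R snr) = relayed_outage ?I \<kappa> snr R ?ns (1\<^sub>m (n 0))" for R snr
  proof (rule outage_prob_eq_relayed_outage[OF projector_identity t])
    fix snr \<omega> assume "\<omega> \<in> space M"
    then show "?AF snr \<omega> = hop ?I ?t \<kappa> snr (\<lambda>i. H i \<omega>) (N - 1) * transmitted ?I ?t \<kappa> snr (\<lambda>i. H i \<omega>) (N - 1)"
      using AF_matrix_eq_hop[of N "\<lambda>i. H i \<omega>" n m \<kappa> snr] H_carrier by (simp add: N)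
  qed
  \<comment> \<open>The schemes are compared through the Gaussian product without relays, not
    directly with each other.\<close>
  have "comparable (\<lambda>snr R. relayed_outage PF_Q \<kappa> snr R ?ns) (\<lambda>snr R. relayed_outage ?I \<kappa> snr R ?ns)"
    using relayed_outage_comparable[OF projector_PF_Q \<open>0 < \<kappa>\<close>] relayed_outage_comparable[OF projector_identity \<open>0 < \<kappa>\<close>]
    by (blast intro: comparable_trans comparable_sym)
  \<comment> \<open>One constant suffices, since both functionals are evaluated at the identity of
    size \<open>n 0\<close>.\<close>
  then obtain C where C: "0 \<le> C" and cmp: "\<And>snr R X. 1 \<le> snr \<Longrightarrow> dim_row X = n 0 \<Longrightarrow>
      relayed_outage PF_Q \<kappa> snr R ?ns X \<le> ennreal C * relayed_outage ?I \<kappa> snr R ?ns X \<and>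
      relayed_outage ?I \<kappa> snr R ?ns X \<le> ennreal C * relayed_outage PF_Q \<kappa> snr R ?ns X"
    unfolding comparable_def by meson
  have nonneg: "0 \<le> outage_prob M A R snr" for A R snr by (simp add: outage_prob_def)
  have "outage_prob M ?PF R snr \<le> C * outage_prob M ?AF R snr \<and> outage_prob M ?AF R snr \<le> C * outage_prob M ?PF R snr"
    if "1 \<le> snr" for snr R
    using cmp[OF that, of "1\<^sub>m (n 0)" R] C nonneg unfolding PF[symmetric] AF[symmetric]
    by (simp add: ennreal_mult[symmetric])
  \<comment> \<open>The bound holds for every \<open>R\<close>, hence at the rate belonging to each
    \<open>snr\<close>; its symmetry yields both directions.\<close>
  then show ?thesis
    unfolding has_DMT_def using C nonneg
    by (intro iffI; elim tendsto_ext_ln_comparable[rotated 2]) auto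
qed

end
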